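(* Let $\Gamma=\mathbb{Z}(1,0)\oplus\mathbb{Z}(c,d)\subset\mathbb{R}^2$, where $0\leqslant c\leqslant\frac12$, $d>0$ and $c^2+d^2=1$, and let $g_{c,d}$ be the corresponding flat metric of unit area on $\mathbb{T}^2$. Set $\mathcal{C}=[g_{c,d}]$. Then the isoperimetric inequality $$\bar\lambda_1(\mathbb{T}^2,g)\leqslant\lambda_1(\mathbb{T}^2,g_{c,d})=\Lambda_1(\mathbb{T}^2,[g_{c,d}]),\qquad g\in[g_{c,d}],$$ is quantitatively stable; that is, there exist constants $\delta,c_0>0$ such that for any admissible measure $\mu$ with $\Lambda_1(\mathbb{T}^2,\mathcal{C})-\bar\lambda_1(\mathbb{T}^2,\mathcal{C},\mu)<\delta$ there exists a $\bar\lambda_1$-conformally maximal metric $g_{\max}\in\mathcal{C}$ (possibly with finitely many conical singularities) such that $$\Lambda_1(\mathbb{T}^2,\mathcal{C})-\bar\lambda_1(\mathbb{T}^2,\mathcal{C},\mu)\geqslant c_0\,\big\|\lambda_1(\mathbb{T}^2,g_{\max})\,dv_{g_{\max}}-\lambda_1(\mathbb{T}^2,\mathcal{C},\mu)\,\mu\big\|^2_{W^{-1,2}(\mathbb{T}^2,g_{c,d})}.$$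
   Context: It is a known theorem (El Soufi–Ilias–Ros) that the displayed isoperimetric inequality holds, i.e. $g_{c,d}$ is $\bar\lambda_1$-conformally maximal. For a metric $h\in\mathcal{C}$, $\lambda_k(M,h)$ is the $k$-th nonzero Laplace eigenvalue, $\bar\lambda_k(M,h)=\lambda_k(M,h)\,\mathrm{Area}(M,h)$, $\Lambda_k(M,\mathcal{C})=\sup_{h\in\mathcal{C}}\bar\lambda_k(M,h)$; a metric $h\in\mathcal{C}$ (possibly with conical singularities) is $\bar\lambda_1$-conformally maximal if $\bar\lambda_1(M,h)=\Lambda_1(M,\mathcal{C})$. A nonzero (nonnegative) Radon measure $\mu$ on $M=\mathbb{T}^2$ is admissible if the identity map on $C^\infty(M)$ extends to a compact operator $W^{1,2}(M,g_{c,d})\to L^2(M,\mu)$. For admissible $\mu$, $$\lambda_k(M,\mathcal{C},\mu)=\inf_{E_{k+1}}\ \sup_{0\neq f\in E_{k+1}}\frac{\int_M|\nabla f|^2_{g_{c,d}}\,dv_{g_{c,d}}}{\int_M f^2\,d\mu},$$ the infimum being over all $(k+1)$-dimensional subspaces $E_{k+1}\subset C^\infty(M)$ which are also $(k+1)$-dimensional in $L^2(M,\mu)$; $\bar\lambda_k(M,\mathcal{C},\mu)=\lambda_k(M,\mathcal{C},\mu)\mu(M)$. The norm is $\|\sigma\|_{W^{-1,2}(M,g)}=\sup\{\int_M f\,d\sigma: f\in C^\infty(M),\ \|f\|_{W^{1,2}(M,g)}=1\}$. *)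

theory Defs
  imports "HOL-Analysis.Analysis" "HOL-Library.Function_Algebras"
begin

text \<open>Real-valued functions on a set form a real vector space, so that the library's
  \<open>subspace\<close> and \<open>dim\<close> apply to spaces of test functions and to eigenspaces.\<close>

instantiation "fun" :: (type, real_vector) real_vector
begin

definition scaleR_fun :: "real \<Rightarrow> ('a \<Rightarrow> 'b) \<Rightarrow> 'a \<Rightarrow> 'b"
  where "scaleR_fun r f = (\<lambda>x. r *\<^sub>R f x)"

instance
  by standard (auto simp: scaleR_fun_def fun_eq_iff scaleR_add_right scaleR_add_left)

end

text \<open>The torus is \<open>M = \<real>\<^sup>2 / \<Gamma>\<close>. A function on \<open>M\<close> is represented by its \<open>\<Gamma>\<close>-periodic lift to
  the plane. As a Borel space \<open>M\<close> is identified with the half-open fundamental parallelogram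
  (the quotient map restricts to a Borel isomorphism from it onto \<open>M\<close>), so measures on \<open>M\<close>
  are measures on \<open>torus_dom\<close>.\<close>

type_synonym plane = "real \<times> real"

definition torus_lattice :: "real \<Rightarrow> real \<Rightarrow> plane set" where
  "torus_lattice c d = {of_int m *\<^sub>R (1, 0) + of_int n *\<^sub>R (c, d) | m n. True}"

definition torus_dom :: "real \<Rightarrow> real \<Rightarrow> plane set" where
  "torus_dom c d = {s *\<^sub>R (1, 0) + t *\<^sub>R (c, d) | s t. 0 \<le> s \<and> s < 1 \<and> 0 \<le> t \<and> t < 1}"

definition periodic :: "real \<Rightarrow> real \<Rightarrow> (plane \<Rightarrow> 'b) \<Rightarrow> bool" where
  "periodic c d f \<longleftrightarrow> (\<forall>x. \<forall>\<gamma>\<in>torus_lattice c d. f (x + \<gamma>) = f x)"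

text \<open>Smoothness is only meant for open sets \<open>U\<close>.\<close>

primrec Ck_on :: "nat \<Rightarrow> (plane \<Rightarrow> real) \<Rightarrow> plane set \<Rightarrow> bool" where
  "Ck_on 0 f U \<longleftrightarrow> continuous_on U f"
| "Ck_on (Suc n) f U \<longleftrightarrow>
     f differentiable_on U \<and> (\<forall>v. Ck_on n (\<lambda>x. frechet_derivative f (at x) v) U)"

definition smooth_on :: "(plane \<Rightarrow> real) \<Rightarrow> plane set \<Rightarrow> bool" where
  "smooth_on f U \<longleftrightarrow> (\<forall>n. Ck_on n f U)"

definition smooth_torus :: "real \<Rightarrow> real \<Rightarrow> (plane \<Rightarrow> real) set" where
  "smooth_torus c d = {f. periodic c d f \<and> smooth_on f UNIV}"

text \<open>Gradient and Laplacian (the trace of the Hessian) of the Euclidean metric of the plane.\<close>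

definition eucl_grad :: "(plane \<Rightarrow> real) \<Rightarrow> plane \<Rightarrow> plane" where
  "eucl_grad f x = (\<Sum>b\<in>Basis. frechet_derivative f (at x) b *\<^sub>R b)"

definition eucl_laplacian :: "(plane \<Rightarrow> real) \<Rightarrow> plane \<Rightarrow> real" where
  "eucl_laplacian f x =
     (\<Sum>b\<in>Basis. frechet_derivative (\<lambda>y. frechet_derivative f (at y) b) (at x) b)"

text \<open>The lattice has covolume \<open>d\<close>, hence the flat metric of unit area is
  \<open>g\<^sub>c\<^sub>,\<^sub>d = (1/d)\<close> times the Euclidean one. A metric \<open>h = \<rho> g\<^sub>c\<^sub>,\<^sub>d\<close> conformal to it is represented
  by its conformal factor \<open>\<rho>\<close>; \<open>g\<^sub>c\<^sub>,\<^sub>d\<close> itself is \<open>\<rho> = 1\<close>. Accordingly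
  \<open>dv\<^sub>h = (\<rho>/d) dx\<close> and \<open>\<Delta>\<^sub>h = (d/\<rho>) \<Delta>\<close>, and the squared \<open>g\<^sub>c\<^sub>,\<^sub>d\<close>-length of the
  \<open>g\<^sub>c\<^sub>,\<^sub>d\<close>-gradient is \<open>d\<close> times its Euclidean counterpart.\<close>

definition flat_metric :: "plane \<Rightarrow> real" where
  "flat_metric = (\<lambda>_. 1)"

definition vol :: "real \<Rightarrow> real \<Rightarrow> (plane \<Rightarrow> real) \<Rightarrow> plane measure" where
  "vol c d \<rho> = density (restrict_space lborel (torus_dom c d)) (\<lambda>x. ennreal (\<rho> x / d))"

definition area :: "real \<Rightarrow> real \<Rightarrow> (plane \<Rightarrow> real) \<Rightarrow> real" where
  "area c d \<rho> = measure (vol c d \<rho>) (torus_dom c d)"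

definition laplacian :: "real \<Rightarrow> (plane \<Rightarrow> real) \<Rightarrow> (plane \<Rightarrow> real) \<Rightarrow> plane \<Rightarrow> real" where
  "laplacian d \<rho> f x = (d / \<rho> x) * eucl_laplacian f x"

definition conformal_class :: "real \<Rightarrow> real \<Rightarrow> (plane \<Rightarrow> real) set" where
  "conformal_class c d = {\<rho>\<in>smooth_torus c d. \<forall>x. 0 < \<rho> x}"

text \<open>Conical singularities: \<open>\<rho>\<close> is the factor of a smooth metric near every point outside a set
  that is finite modulo \<open>\<Gamma>\<close>, and near an exceptional point \<open>p\<close> it is \<open>\<bar>x - p\<bar>\<^bsup>2\<beta>\<^esup>\<close> times a smooth
  positive function, with \<open>\<beta> > -1\<close>. The value of \<open>\<rho>\<close> at \<open>p\<close> itself is irrelevant.\<close>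

definition regular_points :: "(plane \<Rightarrow> real) \<Rightarrow> plane set" where
  "regular_points \<rho> = {x. \<exists>r>0. smooth_on \<rho> (ball x r) \<and> (\<forall>y\<in>ball x r. 0 < \<rho> y)}"

definition conical_conformal_class :: "real \<Rightarrow> real \<Rightarrow> (plane \<Rightarrow> real) set" where
  "conical_conformal_class c d = {\<rho>. periodic c d \<rho> \<and>
     finite (torus_dom c d - regular_points \<rho>) \<and>
     (\<forall>p. p \<notin> regular_points \<rho> \<longrightarrow>
        (\<exists>\<beta>>-1. \<exists>r>0. \<exists>v. smooth_on v (ball p r) \<and> (\<forall>x\<in>ball p r. 0 < v x) \<and>
           (\<forall>x\<in>ball p r - {p}. \<rho> x = norm (x - p) powr (2 * \<beta>) * v x)))}"

text \<open>Eigenfunctions of the Laplacian of \<open>h = \<rho> g\<^sub>c\<^sub>,\<^sub>d\<close>. For a smooth metric every point is regular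
  and these are the classical smooth eigenfunctions. For a metric with conical singularities,
  continuity at the cone points selects the Friedrichs extension: isolated singularities of
  bounded solutions are removable for the weak equation, and weak solutions are continuous.\<close>

definition eigenspace :: "real \<Rightarrow> real \<Rightarrow> (plane \<Rightarrow> real) \<Rightarrow> real \<Rightarrow> (plane \<Rightarrow> real) set" where
  "eigenspace c d \<rho> \<nu> = {f. periodic c d f \<and> continuous_on UNIV f \<and>
     smooth_on f (regular_points \<rho>) \<and>
     (\<forall>x\<in>regular_points \<rho>. - laplacian d \<rho> f x = \<nu> * f x)}"

text \<open>The \<open>k\<close>-th nonzero (\<open>k \<ge> 1\<close>) eigenvalue, counted with multiplicity: the least \<open>l\<close> such that
  the eigenspaces of the eigenvalues in \<open>(0, l]\<close> have total dimension at least \<open>k\<close>. Eigenfunctions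
  of distinct eigenvalues are linearly independent, so this total is the dimension of (the span of) the union, and it is finite.\<close>

definition laplace_eigenvalue :: "nat \<Rightarrow> real \<Rightarrow> real \<Rightarrow> (plane \<Rightarrow> real) \<Rightarrow> real" where
  "laplace_eigenvalue k c d \<rho> = Inf {l. k \<le> dim (\<Union>\<nu>\<in>{0<..l}. eigenspace c d \<rho> \<nu>)}"

definition norm_eigenvalue :: "nat \<Rightarrow> real \<Rightarrow> real \<Rightarrow> (plane \<Rightarrow> real) \<Rightarrow> real" where
  "norm_eigenvalue k c d \<rho> = laplace_eigenvalue k c d \<rho> * area c d \<rho>"

definition conf_eigenvalue :: "nat \<Rightarrow> real \<Rightarrow> real \<Rightarrow> real" where
  "conf_eigenvalue k c d = (SUP \<rho>\<in>conformal_class c d. norm_eigenvalue k c d \<rho>)"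

definition conformally_maximal :: "nat \<Rightarrow> real \<Rightarrow> real \<Rightarrow> (plane \<Rightarrow> real) \<Rightarrow> bool" where
  "conformally_maximal k c d \<rho> \<longleftrightarrow>
     \<rho> \<in> conical_conformal_class c d \<and> norm_eigenvalue k c d \<rho> = conf_eigenvalue k c d"

text \<open>Representatives of the elements of \<open>L\<^sup>2\<close>.\<close>

definition L2 :: "'a measure \<Rightarrow> ('a \<Rightarrow> 'b::euclidean_space) set" where
  "L2 M = {f \<in> borel_measurable M. integrable M (\<lambda>x. (norm (f x))\<^sup>2)}"

text \<open>The \<open>W\<^sup>1\<^sup>,\<^sup>2(M, g\<^sub>c\<^sub>,\<^sub>d)\<close>-norm of a function \<open>u\<close> with (Euclidean) weak gradient \<open>G\<close>.\<close>

definition W12_norm :: "real \<Rightarrow> real \<Rightarrow> (plane \<Rightarrow> real) \<Rightarrow> (plane \<Rightarrow> plane) \<Rightarrow> real" where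
  "W12_norm c d u G =
     sqrt ((\<integral>x. (u x)\<^sup>2 \<partial>vol c d flat_metric) + (\<integral>x. d * (norm (G x))\<^sup>2 \<partial>vol c d flat_metric))"

text \<open>\<open>W\<^sup>1\<^sup>,\<^sup>2(M, g\<^sub>c\<^sub>,\<^sub>d)\<close> as the completion of \<open>C\<^sup>\<infinity>(M)\<close>, realised inside \<open>L\<^sup>2\<close>: the pairs of a function
  and its weak gradient that are limits of smooth functions in the above norm.\<close>

definition W12 :: "real \<Rightarrow> real \<Rightarrow> ((plane \<Rightarrow> real) \<times> (plane \<Rightarrow> plane)) set" where
  "W12 c d = {(u, G). periodic c d u \<and> periodic c d G \<and>
     u \<in> L2 (vol c d flat_metric) \<and> G \<in> L2 (vol c d flat_metric) \<and>
     (\<exists>f :: nat \<Rightarrow> plane \<Rightarrow> real. (\<forall>n. f n \<in> smooth_torus c d) \<and>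
        (\<lambda>n. W12_norm c d (f n - u) (eucl_grad (f n) - G)) \<longlonglongrightarrow> 0)}"

text \<open>On the compact metrizable space \<open>M\<close> the Radon measures are the finite Borel measures.\<close>

definition radon_measure :: "real \<Rightarrow> real \<Rightarrow> plane measure \<Rightarrow> bool" where
  "radon_measure c d \<mu> \<longleftrightarrow>
     sets \<mu> = sets (restrict_space borel (torus_dom c d)) \<and> finite_measure \<mu>"

text \<open>\<open>T\<close> is a linear operator from \<open>W\<^sup>1\<^sup>,\<^sup>2(M, g\<^sub>c\<^sub>,\<^sub>d)\<close> to \<open>L\<^sup>2(M, \<mu>)\<close>, given on representatives, which
  maps bounded sequences to sequences with convergent subsequences. (Linearity and compactness
  make it bounded, hence independent of the representative.)\<close>

definition compact_W12_L2 ::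
  "real \<Rightarrow> real \<Rightarrow> plane measure \<Rightarrow> ((plane \<Rightarrow> real) \<Rightarrow> plane \<Rightarrow> real) \<Rightarrow> bool" where
  "compact_W12_L2 c d \<mu> T \<longleftrightarrow>
     (\<forall>u\<in>fst ` W12 c d. T u \<in> L2 \<mu>) \<and>
     (\<forall>u\<in>fst ` W12 c d. \<forall>w\<in>fst ` W12 c d. \<forall>a b :: real.
        AE x in \<mu>. T (a *\<^sub>R u + b *\<^sub>R w) x = a * T u x + b * T w x) \<and>
     (\<forall>u G. (\<forall>n :: nat. (u n, G n) \<in> W12 c d) \<and>
        bounded (range (\<lambda>n. W12_norm c d (u n) (G n))) \<longrightarrow>
        (\<exists>w\<in>L2 \<mu>. \<exists>r. strict_mono r \<and>
           (\<lambda>n. \<integral>x. (T (u (r n)) x - w x)\<^sup>2 \<partial>\<mu>) \<longlonglongrightarrow> 0))"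

definition admissible :: "real \<Rightarrow> real \<Rightarrow> plane measure \<Rightarrow> bool" where
  "admissible c d \<mu> \<longleftrightarrow> radon_measure c d \<mu> \<and> measure \<mu> (space \<mu>) \<noteq> 0 \<and>
     (\<exists>T. compact_W12_L2 c d \<mu> T \<and>
        (\<forall>f\<in>smooth_torus c d. AE x in \<mu>. T f x = f x))"

definition dirichlet_energy :: "real \<Rightarrow> real \<Rightarrow> (plane \<Rightarrow> real) \<Rightarrow> real" where
  "dirichlet_energy c d f = (\<integral>x. d * (norm (eucl_grad f x))\<^sup>2 \<partial>vol c d flat_metric)"

text \<open>\<open>(k+1)\<close>-dimensional subspaces of \<open>C\<^sup>\<infinity>(M)\<close> that are also \<open>(k+1)\<close>-dimensional in \<open>L\<^sup>2(M, \<mu>)\<close>,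
  i.e. on which the map to \<open>L\<^sup>2(M, \<mu>)\<close> has trivial kernel.\<close>

definition test_subspaces ::
  "nat \<Rightarrow> real \<Rightarrow> real \<Rightarrow> plane measure \<Rightarrow> (plane \<Rightarrow> real) set set" where
  "test_subspaces k c d \<mu> = {E. subspace E \<and> E \<subseteq> smooth_torus c d \<and> dim E = k + 1 \<and>
     (\<forall>f\<in>E. (AE x in \<mu>. f x = 0) \<longrightarrow> f = 0)}"

definition meas_eigenvalue :: "nat \<Rightarrow> real \<Rightarrow> real \<Rightarrow> plane measure \<Rightarrow> real" where
  "meas_eigenvalue k c d \<mu> =
     (INF E\<in>test_subspaces k c d \<mu>. SUP f\<in>E - {0}. dirichlet_energy c d f / (\<integral>x. (f x)\<^sup>2 \<partial>\<mu>))"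

definition norm_meas_eigenvalue :: "nat \<Rightarrow> real \<Rightarrow> real \<Rightarrow> plane measure \<Rightarrow> real" where
  "norm_meas_eigenvalue k c d \<mu> = meas_eigenvalue k c d \<mu> * measure \<mu> (space \<mu>)"

text \<open>The \<open>W\<^sup>-\<^sup>1\<^sup>,\<^sup>2(M, g\<^sub>c\<^sub>,\<^sub>d)\<close>-norm of a signed measure, given by the functional \<open>\<sigma>\<close> that it defines by
  integration of smooth functions. The supremum is taken in the extended reals.\<close>

definition Wm12_norm :: "real \<Rightarrow> real \<Rightarrow> ((plane \<Rightarrow> real) \<Rightarrow> real) \<Rightarrow> ereal" where
  "Wm12_norm c d \<sigma> =
     (SUP f\<in>{f\<in>smooth_torus c d. W12_norm c d f (eucl_grad f) = 1}. ereal (\<sigma> f))"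

end

theory Submission
  imports Defs "HOL-Complex_Analysis.Great_Picard"
begin

text \<open>
  Let \<open>\<Lambda> = 4 \<pi>\<^sup>2 / d\<close>. The flat torus maps harmonically by first eigenfunctions onto the Clifford torus
  in the unit three-sphere, with energy density \<open>\<Lambda>\<close>. Given a measure \<open>\<mu>\<close> without atoms, Brouwer's
  theorem yields a conformal automorphism of the sphere, with parameter \<open>a\<close> in the unit ball, that
  balances \<open>\<mu>\<close>; the composed map \<open>F\<close> has \<open>|F| = 1\<close> and energy at most \<open>\<Lambda> (1 - |a|\<^sup>2 / 16)\<close>, so its
  coordinates give the inequality (Hersch's argument) and control \<open>|a|\<^sup>2\<close> by the deficit. The form
  \<open>\<integral> \<nabla>u \<nabla>v - \<lambda> \<integral> u v d\<mu>\<close> is nonnegative on functions of mean zero, so by Cauchy-Schwarz between \<open>F\<close>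
  and \<open>f F\<close> the functional \<open>\<integral> f |\<nabla>F|\<^sup>2 - \<lambda> \<integral> f d\<mu>\<close> is bounded by the square root of the deficit, and
  \<open>|\<nabla>F|\<^sup>2\<close> is close to \<open>\<Lambda>\<close> because \<open>a\<close> is small. The flat metric thus serves as the maximal metric
  for every \<open>\<mu>\<close>.

  For smooth metrics one also needs that the first eigenvalue exists, has finite multiplicity and
  equals the infimum of the Rayleigh quotient: the Fourier coefficients of a minimising sequence
  converge along a subsequence to a bounded solution of the eigenvalue equation, which is smooth by
  a bootstrap in the decay of the coefficients.
\<close>

text \<open>The condition c^2 + d^2 = 1 makes the two generating frequencies equally long in the
  dual lattice, so both have eigenvalue \<open>Lam\<close>, and c \<le> 1/2 keeps every nonzero
  frequency from falling below it. The four real eigenfunctions obtained this way place the torus in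
  the three-sphere. Balancing needs continuity up to the boundary of the parameter ball, where the
  automorphisms collapse to constants away from one point. An atom at that point would destroy it,
  and admissible measures have no atoms because points have zero capacity. The threshold
  \<open>Lam / 64\<close> forces |a| \<le> 1/2, which keeps the conformal factor bounded; the
  constant \<open>c\<^sub>0\<close> is \<open>1 / C_stab^2\<close>. The spectral part meets a
  different obstacle: eigenvalues are defined through \<open>dim\<close> of eigenspaces, and
  \<open>dim\<close> is 0 on infinite-dimensional spaces, so existence and finite multiplicity are
  both required to evaluate the conformal supremum. All limits are taken on Fourier coefficients,
  where weak convergence is pointwise and regularity is polynomial decay.\<close>

declare split_paired_All [simp del] split_paired_Ex [simp del]

section \<open>Smooth functions on the plane\<close>

abbreviation dird :: "plane \<Rightarrow> (plane \<Rightarrow> real) \<Rightarrow> plane \<Rightarrow> real" where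
  "dird v f x \<equiv> frechet_derivative f (at x) v"

abbreviation smooth :: "(plane \<Rightarrow> real) \<Rightarrow> bool" where
  "smooth f \<equiv> smooth_on f UNIV"

lemma dird_eq: "(f has_derivative f') (at x) \<Longrightarrow> dird v f x = f' v"
  using frechet_derivative_at by metis

lemma Ck_on_SucD: "Ck_on (Suc n) f U \<Longrightarrow> Ck_on n f U"
  by (induction n arbitrary: f) (auto simp: differentiable_imp_continuous_on)

text \<open>A one-step unfolding without the order n. In the converse, level n + 1 is reached at
  once and lowered to n, so that n = 0 needs no case of its own.\<close>

lemma smooth_on_iff: "smooth_on f U \<longleftrightarrow> f differentiable_on U \<and> (\<forall>v. smooth_on (dird v f) U)"
proof
  assume "smooth_on f U"
  then show "f differentiable_on U \<and> (\<forall>v. smooth_on (dird v f) U)"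
    unfolding smooth_on_def by (metis Ck_on.simps(2))
next
  assume R: "f differentiable_on U \<and> (\<forall>v. smooth_on (dird v f) U)"
  show "smooth_on f U"
    unfolding smooth_on_def
  proof
    fix n
    from R have "Ck_on (Suc n) f U" by (simp add: smooth_on_def)
    then show "Ck_on n f U" by (rule Ck_on_SucD)
  qed
qed

lemma smooth_dird: "smooth f \<Longrightarrow> smooth (dird v f)"
  using smooth_on_iff by blast

lemma smooth_has_derivative: "smooth f \<Longrightarrow> (f has_derivative (\<lambda>v. dird v f x)) (at x)"
  using smooth_on_iff[of f UNIV] frechet_derivative_works[of f "at x"]
  unfolding differentiable_on_def by (metis UNIV_I)

lemma smooth_continuous: "smooth f \<Longrightarrow> continuous_on A f"
  using smooth_on_iff[of f UNIV] differentiable_imp_continuous_on continuous_on_subset by blast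

lemma Ck_on_UNIV_has_derivative:
  "Ck_on (Suc n) f UNIV \<Longrightarrow> (f has_derivative (\<lambda>v. dird v f x)) (at x)"
  using frechet_derivative_works[of f "at x"]
  unfolding Ck_on.simps differentiable_on_def by (metis UNIV_I)

text \<open>\<open>frechet_derivative\<close> is a choice and does not compute; with this rule the
  inductions on the order can use explicit derivative formulas.\<close>

lemma Ck_on_SucI:
  assumes "\<And>x. (f has_derivative f' x) (at x)" and "\<And>v. Ck_on n (\<lambda>x. f' x v) UNIV"
  shows "Ck_on (Suc n) f UNIV"
proof -
  have "dird v f = (\<lambda>x. f' x v)" for v
    using dird_eq[OF assms(1)] by blast
  moreover have "f differentiable_on UNIV"
    unfolding differentiable_on_def differentiable_def using assms(1) by blast
  ultimately show ?thesis
    using assms(2) unfolding Ck_on.simps by metis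
qed

lemma Ck_on_const: "Ck_on n (\<lambda>x. a) UNIV"
proof (induction n arbitrary: a)
  case (Suc n)
  show ?case by (rule Ck_on_SucI[where f' = "\<lambda>_ _. 0"]) (auto intro: Suc)
qed simp

lemma Ck_on_add: "Ck_on n f UNIV \<Longrightarrow> Ck_on n g UNIV \<Longrightarrow> Ck_on n (\<lambda>x. f x + g x) UNIV"
proof (induction n arbitrary: f g)
  case (Suc n)
  show ?case
  proof (rule Ck_on_SucI[where f' = "\<lambda>x v. dird v f x + dird v g x"])
    show "((\<lambda>x. f x + g x) has_derivative (\<lambda>v. dird v f x + dird v g x)) (at x)" for x
      by (intro has_derivative_add Ck_on_UNIV_has_derivative[of n] Suc.prems)
    show "Ck_on n (\<lambda>x. dird v f x + dird v g x) UNIV" for v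
      using Suc by simp
  qed
qed (auto intro: continuous_intros)

lemma Ck_on_mult: "Ck_on n f UNIV \<Longrightarrow> Ck_on n g UNIV \<Longrightarrow> Ck_on n (\<lambda>x. f x * g x) UNIV"
proof (induction n arbitrary: f g)
  case (Suc n)
  show ?case
  proof (rule Ck_on_SucI[where f' = "\<lambda>x v. f x * dird v g x + dird v f x * g x"])
    show "((\<lambda>x. f x * g x) has_derivative (\<lambda>v. f x * dird v g x + dird v f x * g x)) (at x)" for x
      by (intro has_derivative_mult Ck_on_UNIV_has_derivative[of n] Suc.prems)
    show "Ck_on n (\<lambda>x. f x * dird v g x + dird v f x * g x) UNIV" for v
      using Suc Ck_on_SucD[OF Suc.prems(1)] Ck_on_SucD[OF Suc.prems(2)]
      by (intro Ck_on_add Suc.IH) auto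
  qed
qed (auto intro: continuous_intros)

lemma Ck_on_inverse:
  assumes nz: "\<And>x. f x \<noteq> 0"
  shows "Ck_on n f UNIV \<Longrightarrow> Ck_on n (\<lambda>x. inverse (f x)) UNIV"
proof (induction n)
  case (Suc n)
  show ?case
  proof (rule Ck_on_SucI[where f' = "\<lambda>x v. - 1 * (inverse (f x) * dird v f x * inverse (f x))"])
    show "((\<lambda>x. inverse (f x)) has_derivative (\<lambda>v. - 1 * (inverse (f x) * dird v f x * inverse (f x)))) (at x)" for x
      by (rule has_derivative_eq_rhs[OF Deriv.has_derivative_inverse[OF nz Ck_on_UNIV_has_derivative[OF Suc.prems]]])
        simp
    show "Ck_on n (\<lambda>x. - 1 * (inverse (f x) * dird v f x * inverse (f x))) UNIV" for v
      using Suc.IH[OF Ck_on_SucD[OF Suc.prems]] Suc.prems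
      by (intro Ck_on_mult Ck_on_const) auto
  qed
qed (use nz in \<open>simp add: continuous_on_inverse\<close>)

text \<open>Each function occurs in the derivative of the other, so the two inductions run
  together.\<close>

lemma Ck_on_trig:
  assumes L: "bounded_linear (L :: plane \<Rightarrow> real)"
  shows "Ck_on n (\<lambda>x. cos (L x)) UNIV \<and> Ck_on n (\<lambda>x. sin (L x)) UNIV"
proof (induction n)
  case 0
  show ?case
    using linear_continuous_on[OF L, of UNIV] by (simp add: continuous_on_cos continuous_on_sin)
next
  case (Suc n)
  have D: "(L has_derivative L) (at x)" for x
    using L by (rule bounded_linear_imp_has_derivative)
  have "Ck_on (Suc n) (\<lambda>x. cos (L x)) UNIV"
  proof (rule Ck_on_SucI[where f' = "\<lambda>x v. - L v * sin (L x)"])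
    show "((\<lambda>x. cos (L x)) has_derivative (\<lambda>v. - L v * sin (L x))) (at x)" for x
      by (rule has_derivative_eq_rhs[OF has_derivative_cos[OF D]]) (auto simp: mult.commute)
  qed (intro Ck_on_mult Ck_on_const Suc[THEN conjunct2])
  moreover have "Ck_on (Suc n) (\<lambda>x. sin (L x)) UNIV"
  proof (rule Ck_on_SucI[where f' = "\<lambda>x v. L v * cos (L x)"])
    show "((\<lambda>x. sin (L x)) has_derivative (\<lambda>v. L v * cos (L x))) (at x)" for x
      by (rule has_derivative_eq_rhs[OF has_derivative_sin[OF D]]) (auto simp: mult.commute)
  qed (use Suc in \<open>auto intro: Ck_on_mult Ck_on_const\<close>)
  ultimately show ?case ..
qed

lemma smooth_const: "smooth (\<lambda>x. a)"
  and smooth_add: "smooth f \<Longrightarrow> smooth g \<Longrightarrow> smooth (\<lambda>x. f x + g x)"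
  and smooth_mult: "smooth f \<Longrightarrow> smooth g \<Longrightarrow> smooth (\<lambda>x. f x * g x)"
  and smooth_inverse: "smooth f \<Longrightarrow> (\<And>x. f x \<noteq> 0) \<Longrightarrow> smooth (\<lambda>x. inverse (f x))"
  and smooth_cos: "bounded_linear L \<Longrightarrow> smooth (\<lambda>x. cos (L x))"
  and smooth_sin: "bounded_linear L \<Longrightarrow> smooth (\<lambda>x. sin (L x))"
  unfolding smooth_on_def
  using Ck_on_const Ck_on_add Ck_on_mult Ck_on_inverse Ck_on_trig by auto

lemma smooth_on_ball:
  assumes "smooth f" shows "smooth_on f (ball p r)"
proof -
  have "Ck_on n f UNIV \<Longrightarrow> Ck_on n f (ball p r)" for n and f :: "plane \<Rightarrow> real"
    by (induction n arbitrary: f)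
      (auto intro: continuous_on_subset differentiable_on_subset)
  then show ?thesis using assms by (simp add: smooth_on_def)
qed

lemma dird_mult_add:
  assumes "smooth f" "smooth g"
  shows "dird v (\<lambda>x. f x * g x) x = f x * dird v g x + dird v f x * g x"
    and "dird v (\<lambda>x. f x + g x) x = dird v f x + dird v g x"
  by (rule dird_eq[OF has_derivative_mult[OF smooth_has_derivative smooth_has_derivative, OF assms]],
      rule dird_eq[OF has_derivative_add[OF smooth_has_derivative smooth_has_derivative, OF assms]])

lemma eucl_grad_eq: "eucl_grad f x = (dird (1,0) f x, dird (0,1) f x)"
  by (simp add: eucl_grad_def Basis_prod_def sum.union_disjoint Collect_disj_eq image_iff)

lemma eucl_laplacian_eq:
  "eucl_laplacian f x = dird (1,0) (dird (1,0) f) x + dird (0,1) (dird (0,1) f) x"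
  by (simp add: eucl_laplacian_def Basis_prod_def)

lemma norm_eucl_grad: "(norm (eucl_grad f x))\<^sup>2 = (dird (1,0) f x)\<^sup>2 + (dird (0,1) f x)\<^sup>2"
  by (simp add: eucl_grad_eq norm_Pair)

section \<open>Integration over the torus\<close>

locale rhombic_torus =
  fixes c d :: real
  assumes c0: "0 \<le> c" and c_half: "c \<le> 1/2" and d0: "d > 0" and cd: "c\<^sup>2 + d\<^sup>2 = 1"
begin

abbreviation V :: "plane measure" where "V \<equiv> vol c d flat_metric"
abbreviation dom :: "plane set" where "dom \<equiv> torus_dom c d"

text \<open>Coordinates for the lattice basis (1,0), (c,d): periodicity becomes invariance under
  integer shifts, and the fundamental parallelogram becomes the half-open unit square.\<close>

definition lat :: "plane \<Rightarrow> plane" where "lat p = (fst p + c * snd p, d * snd p)"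
definition coord :: "plane \<Rightarrow> plane" where "coord x = (fst x - c / d * snd x, snd x / d)"

lemma lat_coord [simp]: "lat (coord x) = x" and coord_lat [simp]: "coord (lat p) = p"
  using d0 by (auto simp: lat_def coord_def prod_eq_iff)

lemma continuous_on_lat [continuous_intros]: "continuous_on A lat"
  unfolding lat_def by (intro continuous_intros)

lemma lat_measurable [measurable]: "lat \<in> borel_measurable borel"
  by (intro borel_measurable_continuous_onI continuous_on_lat)

lemma coord_measurable [measurable]: "coord \<in> borel_measurable borel"
  unfolding coord_def by (intro borel_measurable_continuous_onI continuous_intros) (use d0 in auto)

definition sq :: "plane set" where "sq = {0..<1} \<times> {0..<1}"

lemma sq_borel [measurable]: "sq \<in> sets borel"
  unfolding sq_def by (intro borel_Times) auto

lemma lat_in_dom: "lat p \<in> dom \<longleftrightarrow> p \<in> sq"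
proof -
  have "lat p \<in> dom \<longleftrightarrow> (\<exists>s t. lat p = lat (s, t) \<and> (s,t) \<in> sq)"
    by (auto simp: torus_dom_def sq_def lat_def mult.commute)
  also have "\<dots> \<longleftrightarrow> p \<in> sq"
    by (metis coord_lat prod.collapse)
  finally show ?thesis .
qed

lemma dom_eq: "dom = coord -` sq"
  using lat_in_dom by (metis (no_types, lifting) lat_coord subsetI subset_antisym vimage_eq)

lemma dom_borel [measurable]: "dom \<in> sets borel"
  using measurable_sets[OF coord_measurable sq_borel] by (simp add: dom_eq)

text \<open>A change of variables with Jacobian d, one coordinate at a time: a scaling of the second
  variable and, for fixed second variable, a translation of the first.\<close>

lemma nn_integral_lat:
  assumes [measurable]: "f \<in> borel_measurable borel"
  shows "(\<integral>\<^sup>+x. f x \<partial>lborel) = ennreal d * (\<integral>\<^sup>+p. f (lat p) \<partial>lborel)"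
proof -
  have "(\<integral>\<^sup>+x. f x \<partial>lborel) = (\<integral>\<^sup>+y. \<integral>\<^sup>+x. f (x, y) \<partial>lborel \<partial>lborel)"
    using lborel_pair.nn_integral_snd[of f] by (simp add: lborel_prod)
  also have "\<dots> = ennreal d * (\<integral>\<^sup>+t. \<integral>\<^sup>+x. f (x, d * t) \<partial>lborel \<partial>lborel)"
    by (subst nn_integral_real_affine[of _ d 0]) (use d0 in \<open>auto\<close>)
  also have "(\<integral>\<^sup>+t. \<integral>\<^sup>+x. f (x, d * t) \<partial>lborel \<partial>lborel) =
      (\<integral>\<^sup>+t. \<integral>\<^sup>+s. f (s + c * t, d * t) \<partial>lborel \<partial>lborel)"
  proof (rule nn_integral_cong)
    fix t :: real
    show "(\<integral>\<^sup>+x. f (x, d * t) \<partial>lborel) = (\<integral>\<^sup>+s. f (s + c * t, d * t) \<partial>lborel)"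
      by (subst nn_integral_real_affine[of _ 1 "c * t"]) (auto simp: add.commute)
  qed
  also have "\<dots> = (\<integral>\<^sup>+p. f (lat p) \<partial>lborel)"
  proof -
    have "(\<lambda>p. f (lat p)) \<in> borel_measurable (lborel \<Otimes>\<^sub>M lborel)"
      unfolding lborel_prod by measurable
    from lborel_pair.nn_integral_snd[OF this] show ?thesis
      by (simp add: lborel_prod lat_def)
  qed
  finally show ?thesis .
qed

text \<open>The weight 1/d of the unit-area metric cancels the Jacobian of \<open>lat\<close>, so V
  is the image of Lebesgue measure on the unit square.\<close>

lemma V_distr: "V = distr (restrict_space lborel sq) (restrict_space borel dom) lat"
proof (rule measure_eqI)
  show "sets V = sets (distr (restrict_space lborel sq) (restrict_space borel dom) lat)"
    by (auto simp: vol_def sets_restrict_space)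
next
  fix A assume "A \<in> sets V"
  then have A: "A \<in> sets (restrict_space borel dom)" 
    by (auto simp: vol_def sets_restrict_space)
  then have A': "A \<subseteq> dom" and [measurable]: "A \<in> sets borel"
    by (auto simp: sets_restrict_space_iff)
  have m: "lat \<in> restrict_space lborel sq \<rightarrow>\<^sub>M restrict_space borel dom"
    by (rule measurable_restrict_space2)
      (auto simp: space_restrict_space lat_in_dom intro: measurable_restrict_space1)
  have "emeasure V A = (\<integral>\<^sup>+x. ennreal (1/d) * indicator A x \<partial>restrict_space lborel dom)"
    using A by (simp add: vol_def flat_metric_def emeasure_density sets_restrict_space)
  also have "\<dots> = (\<integral>\<^sup>+x. ennreal (1/d) * indicator A x * indicator dom x \<partial>lborel)"
    by (subst nn_integral_restrict_space) auto
  also have "\<dots> = (\<integral>\<^sup>+x. ennreal (1/d) * indicator A x \<partial>lborel)"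
    using A' by (intro nn_integral_cong) (auto split: split_indicator)
  also have "\<dots> = ennreal (1/d) * (ennreal d * (\<integral>\<^sup>+p. indicator A (lat p) \<partial>lborel))"
    by (simp add: nn_integral_cmult flip: nn_integral_lat[of "indicator A"])
  also have "\<dots> = (\<integral>\<^sup>+p. indicator A (lat p) \<partial>lborel)"
    using d0 by (simp flip: mult.assoc ennreal_mult)
  also have "\<dots> = (\<integral>\<^sup>+p. indicator (lat -` A \<inter> sq) p \<partial>lborel)"
    using A' lat_in_dom by (intro nn_integral_cong) (auto split: split_indicator)
  also have "\<dots> = emeasure lborel (lat -` A \<inter> sq)"
    using measurable_sets[OF lat_measurable, of A] by (intro nn_integral_indicator) auto
  also have "\<dots> = emeasure (distr (restrict_space lborel sq) (restrict_space borel dom) lat) A"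
    using A m by (simp add: emeasure_distr emeasure_restrict_space space_restrict_space)
  finally show "emeasure V A = emeasure (distr (restrict_space lborel sq) (restrict_space borel dom) lat) A" .
qed

lemma sets_V: "sets V = sets (restrict_space borel dom)"
  by (auto simp: vol_def sets_restrict_space)

lemma space_V: "space V = dom"
  using sets_eq_imp_space_eq[OF sets_V] by (simp add: space_restrict_space)

abbreviation unit_square :: "plane set" where "unit_square \<equiv> cbox (0,0) (1,1)"

text \<open>Passing to the closed square adds only a null set and turns V-integrals into gauge
  integrals over a compact interval, where iterated integration and the fundamental theorem of
  calculus are available.\<close>

lemma V_integral:
  fixes h :: "plane \<Rightarrow> 'b::euclidean_space"
  assumes h: "continuous_on UNIV h"
  shows "integrable V h" and "(\<integral>x. h x \<partial>V) = integral unit_square (\<lambda>p. h (lat p))"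
proof -
  have [measurable]: "h \<in> borel_measurable borel"
    using h by (rule borel_measurable_continuous_onI)
  have m: "lat \<in> restrict_space lborel sq \<rightarrow>\<^sub>M restrict_space borel dom"
    by (rule measurable_restrict_space2)
      (auto simp: space_restrict_space lat_in_dom intro: measurable_restrict_space1)
  have hm: "h \<in> borel_measurable (restrict_space borel dom)"
    by (intro measurable_restrict_space1) auto
  have hc: "continuous_on unit_square (\<lambda>p. h (lat p))"
    by (rule continuous_on_compose2[OF h continuous_on_lat]) auto
  have int: "integrable lborel (\<lambda>p. indicator unit_square p *\<^sub>R h (lat p))"
    using borel_integrable_compact[OF compact_cbox hc] by (simp add: indicator_scaleR_eq_if)
  have null: "emeasure lborel (unit_square - box (0,0) (1,1)) = 0"
    by (subst emeasure_Diff) (auto simp: box_subset_cbox Basis_prod_def emeasure_lborel_cbox_eq emeasure_lborel_box_eq)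
  have "box (0,0) (1,1) \<subseteq> sq" "sq \<subseteq> unit_square"
    by (auto simp: sq_def box_def Basis_prod_def cbox_Pair_eq)
  then have "p \<in> sq \<longleftrightarrow> p \<in> unit_square" if "p \<notin> unit_square - box (0,0) (1,1)" for p
    using that box_subset_cbox by blast
  then have ae: "AE p in lborel. indicator sq p *\<^sub>R h (lat p) = indicator unit_square p *\<^sub>R h (lat p)"
    using null by (intro AE_I[where N = "unit_square - box (0,0) (1,1)"])
      (auto simp: indicator_def)
  have int': "integrable lborel (\<lambda>p. indicator sq p *\<^sub>R h (lat p))"
    using int ae by (subst integrable_cong_AE) auto
  show "integrable V h"
    unfolding V_distr using m hm int'
    by (subst integrable_distr_eq) (auto simp: integrable_restrict_space)
  have "(\<integral>x. h x \<partial>V) = (\<integral>p. indicator sq p *\<^sub>R h (lat p) \<partial>lborel)"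
    unfolding V_distr using m hm
    by (subst integral_distr) (auto simp: integral_restrict_space)
  also have "\<dots> = (\<integral>p. indicator unit_square p *\<^sub>R h (lat p) \<partial>lborel)"
    by (rule integral_cong_AE) (use ae in auto)
  also have "\<dots> = integral unit_square (\<lambda>p. h (lat p))"
    using set_borel_integral_eq_integral(2)[of unit_square "\<lambda>p. h (lat p)"] int
    by (simp add: set_integrable_def set_lebesgue_integral_def)
  finally show "(\<integral>x. h x \<partial>V) = integral unit_square (\<lambda>p. h (lat p))" .
qed

lemma measure_V: "measure V dom = 1" and finite_V: "finite_measure V"
proof -
  have "(\<integral>\<^sup>+x. ennreal (norm (1::real)) \<partial>V) < \<infinity>"
    using V_integral(1)[of "\<lambda>_. 1 :: real"] by (simp only: integrable_iff_bounded continuous_on_const)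
  then have "emeasure V (space V) < \<infinity>" by simp
  from finite_measureI[OF less_imp_neq[OF this]] interpret finite_measure V .
  show "finite_measure V" by (rule finite_measure_axioms)
  have "(\<integral>x. 1 \<partial>V) = (1::real)"
    by (subst V_integral(2)) (auto simp: content_Pair)
  then show "measure V dom = 1" by (simp add: space_V)
qed

lemma periodic_lat:
  assumes "periodic c d g"
  shows "g (lat (s + of_int m, t + of_int n)) = g (lat (s, t))"
proof -
  have "of_int m *\<^sub>R (1, 0) + of_int n *\<^sub>R (c, d) \<in> torus_lattice c d"
    unfolding torus_lattice_def by blast
  moreover have "lat (s + of_int m, t + of_int n) = lat (s,t) + (of_int m *\<^sub>R (1, 0) + of_int n *\<^sub>R (c, d))"
    by (auto simp: lat_def algebra_simps)
  ultimately show ?thesis using assms unfolding periodic_def by metis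
qed

lemma periodic_iff_lat:
  "periodic c d g \<longleftrightarrow> (\<forall>s t m n. g (lat (s + of_int m, t + of_int n)) = g (lat (s, t)))"
proof
  assume R: "\<forall>s t m n. g (lat (s + of_int m, t + of_int n)) = g (lat (s, t))"
  show "periodic c d g"
    unfolding periodic_def
  proof (intro allI ballI)
    fix x \<gamma> assume "\<gamma> \<in> torus_lattice c d"
    then obtain m n where \<gamma>: "\<gamma> = of_int m *\<^sub>R (1, 0) + of_int n *\<^sub>R (c, d)"
      unfolding torus_lattice_def by blast
    obtain s t where st: "coord x = (s, t)" by fastforce
    then have x: "x = lat (s, t)" by (metis lat_coord)
    have "x + \<gamma> = lat (s + of_int m, t + of_int n)"
      by (auto simp: x \<gamma> lat_def algebra_simps)
    then show "g (x + \<gamma>) = g x" using R x by metis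
  qed
qed (use periodic_lat in blast)

text \<open>The divergence theorem on the torus: the fundamental theorem of calculus along either
  lattice direction leaves boundary values that periodicity cancels, and every v is a combination of
  the two directions. All integrations by parts rest on this.\<close>

lemma integral_derivative_zero:
  fixes g :: "plane \<Rightarrow> 'b::euclidean_space"
  assumes per: "periodic c d g"
    and der: "\<And>x. (g has_derivative g' x) (at x)"
    and cont: "\<And>v. continuous_on UNIV (\<lambda>x. g' x v)"
  shows "(\<integral>x. g' x v \<partial>V) = 0"
proof -
  have lin: "linear (g' x)" for x
    using der has_derivative_linear by blast
  have 1: "((\<lambda>s. g (lat (s, t))) has_vector_derivative g' (lat (s,t)) (1,0)) (at s within S)" for s t S
  proof -
    have "((\<lambda>s. lat (s, t)) has_derivative (\<lambda>h. h *\<^sub>R (1,0))) (at s within S)"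
      unfolding lat_def by (auto intro!: derivative_eq_intros)
    from diff_chain_within[OF this has_derivative_at_withinI[OF der]]
    show ?thesis
      by (simp add: has_vector_derivative_def o_def linear_scale[OF lin] del: scaleR_Pair)
  qed
  have 2: "((\<lambda>t. g (lat (s, t))) has_vector_derivative g' (lat (s,t)) (c,d)) (at t within S)" for s t S
  proof -
    have "((\<lambda>t. lat (s, t)) has_derivative (\<lambda>h. h *\<^sub>R (c,d))) (at t within S)"
      unfolding lat_def by (auto intro!: derivative_eq_intros)
    from diff_chain_within[OF this has_derivative_at_withinI[OF der]]
    show ?thesis
      by (simp add: has_vector_derivative_def o_def linear_scale[OF lin] del: scaleR_Pair)
  qed
  have cont': "continuous_on A (\<lambda>p. g' (lat p) v)" for A v
    by (rule continuous_on_compose2[OF cont continuous_on_lat]) auto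
  have e1: "(\<integral>x. g' x (1,0) \<partial>V) = 0"
  proof -
    have "integral {0..1} (\<lambda>s. g' (lat (s,t)) (1,0)) = 0" for t
      using fundamental_theorem_of_calculus[of 0 1 "\<lambda>s. g (lat (s,t))", OF _ 1] periodic_lat[OF per, of 0 1 t 0]
      by (simp add: integral_unique)
    \<comment> \<open>The integral known to vanish runs over the first coordinate, so the order of
      integration is exchanged.\<close>
    then have "integral (cbox 0 1) (\<lambda>s. integral (cbox 0 1) (\<lambda>t. g' (lat (s,t)) (1,0))) = 0"
      by (subst integral_swap_continuous) (use cont' in \<open>simp_all add: split_def\<close>)
    then show ?thesis
      using integral_prod_continuous[of 0 0 1 1 "\<lambda>p. g' (lat p) (1,0)"] cont'
      by (simp add: V_integral(2)[OF cont])
  qed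
  have e2: "(\<integral>x. g' x (c,d) \<partial>V) = 0"
  proof -
    have "integral {0..1} (\<lambda>t. g' (lat (s,t)) (c,d)) = 0" for s
      using fundamental_theorem_of_calculus[of 0 1 "\<lambda>t. g (lat (s,t))", OF _ 2] periodic_lat[OF per, of s 0 0 1]
      by (simp add: integral_unique)
    then show ?thesis
      using integral_prod_continuous[of 0 0 1 1 "\<lambda>p. g' (lat p) (c,d)"] cont'
      by (simp add: V_integral(2)[OF cont])
  qed
  obtain \<alpha> \<beta> where v: "v = \<alpha> *\<^sub>R (1,0) + \<beta> *\<^sub>R (c,d)"
  proof
    show "v = fst (coord v) *\<^sub>R (1,0) + snd (coord v) *\<^sub>R (c,d)"
      using lat_coord[of v] by (simp add: lat_def mult.commute)
  qed
  have "(\<integral>x. g' x v \<partial>V) = (\<integral>x. \<alpha> *\<^sub>R g' x (1,0) + \<beta> *\<^sub>R g' x (c,d) \<partial>V)"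
    unfolding v by (simp only: linear_add[OF lin] linear_scale[OF lin])
  also have "\<dots> = 0"
    using V_integral(1)[OF cont] by (simp add: e1 e2)
  finally show ?thesis .
qed

lemma integral_V_eq_0:
  fixes h :: "plane \<Rightarrow> real"
  assumes "continuous_on UNIV h" "periodic c d h" "\<And>x. h x \<ge> 0" "(\<integral>x. h x \<partial>V) = 0"
  shows "h x = 0"
proof -
  have "continuous_on unit_square (\<lambda>p. h (lat p))"
    by (rule continuous_on_compose2[OF assms(1) continuous_on_lat]) auto
  moreover have "box (0,0) (1,1::real) \<noteq> ({} :: plane set)"
    by (auto simp: box_eq_empty Basis_prod_def)
  ultimately have z: "\<forall>p\<in>unit_square. h (lat p) = 0"
    using integral_cbox_eq_0_iff[of "(0,0)" "(1,1)" "\<lambda>p. h (lat p)"] assms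
    by (simp add: V_integral(2)[OF assms(1)])
  obtain s t where st: "coord x = (s, t)" by fastforce
  have "h x = h (lat (frac s + of_int \<lfloor>s\<rfloor>, frac t + of_int \<lfloor>t\<rfloor>))"
    using st by (metis lat_coord frac_def diff_add_cancel)
  also have "\<dots> = h (lat (frac s, frac t))" by (rule periodic_lat[OF assms(2)])
  also have "\<dots> = 0"
    using z by (auto simp: cbox_Pair_eq frac_lt_1 less_imp_le)
  finally show ?thesis .
qed

end

section \<open>Fourier series on the torus\<close>

context rhombic_torus
begin

lemma smooth_torusD: "f \<in> smooth_torus c d \<Longrightarrow> smooth f" "f \<in> smooth_torus c d \<Longrightarrow> periodic c d f"
  by (auto simp: smooth_torus_def)

lemma periodic_dird: 
  assumes "periodic c d f" "smooth f" shows "periodic c d (dird v f)"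
  unfolding periodic_def
proof (intro allI ballI)
  fix x \<gamma> assume "\<gamma> \<in> torus_lattice c d"
  then have f: "f = (\<lambda>y. f (y + \<gamma>))" using assms(1) unfolding periodic_def by simp
  have "((\<lambda>y. f (y + \<gamma>)) has_derivative (\<lambda>v. dird v f (x + \<gamma>))) (at x)"
    by (rule has_derivative_compose[of "\<lambda>y. y + \<gamma>" "\<lambda>v. v" x UNIV f, simplified])
      (auto intro!: derivative_eq_intros smooth_has_derivative assms)
  from dird_eq[OF this[folded f]] show "dird v f (x + \<gamma>) = dird v f x" by simp
qed

lemma smooth_torus_const: "(\<lambda>x. a) \<in> smooth_torus c d"
  and smooth_torus_add: "f \<in> smooth_torus c d \<Longrightarrow> g \<in> smooth_torus c d \<Longrightarrow> (\<lambda>x. f x + g x) \<in> smooth_torus c d"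
  and smooth_torus_mult: "f \<in> smooth_torus c d \<Longrightarrow> g \<in> smooth_torus c d \<Longrightarrow> (\<lambda>x. f x * g x) \<in> smooth_torus c d"
  and smooth_torus_inverse: "f \<in> smooth_torus c d \<Longrightarrow> (\<And>x. f x \<noteq> 0) \<Longrightarrow> (\<lambda>x. inverse (f x)) \<in> smooth_torus c d"
  and smooth_torus_dird: "f \<in> smooth_torus c d \<Longrightarrow> dird v f \<in> smooth_torus c d"
  using smooth_const smooth_add smooth_mult smooth_inverse periodic_dird smooth_dird
  by (auto simp: smooth_torus_def periodic_def)

lemma smooth_torus_cmult: "f \<in> smooth_torus c d \<Longrightarrow> (\<lambda>x. r * f x) \<in> smooth_torus c d"
  using smooth_torus_mult[OF smooth_torus_const] .

text \<open>Lifts of the continuous functions on the compact torus: they are bounded, and integrable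
  for every Radon measure.\<close>

definition torfun :: "(plane \<Rightarrow> 'b::topological_space) \<Rightarrow> bool" where
  "torfun f \<longleftrightarrow> periodic c d f \<and> continuous_on UNIV f"

lemma torfun_smooth: "f \<in> smooth_torus c d \<Longrightarrow> torfun f"
  by (simp add: torfun_def smooth_torus_def smooth_continuous)

lemma torfun_of_real: "torfun f \<Longrightarrow> torfun (\<lambda>x. complex_of_real (f x))"
  and torfun_Re: "torfun g \<Longrightarrow> torfun (\<lambda>x. Re (g x))"
  unfolding torfun_def periodic_def by (auto intro: continuous_intros)

lemma torfun_mult: "torfun f \<Longrightarrow> torfun g \<Longrightarrow> torfun (\<lambda>x. f x * g x)"
  and torfun_diff: "torfun f' \<Longrightarrow> torfun g' \<Longrightarrow> torfun (\<lambda>x. f' x - g' x)"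
  and torfun_add: "torfun f' \<Longrightarrow> torfun g' \<Longrightarrow> torfun (\<lambda>x. f' x + g' x)"
  for f g :: "plane \<Rightarrow> 'b::real_normed_algebra" and f' g' :: "plane \<Rightarrow> 'c::real_normed_vector"
  unfolding torfun_def periodic_def by (auto intro: continuous_intros)

lemma torfun_const: "torfun (\<lambda>x. a)"
  by (simp add: torfun_def periodic_def)

lemma torfun_bounded:
  fixes f :: "plane \<Rightarrow> 'b::real_normed_vector"
  assumes "torfun f" obtains M where "M > 0" "\<And>x. norm (f x) \<le> M"
proof -
  have "continuous_on unit_square (\<lambda>p. f (lat p))"
    by (rule continuous_on_compose2[OF _ continuous_on_lat]) (use assms torfun_def in auto)
  then have "bounded ((\<lambda>p. f (lat p)) ` unit_square)"
    by (intro compact_imp_bounded compact_continuous_image compact_cbox)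
  then obtain M where M: "\<And>p. p \<in> unit_square \<Longrightarrow> norm (f (lat p)) \<le> M" "M > 0"
    unfolding bounded_pos by auto
  have "norm (f x) \<le> M" for x
  proof -
    obtain s t where st: "coord x = (s, t)" by fastforce
    have "f x = f (lat (frac s + of_int \<lfloor>s\<rfloor>, frac t + of_int \<lfloor>t\<rfloor>))"
      using st by (metis lat_coord frac_def diff_add_cancel)
    also have "\<dots> = f (lat (frac s, frac t))"
      using periodic_lat assms unfolding torfun_def by blast
    finally show ?thesis using M(1) by (auto simp: cbox_Pair_eq frac_lt_1 less_imp_le)
  qed
  with M(2) that show ?thesis by blast
qed

lemma torfun_integrable: "torfun f \<Longrightarrow> integrable V f"
  for f :: "plane \<Rightarrow> 'b::euclidean_space"
  using V_integral(1) torfun_def by blast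

subsection \<open>Characters and coefficients\<close>

type_synonym freq = "int \<times> int"

text \<open>The pairing of x with 2 pi times the dual lattice vector whose products with the
  generators (1,0) and (c,d) are the two integers of k; compare \<open>ph_lat\<close>.\<close>

definition ph :: "freq \<Rightarrow> plane \<Rightarrow> real" where
  "ph k x = 2 * pi * (of_int (fst k) * fst x + (of_int (snd k) - c * of_int (fst k)) / d * snd x)"

definition ch :: "freq \<Rightarrow> plane \<Rightarrow> complex" where "ch k x = cis (ph k x)"

lemma ph_lat: "ph k (lat (s, t)) = 2 * pi * (of_int (fst k) * s + of_int (snd k) * t)"
  using d0 by (simp add: ph_def lat_def field_simps)

lemma bounded_linear_ph: "bounded_linear (ph k)"
  unfolding linear_conv_bounded_linear[symmetric]
  by (rule linearI) (auto simp: ph_def algebra_simps add_divide_distrib diff_divide_distrib)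

lemma ph_add: "ph (j + k) x = ph j x + ph k x"
  and ph_uminus: "ph (- k) x = - ph k x"
  and ph_0: "ph 0 x = 0"
  and ph_scaleR: "ph k (r *\<^sub>R x) = r * ph k x"
  by (auto simp: ph_def algebra_simps add_divide_distrib diff_divide_distrib)

lemma ch_add: "ch (j + k) x = ch j x * ch k x"
  and ch_0: "ch 0 x = 1"
  and ch_cnj: "cnj (ch k x) = ch (- k) x"
  and norm_ch [simp]: "norm (ch k x) = 1"
  by (auto simp: ch_def ph_add ph_0 ph_uminus cis_mult cis_cnj)

lemma ch_plus: "ch k (x + y) = ch k x * ch k y"
  using bounded_linear_ph[of k] by (simp add: ch_def cis_mult linear_simps)

lemma torfun_ch: "torfun (ch k)"
  unfolding torfun_def periodic_iff_lat
proof (intro conjI allI)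
  show "ch k (lat (s + of_int m, t + of_int n)) = ch k (lat (s, t))" for s t m n
  proof -
    have "ph k (lat (s + of_int m, t + of_int n)) = ph k (lat (s,t)) + 2 * pi * of_int (fst k * m + snd k * n)"
      by (simp add: ph_lat algebra_simps)
    then show ?thesis
      by (simp add: ch_def cis_multiple_2pi flip: cis_mult)
  qed
  show "continuous_on UNIV (ch k)"
    unfolding ch_def by (intro continuous_intros linear_continuous_on bounded_linear_ph)
qed

lemma smooth_torus_trig: "(\<lambda>x. cos (ph k x)) \<in> smooth_torus c d" "(\<lambda>x. sin (ph k x)) \<in> smooth_torus c d"
proof -
  have "periodic c d (ch k)" using torfun_ch torfun_def by blast
  then have "periodic c d (\<lambda>x. Re (ch k x))" "periodic c d (\<lambda>x. Im (ch k x))"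
    unfolding periodic_def by auto
  then show "(\<lambda>x. cos (ph k x)) \<in> smooth_torus c d" "(\<lambda>x. sin (ph k x)) \<in> smooth_torus c d"
    unfolding smooth_torus_def ch_def using smooth_cos smooth_sin bounded_linear_ph by auto
qed

lemma has_derivative_ch:
  "(ch k has_derivative (\<lambda>v. of_real (ph k v) * (\<i> * ch k x))) (at x)"
proof -
  have "((\<lambda>x. \<i> * of_real (ph k x)) has_derivative (\<lambda>v. \<i> * of_real (ph k v))) (at x)"
    by (intro has_derivative_mult_right has_derivative_of_real bounded_linear_imp_has_derivative bounded_linear_ph)
  from has_derivative_compose[OF this DERIV_exp[unfolded has_field_derivative_def]] show ?thesis
    by (simp add: ch_def[abs_def] cis_conv_exp mult_ac)
qed

lemma integral_ch: "(\<integral>x. ch k x \<partial>V) = (if k = 0 then 1 else 0)"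
proof (cases "k = 0")
  case True
  then show ?thesis using measure_V by (simp add: ch_0 space_V)
next
  case False
  \<comment> \<open>Along this lattice vector the phase is 2 pi times the sum of the squared
    indices, hence nonzero, so the character is up to a nonzero factor its own derivative.\<close>
  define v where "v = lat (of_int (fst k), of_int (snd k))"
  have "(of_int (fst k))\<^sup>2 + (of_int (snd k))\<^sup>2 > (0::real)"
    using False by (auto simp: sum_power2_gt_zero_iff prod_eq_iff)
  moreover have "ph k v = 2 * pi * ((of_int (fst k))\<^sup>2 + (of_int (snd k))\<^sup>2)"
    by (simp add: v_def ph_lat power2_eq_square)
  ultimately have v: "ph k v \<noteq> 0" using pi_gt_zero by (metis mult_pos_pos less_irrefl zero_less_numeral)
  have "(\<integral>x. of_real (ph k v) * (\<i> * ch k x) \<partial>V) = 0"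
    using torfun_ch[of k] 
    by (intro integral_derivative_zero[where g = "ch k"] has_derivative_ch) (simp_all add: torfun_def continuous_on_mult)
  then show ?thesis using v False by simp
qed

definition fc :: "(plane \<Rightarrow> complex) \<Rightarrow> freq \<Rightarrow> complex" where
  "fc f k = (\<integral>x. f x * ch (- k) x \<partial>V)"

abbreviation fcr :: "(plane \<Rightarrow> real) \<Rightarrow> freq \<Rightarrow> complex" where
  "fcr f \<equiv> fc (\<lambda>x. complex_of_real (f x))"

abbreviation asum :: "(freq \<Rightarrow> complex) \<Rightarrow> bool" where
  "asum a \<equiv> (\<lambda>k. norm (a k)) summable_on UNIV"

definition four :: "(freq \<Rightarrow> complex) \<Rightarrow> plane \<Rightarrow> complex" where
  "four a x = (\<Sum>\<^sub>\<infinity>k. a k * ch k x)"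

lemma norm_integral_V_le:
  fixes f :: "plane \<Rightarrow> 'b::euclidean_space"
  assumes "torfun f" "\<And>x. norm (f x) \<le> M" shows "norm (\<integral>x. f x \<partial>V) \<le> M"
proof -
  interpret finite_measure V by (rule finite_V)
  have "norm (\<integral>x. f x \<partial>V) \<le> (\<integral>x. norm (f x) \<partial>V)" by (rule integral_norm_bound)
  also have "\<dots> \<le> (\<integral>x. M \<partial>V)"
    using assms torfun_integrable by (intro integral_mono) auto
  finally show ?thesis by (simp add: space_V measure_V)
qed

lemma norm_fc_le:
  assumes "torfun f" "\<And>x. norm (f x) \<le> M" shows "norm (fc f k) \<le> M"
  unfolding fc_def using assms by (intro norm_integral_V_le torfun_mult torfun_ch) (auto simp: norm_mult)

lemma fc_cmult: "fc (\<lambda>x. a * f x) k = a * fc f k"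
  by (simp add: fc_def mult.assoc)

lemma fc_add: "torfun f \<Longrightarrow> torfun g \<Longrightarrow> fc (\<lambda>x. f x + g x) k = fc f k + fc g k"
  and fc_diff: "torfun f \<Longrightarrow> torfun g \<Longrightarrow> fc (\<lambda>x. f x - g x) k = fc f k - fc g k"
  unfolding fc_def distrib_right left_diff_distrib
  by (simp_all add: torfun_mult torfun_ch torfun_integrable)

lemma fc_mult_ch: "fc (\<lambda>x. f x * ch j x) k = fc f (k - j)"
  using ch_add[of j "- k"] by (simp add: fc_def mult.assoc)

lemma fcr_cnj: "cnj (fcr f k) = fcr f (- k)"
  unfolding fc_def by (subst Bochner_Integration.integral_cnj[symmetric]) (simp add: ch_cnj)

lemma four_uniform:
  assumes "asum a"
  shows "uniform_limit UNIV (\<lambda>F x. \<Sum>k\<in>F. a k * ch k x) (four a) (finite_subsets_at_top UNIV)"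
  unfolding four_def
  by (rule Weierstrass_m_test_general[OF _ assms]) (simp add: norm_mult)

lemma four_has_sum:
  assumes "asum a" shows "((\<lambda>k. a k * ch k x) has_sum four a x) UNIV"
proof -
  have "(\<lambda>k. norm (a k * ch k x)) summable_on UNIV" using assms by (simp add: norm_mult)
  then show ?thesis unfolding four_def by (rule has_sum_infsum[OF abs_summable_summable])
qed

lemma torfun_four: "asum a \<Longrightarrow> torfun (four a)"
  unfolding torfun_def
proof
  show "continuous_on UNIV (four a)" if "asum a"
    using torfun_ch
    by (intro uniform_limit_theorem[OF _ four_uniform[OF that]] always_eventually)
      (auto simp: torfun_def intro!: continuous_intros)
  show "periodic c d (four a)"
    using torfun_ch unfolding torfun_def periodic_def four_def by simp
qed

text \<open>Uniform convergence allows termwise integration against a bounded function. Recovery of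
  coefficients, Parseval's identity and the convolution formula are instances.\<close>

lemma four_integral:
  assumes a: "asum a" and f: "torfun f"
  shows "((\<lambda>k. a k * (\<integral>x. ch k x * f x \<partial>V)) has_sum (\<integral>x. four a x * f x \<partial>V)) UNIV"
  unfolding has_sum_def
proof (rule tendstoI)
  fix e :: real assume "e > 0"
  obtain M where M: "M > 0" "\<And>x. norm (f x) \<le> M" using torfun_bounded[OF f] by blast
  have "e / (2 * M) > 0" using \<open>e > 0\<close> M by simp
  from uniform_limitD[OF four_uniform[OF a] this]
  show "\<forall>\<^sub>F F in finite_subsets_at_top UNIV. dist (\<Sum>k\<in>F. a k * (\<integral>x. ch k x * f x \<partial>V)) (\<integral>x. four a x * f x \<partial>V) < e"
  proof eventually_elim
    case (elim F)
    have int: "integrable V (\<lambda>x. ch k x * f x)" for k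
      by (intro torfun_integrable torfun_mult torfun_ch f)
    have "(\<Sum>k\<in>F. a k * (\<integral>x. ch k x * f x \<partial>V)) = (\<integral>x. (\<Sum>k\<in>F. a k * ch k x) * f x \<partial>V)"
      using int by (simp add: sum_distrib_right mult.assoc)
    also have "\<dots> - (\<integral>x. four a x * f x \<partial>V) = (\<integral>x. ((\<Sum>k\<in>F. a k * ch k x) - four a x) * f x \<partial>V)"
      using int by (subst Bochner_Integration.integral_diff[symmetric])
        (auto simp: sum_distrib_right mult.assoc left_diff_distrib intro!: torfun_integrable[OF torfun_mult[OF torfun_four[OF a] f]])
    also have "norm \<dots> \<le> e / 2"
    proof (rule norm_integral_V_le)
      show "torfun (\<lambda>x. ((\<Sum>k\<in>F. a k * ch k x) - four a x) * f x)"
        using torfun_ch f torfun_four[OF a] unfolding torfun_def periodic_def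
        by (auto intro!: continuous_intros)
      show "norm (((\<Sum>k\<in>F. a k * ch k x) - four a x) * f x) \<le> e / 2" for x
      proof -
        have "norm (((\<Sum>k\<in>F. a k * ch k x) - four a x) * f x) \<le> e / (2 * M) * M"
          unfolding norm_mult using elim M(2)[of x] M(1) \<open>e > 0\<close>
          by (intro mult_mono) (auto simp: dist_norm less_imp_le)
        then show ?thesis using M(1) by simp
      qed
    qed
    finally show ?case using \<open>e > 0\<close> by (simp add: dist_norm)
  qed
qed

lemma fc_four:
  assumes "asum a" shows "fc (four a) k = a k"
proof -
  have "((\<lambda>j. a j * (\<integral>x. ch j x * ch (- k) x \<partial>V)) has_sum fc (four a) k) UNIV"
    unfolding fc_def by (rule four_integral[OF assms torfun_ch])
  moreover have "a j * (\<integral>x. ch j x * ch (- k) x \<partial>V) = (if j = k then a k else 0)" for j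
    using ch_add[of j "- k", symmetric] by (simp add: integral_ch)
  ultimately have "((\<lambda>j. if j = k then a k else 0) has_sum fc (four a) k) UNIV" by simp
  moreover have "((\<lambda>j. if j = k then a k else 0) has_sum a k) UNIV"
    by (rule has_sum_finite_neutralI[of "{k}"]) auto
  ultimately show ?thesis using has_sum_unique by blast
qed

subsection \<open>Uniqueness of Fourier coefficients\<close>

text \<open>The two basic characters separate the points of the torus, because equal values of
  \<open>cis\<close> mean lattice coordinates that differ by integers. So every periodic function
  factors through them.\<close>

lemma ch_eq_imp_torfun_eq:
  assumes "periodic c d h" "ch (1,0) x = ch (1,0) y" "ch (0,1) x = ch (0,1) y"
  shows "h x = h y"
proof -
  obtain s t s' t' where st: "coord x = (s, t)" "coord y = (s', t')" by fastforce
  then have xy: "x = lat (s, t)" "y = lat (s', t')" by (metis lat_coord)+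
  have *: "\<exists>n::int. u = u' + of_int n" if "cis (2 * pi * u) = cis (2 * pi * u')" for u u'
  proof -
    from that obtain n :: int where "complex_of_real (2 * pi * u) * \<i> = complex_of_real (2 * pi * u') * \<i> + of_real (of_int (2 * n) * pi) * \<i>"
      unfolding cis_conv_exp exp_eq by (auto simp: mult.commute)
    then have "2 * pi * u = 2 * pi * u' + of_int (2 * n) * pi"
      by (metis (no_types, lifting) complex_i_not_zero distrib_right mult_cancel_right of_real_add of_real_eq_iff)
    then have "2 * pi * u = 2 * pi * (u' + of_int n)" by (simp add: algebra_simps)
    then have "u = u' + of_int n" by simp
    then show ?thesis ..
  qed
  from assms(2,3) obtain m n where "s = s' + of_int m" "t = t' + of_int n"
    using *[of s s'] *[of t t'] by (auto simp: ch_def xy ph_lat)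
  then show ?thesis using periodic_lat[OF assms(1)] by (simp add: xy)
qed

text \<open>The annihilator of all characters among the real continuous functions. It is stable
  under multiplication by polynomials in the characters, which will force it to be zero.\<close>

definition coef0 :: "(plane \<Rightarrow> real) set" where
  "coef0 = {h. torfun h \<and> (\<forall>k. fcr h k = 0)}"

definition emb :: "plane \<Rightarrow> complex \<times> complex" where "emb x = (ch (1,0) x, ch (0,1) x)"

lemma continuous_on_emb: "continuous_on A emb"
  unfolding emb_def using torfun_ch continuous_on_subset[of UNIV _ A]
  by (auto simp: torfun_def intro!: continuous_intros)

text \<open>A real linear functional of \<open>emb\<close> is a combination of the two basic
  characters and their conjugates, and multiplication by a character only shifts the
  coefficients.\<close>

lemma coef0_mult_linear:
  assumes h: "h \<in> coef0" and L: "bounded_linear L"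
  shows "(\<lambda>x. h x * L (emb x)) \<in> coef0"
proof -
  define A where "A = Complex (L (1,0)) (- L (\<i>,0))"
  define B where "B = Complex (L (0,1)) (- L (0,\<i>))"
  have "L (z, w) = Re (A * z) + Re (B * w)" for z w
  proof -
    have "(z, w) = Re z *\<^sub>R (1,0) + Im z *\<^sub>R (\<i>,0) + Re w *\<^sub>R (0,1) + Im w *\<^sub>R (0,\<i>)"
      by (auto simp: complex_eq_iff)
    then have "L (z, w) = Re z * L (1,0) + Im z * L (\<i>,0) + Re w * L (0,1) + Im w * L (0,\<i>)"
      by (simp only: linear_simps(1,5)[OF L] real_scaleR_def)
    then show ?thesis by (simp add: A_def B_def algebra_simps)
  qed
  moreover have "complex_of_real (Re z) = (z + cnj z) / 2" for z by (simp add: complex_eq_iff)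
  ultimately have "complex_of_real (L (emb x)) =
     (A * ch (1,0) x + cnj A * ch (-(1,0)) x) / 2 + (B * ch (0,1) x + cnj B * ch (-(0,1)) x) / 2" for x
    by (simp only: emb_def of_real_add complex_cnj_mult ch_cnj)
  then have eq: "complex_of_real (h x * L (emb x)) =
     A/2 * (of_real (h x) * ch (1,0) x) + cnj A/2 * (of_real (h x) * ch (-(1,0)) x)
     + (B/2 * (of_real (h x) * ch (0,1) x) + cnj B/2 * (of_real (h x) * ch (-(0,1)) x))" for x
    unfolding of_real_mult by (simp add: algebra_simps add_divide_distrib)
  have hc: "torfun (\<lambda>x. complex_of_real (h x))" and h0: "\<And>k. fcr h k = 0"
    using h torfun_of_real by (auto simp: coef0_def)
  have t: "torfun (\<lambda>x. a * (complex_of_real (h x) * ch j x))" for a j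
    by (intro torfun_mult torfun_const hc torfun_ch)
  have t': "torfun (\<lambda>x. a * (complex_of_real (h x) * ch j x) + b * (complex_of_real (h x) * ch l x))" for a j b l
    by (intro torfun_add t)
  have "fcr (\<lambda>x. h x * L (emb x)) k = 0" for k
    unfolding eq by (subst fc_add[OF t' t'], (subst fc_add[OF t t])+) (simp only: fc_cmult fc_mult_ch h0, simp)
  moreover have "torfun (\<lambda>x. L (emb x))"
    using linear_continuous_on[OF L] continuous_on_emb torfun_ch
    unfolding torfun_def periodic_def emb_def by (auto intro: continuous_on_compose2)
  ultimately show ?thesis
    using h by (auto simp: coef0_def torfun_mult)
qed

text \<open>The factor h stays arbitrary in the induction because a product of polynomials is
  multiplied on in two successive steps.\<close>

lemma coef0_mult_polynomial:
  assumes "real_polynomial_function p"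
  shows "h \<in> coef0 \<Longrightarrow> (\<lambda>x. h x * p (emb x)) \<in> coef0"
  using assms
proof (induction p arbitrary: h)
  case (linear f)
  then show ?case using coef0_mult_linear by blast
next
  case (const a)
  then show ?case 
    unfolding coef0_def torfun_def periodic_def
    by (auto simp: fc_cmult mult.commute[of _ a] intro: continuous_intros)
next
  case (add f g)
  have "torfun (\<lambda>x. complex_of_real (h x * f (emb x)))" "torfun (\<lambda>x. complex_of_real (h x * g (emb x)))"
    using add.IH[OF add.prems] unfolding coef0_def by (simp_all only: mem_Collect_eq torfun_of_real)
  from fc_add[OF this] show ?case
    using add.IH[OF add.prems] by (auto simp: coef0_def distrib_left torfun_def periodic_def intro!: continuous_intros)
next
  case (mult f g)
  then show ?case by (simp flip: mult.assoc)
qed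

text \<open>Stone-Weierstrass. Since \<open>emb\<close> is a quotient map from a compact square onto
  its image T, h descends to a continuous g on T. A polynomial p within e/M of g gives
  \<open>\<integral> h^2 = \<integral> h (h - p) \<le> e\<close>, because h annihilates polynomials
  in the characters.\<close>

lemma fcr_unique:
  assumes h: "torfun h" and 0: "\<And>k. fcr h k = 0"
  shows "h x = 0"
proof -
  define T where "T = emb ` lat ` unit_square"
  have embT: "emb x \<in> T" for x
  proof -
    obtain s t where st: "coord x = (s, t)" by fastforce
    have "emb x = emb (lat (frac s + of_int \<lfloor>s\<rfloor>, frac t + of_int \<lfloor>t\<rfloor>))"
      using st by (metis lat_coord frac_def diff_add_cancel)
    also have "\<dots> = emb (lat (frac s, frac t))"
      using periodic_lat[of "ch _"] torfun_ch unfolding torfun_def emb_def by simp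
    finally show ?thesis unfolding T_def by (auto simp: cbox_Pair_eq frac_lt_1 less_imp_le)
  qed
  define g where "g y = h (SOME x. emb x = y)" for y
  have g: "g (emb x) = h x" for x
    unfolding g_def
    by (rule someI2[of _ x]) (use h in \<open>auto simp: torfun_def emb_def intro: ch_eq_imp_torfun_eq\<close>)
  have cf: "continuous_on unit_square (\<lambda>p. emb (lat p))"
    by (intro continuous_on_compose2[OF continuous_on_emb continuous_on_lat]) auto
  have T: "compact T" 
    using compact_continuous_image[OF cf compact_cbox] by (simp add: T_def image_image)
  have "continuous_on T g"
  proof -
    have "openin (top_of_set T) (T \<inter> g -` U)" if "open U" for U
    proof -
      have "unit_square \<inter> (\<lambda>p. emb (lat p)) -` (T \<inter> g -` U) = unit_square \<inter> (\<lambda>p. h (lat p)) -` U"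
        by (rule set_eqI) (simp add: embT g)
      moreover have "continuous_on unit_square (\<lambda>p. h (lat p))"
        by (rule continuous_on_compose2[OF _ continuous_on_lat]) (use h torfun_def in auto)
      ultimately have "openin (top_of_set unit_square) (unit_square \<inter> (\<lambda>p. emb (lat p)) -` (T \<inter> g -` U))"
        using that continuous_openin_preimage_gen by metis
      then show ?thesis
        using Abstract_Topology_2.continuous_imp_quotient_map[OF cf _ compact_cbox, of T "T \<inter> g -` U"] by (auto simp: T_def)
    qed
    then show ?thesis by (simp add: continuous_on_open_gen[of g T UNIV] )
  qed
  obtain M where M: "M > 0" "\<And>x. norm (h x) \<le> M" using torfun_bounded[OF h] by blast
  have hh: "torfun (\<lambda>x. h x * h x)" using h torfun_mult by blast
  have "(\<integral>x. h x * h x \<partial>V) \<le> e" if "e > 0" for e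
  proof -
    have "e / M > 0" using that M by simp
    then obtain p where p: "real_polynomial_function p" "\<And>y. y \<in> T \<Longrightarrow> \<bar>g y - p y\<bar> < e / M"
      using Stone_Weierstrass_real_polynomial_function[OF T \<open>continuous_on T g\<close>] by metis
    have hp: "(\<lambda>x. h x * p (emb x)) \<in> coef0"
      using coef0_mult_polynomial[OF p(1)] h 0 by (auto simp: coef0_def)
    then have "complex_of_real (\<integral>x. h x * p (emb x) \<partial>V) = 0"
      unfolding coef0_def fc_def using ch_0
      by (metis (mono_tags, lifting) Bochner_Integration.integral_cong integral_complex_of_real mem_Collect_eq minus_zero mult.right_neutral)
    then have "(\<integral>x. h x * h x \<partial>V) = (\<integral>x. h x * h x \<partial>V) - (\<integral>x. h x * p (emb x) \<partial>V)" by simp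
    also have "\<dots> = (\<integral>x. h x * h x - h x * p (emb x) \<partial>V)"
      using hp hh torfun_integrable by (intro Bochner_Integration.integral_diff[symmetric]) (auto simp: coef0_def)
    also have "\<dots> \<le> norm \<dots>" by simp
    also have "\<dots> \<le> e"
    proof (rule norm_integral_V_le)
      show "torfun (\<lambda>x. h x * h x - h x * p (emb x))"
        using hp hh torfun_diff by (auto simp: coef0_def)
      show "norm (h x * h x - h x * p (emb x)) \<le> e" for x
      proof -
        have "norm (h x * (h x - p (emb x))) \<le> M * (e / M)"
          unfolding norm_mult using M(2)[of x] M(1) p(2)[OF embT[of x]] that
          by (intro mult_mono) (auto simp: g)
        then show ?thesis using M(1) by (simp add: right_diff_distrib)
      qed
    qed
    finally show ?thesis .
  qed
  then have "(\<integral>x. h x * h x \<partial>V) \<le> 0" by (rule dense_ge)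
  moreover have "(\<integral>x. h x * h x \<partial>V) \<ge> 0" by (intro integral_nonneg_AE) simp
  ultimately have "(\<integral>x. h x * h x \<partial>V) = 0" by simp
  with hh have "h x * h x = 0"
    unfolding torfun_def by (intro integral_V_eq_0[of "\<lambda>x. h x * h x"]) auto
  then show ?thesis by simp
qed

end

context rhombic_torus
begin

subsection \<open>Rapidly decreasing coefficients\<close>

text \<open>A weight that is at least 1 and submultiplicative under addition of frequencies
  (\<open>sz_add\<close>), so that convolution preserves polynomial decay.\<close>

definition sz :: "freq \<Rightarrow> real" where "sz k = 1 + \<bar>of_int (fst k)\<bar> + \<bar>of_int (snd k)\<bar>"

definition rapid :: "(freq \<Rightarrow> complex) \<Rightarrow> bool" where
  "rapid a \<longleftrightarrow> (\<forall>s. \<exists>C. \<forall>k. norm (a k) * sz k ^ s \<le> C)"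

lemma sz_ge_1: "sz k \<ge> 1" by (simp add: sz_def)

lemma sz_add: "sz (j + k) \<le> sz j * sz k"
proof -
  have "sz (j + k) \<le> sz j + sz k - 1" by (simp add: sz_def)
  moreover have "(sz j - 1) * (sz k - 1) \<ge> 0" using sz_ge_1 by simp
  ultimately show ?thesis by (simp add: algebra_simps)
qed

text \<open>The fourth power dominates a product of squares, one for each index, whose reciprocals
  are summable separately. Decay of order s + 4 therefore gives weighted summability of order
  s.\<close>

lemma summable_sz: "(\<lambda>k. 1 / sz k ^ 4) summable_on UNIV"
proof -
  define u :: "int \<Rightarrow> real" where "u m = 1 / (1 + \<bar>of_int m\<bar>)\<^sup>2" for m
  have s: "summable (\<lambda>n::nat. 1 / (1 + real n)\<^sup>2)"
    using summable_Suc_iff[THEN iffD2, OF inverse_power_summable[of 2, where ?'a = real]]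
    by (simp add: inverse_eq_divide)
  then have "(u \<circ> int) summable_on UNIV" "(u \<circ> (\<lambda>n. - int n)) summable_on UNIV"
    by (subst summable_on_UNIV_nonneg_real_iff; simp add: u_def o_def)+
  then have "u summable_on range int" "u summable_on range (\<lambda>n. - int n)"
    by (auto simp: summable_on_reindex inj_on_def)
  from summable_on_union[OF this] have "u summable_on (range int \<union> range (\<lambda>n. - int n))" .
  moreover have "range int \<union> range (\<lambda>n. - int n) = UNIV"
    using int_cases2 by (auto simp: image_iff) (metis int_cases2)
  ultimately have u: "u summable_on UNIV" by simp
  then have "(u has_sum (\<Sum>\<^sub>\<infinity>m. u m)) UNIV" by simp
  then have "(\<lambda>k. u (fst k) * u (snd k)) summable_on Sigma UNIV (\<lambda>_. UNIV)"
    using u by (intro summable_on_SigmaI[where g = "\<lambda>m. u m * (\<Sum>\<^sub>\<infinity>m. u m)"])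
      (simp_all add: has_sum_cmult_right summable_on_cmult_left, simp add: u_def)
  then have "(\<lambda>k. u (fst k) * u (snd k)) summable_on UNIV" by simp
  then show ?thesis
  proof (rule summable_on_comparison_test)
    fix k :: freq
    have "((1 + \<bar>of_int (fst k)\<bar>) * (1 + \<bar>of_int (snd k)\<bar>)) ^ 2 \<le> (sz k * sz k) ^ 2"
      by (intro power_mono mult_mono) (auto simp: sz_def)
    then have le: "(1 + \<bar>of_int (fst k)\<bar>)\<^sup>2 * (1 + \<bar>of_int (snd k)\<bar>)\<^sup>2 \<le> sz k ^ 4"
      by (simp add: power_mult_distrib flip: power_add)
    have "0 < (1 + \<bar>real_of_int (fst k)\<bar>)\<^sup>2 * (1 + \<bar>real_of_int (snd k)\<bar>)\<^sup>2"
      by (intro mult_pos_pos zero_less_power) auto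
    with le show "1 / sz k ^ 4 \<le> u (fst k) * u (snd k)"
      unfolding u_def times_divide_times_eq mult_1 
      using sz_ge_1[of k] by (intro divide_left_mono mult_pos_pos[of "sz k ^ 4"]) auto
  qed (use sz_ge_1 in \<open>auto simp: order_trans[OF zero_le_one]\<close>)
qed

lemma rapid_asum_sz:
  assumes "rapid a" shows "(\<lambda>k. norm (a k) * sz k ^ s) summable_on UNIV"
proof -
  from assms obtain C where C: "\<And>k. norm (a k) * sz k ^ (s + 4) \<le> C" unfolding rapid_def by blast
  have pos: "sz k > 0" for k using sz_ge_1[of k] by linarith
  have "(\<lambda>k. C * (1 / sz k ^ 4)) summable_on UNIV" 
    by (intro summable_on_cmult_right summable_sz)
  then show ?thesis
  proof (rule summable_on_comparison_test)
    show "norm (a k) * sz k ^ s \<le> C * (1 / sz k ^ 4)" for k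
      using C[of k] pos[of k] by (simp add: field_simps power_add)
  qed (use pos in \<open>simp add: less_imp_le\<close>)
qed

lemma rapid_asum: "rapid a \<Longrightarrow> asum a"
  using rapid_asum_sz[of a 0] by simp

definition C_ph :: real where "C_ph = 2 * pi * (1 + 1 / d)"

lemma ph_bound: "\<bar>ph k v\<bar> \<le> C_ph * sz k * norm v"
proof -
  have 1: "\<bar>fst v\<bar> \<le> norm v" "\<bar>snd v\<bar> \<le> norm v" using norm_fst_le[of "fst v" "snd v"] norm_snd_le[of "snd v" "fst v"] by simp_all
  have 2: "\<bar>of_int (fst k) * fst v\<bar> \<le> sz k * norm v"
    unfolding abs_mult by (intro mult_mono 1) (auto simp: sz_def)
  have "c * \<bar>real_of_int (fst k)\<bar> \<le> \<bar>of_int (fst k)\<bar>"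
    using c_half c0 by (intro mult_left_le_one_le) auto
  then have "\<bar>of_int (snd k) - c * of_int (fst k)\<bar> \<le> sz k"
    using abs_triangle_ineq4[of "of_int (snd k)" "c * of_int (fst k)"] c0 by (simp add: sz_def abs_mult)
  then have 3: "\<bar>(of_int (snd k) - c * of_int (fst k)) / d * snd v\<bar> \<le> sz k / d * norm v"
    unfolding abs_mult abs_divide using d0 by (intro mult_mono 1 divide_mono) auto
  have "\<bar>ph k v\<bar> \<le> 2 * pi * (sz k * norm v + sz k / d * norm v)"
    unfolding ph_def abs_mult[of "2 * pi"] using add_mono[OF 2 3]
    by (intro mult_mono order_trans[OF abs_triangle_ineq]) auto
  also have "\<dots> = C_ph * sz k * norm v" by (simp add: C_ph_def algebra_simps)
  finally show ?thesis .
qed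

lemma C_ph_pos: "C_ph > 0"
  using d0 by (auto simp: C_ph_def intro!: mult_pos_pos add_pos_pos)

abbreviation cdiff :: "plane \<Rightarrow> (freq \<Rightarrow> complex) \<Rightarrow> freq \<Rightarrow> complex" where
  "cdiff v a \<equiv> \<lambda>k. a k * (\<i> * of_real (ph k v))"

lemma norm_cdiff: "norm (cdiff v a k) \<le> C_ph * norm v * (norm (a k) * sz k)"
proof -
  have "norm (cdiff v a k) = norm (a k) * \<bar>ph k v\<bar>" by (simp add: norm_mult)
  also have "\<dots> \<le> norm (a k) * (C_ph * sz k * norm v)" by (intro mult_left_mono ph_bound) auto
  finally show ?thesis by (simp add: mult_ac)
qed

lemma rapid_cdiff: assumes "rapid a" shows "rapid (cdiff v a)"
  unfolding rapid_def
proof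
  fix s
  from assms obtain C where C: "\<And>k. norm (a k) * sz k ^ Suc s \<le> C" unfolding rapid_def by blast
  have "norm (cdiff v a k) * sz k ^ s \<le> C_ph * norm v * C" for k
  proof -
    have "norm (cdiff v a k) * sz k ^ s \<le> C_ph * norm v * (norm (a k) * sz k) * sz k ^ s"
      using sz_ge_1[of k] by (intro mult_right_mono norm_cdiff) auto
    also have "\<dots> = C_ph * norm v * (norm (a k) * sz k ^ Suc s)" by simp
    also have "\<dots> \<le> C_ph * norm v * C" using C_ph_pos by (intro mult_left_mono C) auto
    finally show ?thesis .
  qed
  then show "\<exists>C. \<forall>k. norm (cdiff v a k) * sz k ^ s \<le> C" by blast
qed

lemma cis_taylor: "norm (cis t - 1 - \<i> * of_real t) \<le> t\<^sup>2"
  using Taylor_exp[of "\<i> * of_real t" 1] by (simp add: cis_conv_exp norm_mult power2_eq_square algebra_simps)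

text \<open>Termwise differentiation with a quadratic remainder: the error of the k-th term is at
  most \<open>norm (a k)\<close> times the square of \<open>C_ph * sz k * norm (y - x)\<close>, and
  rapid decay makes the sum S2 of the resulting weights finite.\<close>

lemma has_derivative_four:
  assumes a: "rapid a"
  shows "(four a has_derivative (\<lambda>v. four (cdiff v a) x)) (at x)"
proof -
  have sum1: "asum a" "asum (cdiff v a)" for v using a rapid_cdiff rapid_asum by auto
  define S1 where "S1 = (\<Sum>\<^sub>\<infinity>k. norm (a k) * sz k)"
  define S2 where "S2 = (\<Sum>\<^sub>\<infinity>k. norm (a k) * sz k ^ 2)"
  have S1: "((\<lambda>k. norm (a k) * sz k) has_sum S1) UNIV" and S2: "((\<lambda>k. norm (a k) * sz k ^ 2) has_sum S2) UNIV"
    using rapid_asum_sz[OF a, of 1] rapid_asum_sz[OF a, of 2] by (simp_all add: S1_def S2_def)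
  have bl: "bounded_linear (\<lambda>v. four (cdiff v a) x)"
  proof (rule bounded_linear_intro[where K = "C_ph * S1"])
    fix v w :: plane and r :: real
    have "((\<lambda>k. cdiff v a k * ch k x + cdiff w a k * ch k x) has_sum (four (cdiff v a) x + four (cdiff w a) x)) UNIV"
      by (intro has_sum_add four_has_sum sum1)
    moreover have "cdiff v a k * ch k x + cdiff w a k * ch k x = cdiff (v + w) a k * ch k x" for k
      using bounded_linear_ph[of k] by (simp add: linear_simps algebra_simps)
    ultimately show "four (cdiff (v + w) a) x = four (cdiff v a) x + four (cdiff w a) x"
      using has_sum_unique[OF four_has_sum[OF sum1(2)[of "v + w"]]] by simp
    have "((\<lambda>k. of_real r * (cdiff v a k * ch k x)) has_sum of_real r * four (cdiff v a) x) UNIV"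
      by (intro has_sum_cmult_right four_has_sum sum1)
    moreover have "of_real r * (cdiff v a k * ch k x) = cdiff (r *\<^sub>R v) a k * ch k x" for k
      by (simp add: ph_scaleR)
    ultimately show "four (cdiff (r *\<^sub>R v) a) x = r *\<^sub>R four (cdiff v a) x"
      using has_sum_unique[OF four_has_sum[OF sum1(2)[of "r *\<^sub>R v"]]] by (simp add: scaleR_conv_of_real)
    show "norm (four (cdiff v a) x) \<le> norm v * (C_ph * S1)"
    proof (rule norm_infsum_le[OF four_has_sum[OF sum1(2)]])
      show "((\<lambda>k. C_ph * norm v * (norm (a k) * sz k)) has_sum norm v * (C_ph * S1)) UNIV"
        using has_sum_cmult_right[OF S1, of "C_ph * norm v"] by (simp add: mult_ac)
      show "norm (cdiff v a k * ch k x) \<le> C_ph * norm v * (norm (a k) * sz k)" for k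
        using norm_cdiff[of a k v] by (simp add: norm_mult)
    qed
  qed
  have err: "norm (four a y - four a x - four (cdiff (y - x) a) x) \<le> (C_ph\<^sup>2 * S2 * norm (y - x)) * norm (y - x)" for y
  proof -
    have eq: "a k * ch k y - a k * ch k x - cdiff (y - x) a k * ch k x
       = a k * ch k x * (cis (ph k (y - x)) - 1 - \<i> * of_real (ph k (y - x)))" for k
      using ch_plus[of k x "y - x"] by (simp add: ch_def algebra_simps)
    have "((\<lambda>k. a k * ch k y - a k * ch k x - cdiff (y - x) a k * ch k x) has_sum
        (four a y - four a x - four (cdiff (y - x) a) x)) UNIV"
      unfolding diff_conv_add_uminus by (intro has_sum_add has_sum_uminusI four_has_sum sum1)
    then show ?thesis
    proof (rule norm_infsum_le)
      show "((\<lambda>k. (C_ph\<^sup>2 * (norm (y - x))\<^sup>2) * (norm (a k) * sz k ^ 2)) has_sum C_ph\<^sup>2 * S2 * norm (y - x) * norm (y - x)) UNIV"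
        using has_sum_cmult_right[OF S2, of "C_ph\<^sup>2 * (norm (y - x))\<^sup>2"] by (simp add: mult_ac power2_eq_square)
      fix k
      have "norm (cis (ph k (y - x)) - 1 - \<i> * of_real (ph k (y - x))) \<le> (ph k (y - x))\<^sup>2" by (rule cis_taylor)
      also have "\<dots> \<le> (C_ph * sz k * norm (y - x))\<^sup>2"
        using power_mono[OF ph_bound[of k "y - x"], of 2] by simp
      finally show "norm (a k * ch k y - a k * ch k x - cdiff (y - x) a k * ch k x) \<le> C_ph\<^sup>2 * (norm (y - x))\<^sup>2 * (norm (a k) * sz k ^ 2)"
        unfolding eq norm_mult using mult_left_mono[OF _ norm_ge_zero[of "a k"]]
        by (fastforce simp: power_mult_distrib mult_ac)
    qed
  qed
  have S2_nonneg: "S2 \<ge> 0" unfolding S2_def using sz_ge_1 by (intro infsum_nonneg) simp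
  show ?thesis
    unfolding has_derivative_at_alt
  proof (intro conjI allI impI bl)
    fix e :: real assume "e > 0"
    have pos: "C_ph\<^sup>2 * S2 + 1 > 0" using S2_nonneg by (auto intro: add_nonneg_pos)
    show "\<exists>\<delta>>0. \<forall>y. norm (y - x) < \<delta> \<longrightarrow> norm (four a y - four a x - four (cdiff (y - x) a) x) \<le> e * norm (y - x)"
    proof (intro exI[of _ "e / (C_ph\<^sup>2 * S2 + 1)"] conjI allI impI)
      show "e / (C_ph\<^sup>2 * S2 + 1) > 0" using \<open>e > 0\<close> pos by simp
      fix y assume "norm (y - x) < e / (C_ph\<^sup>2 * S2 + 1)"
      then have "norm (y - x) * (C_ph\<^sup>2 * S2 + 1) < e" using pos by (simp add: pos_less_divide_eq)
      then have "C_ph\<^sup>2 * S2 * norm (y - x) + norm (y - x) < e" by (simp add: distrib_left mult_ac)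
      then have "C_ph\<^sup>2 * S2 * norm (y - x) \<le> e" using norm_ge_zero[of "y - x"] by linarith
      from mult_right_mono[OF this norm_ge_zero[of "y - x"]] err[of y]
      show "norm (four a y - four a x - four (cdiff (y - x) a) x) \<le> e * norm (y - x)" by linarith
    qed
  qed
qed

lemma has_derivative_Re_four:
  "rapid a \<Longrightarrow> ((\<lambda>x. Re (four a x)) has_derivative (\<lambda>v. Re (four (cdiff v a) x))) (at x)"
  by (rule bounded_linear.has_derivative[OF bounded_linear_Re has_derivative_four])

lemma smooth_torus_Re_four: assumes "rapid a" shows "(\<lambda>x. Re (four a x)) \<in> smooth_torus c d"
proof -
  have "rapid a \<Longrightarrow> Ck_on n (\<lambda>x. Re (four a x)) UNIV" for n a
  proof (induction n arbitrary: a)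
    case 0
    then show ?case using torfun_Re[OF torfun_four[OF rapid_asum]] by (simp add: torfun_def)
  next
    case (Suc n)
    show ?case
      by (rule Ck_on_SucI[OF has_derivative_Re_four[OF Suc.prems]]) (intro Suc.IH rapid_cdiff Suc.prems)
  qed
  then show ?thesis
    using assms torfun_Re[OF torfun_four[OF rapid_asum]] by (auto simp: smooth_torus_def smooth_on_def torfun_def)
qed

subsection \<open>Fourier inversion and Parseval\<close>

text \<open>The derivative of f times the conjugate character integrates to zero, which moves the
  derivative onto the character.\<close>

lemma fcr_dird:
  assumes f: "f \<in> smooth_torus c d"
  shows "fcr (dird v f) k = \<i> * of_real (ph k v) * fcr f k"
proof -
  have tf: "torfun (\<lambda>x. complex_of_real (f x))" "torfun (\<lambda>x. complex_of_real (dird v f x))" for v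
    using f smooth_torus_dird torfun_smooth torfun_of_real by blast+
  have t1: "torfun (\<lambda>x. of_real (dird v f x) * ch (- k) x)" "torfun (\<lambda>x. of_real (f x) * ch (- k) x)" for v
    by (intro torfun_mult tf torfun_ch)+
  have "((\<lambda>x. of_real (f x) * ch (- k) x) has_derivative
      (\<lambda>v. of_real (f x) * (of_real (ph (- k) v) * (\<i> * ch (- k) x)) + of_real (dird v f x) * ch (- k) x)) (at x)" for x
    by (intro has_derivative_mult has_derivative_of_real smooth_has_derivative smooth_torusD f has_derivative_ch)
  moreover have "continuous_on UNIV (\<lambda>x. complex_of_real (f x) * (of_real (ph (- k) v) * (\<i> * ch (- k) x)) + of_real (dird v f x) * ch (- k) x)" for v
    using tf torfun_ch unfolding torfun_def by (intro continuous_on_add continuous_on_mult continuous_on_const) auto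
  ultimately have "(\<integral>x. of_real (f x) * (of_real (ph (- k) v) * (\<i> * ch (- k) x)) + of_real (dird v f x) * ch (- k) x \<partial>V) = 0"
    using t1(2) by (intro integral_derivative_zero[where g = "\<lambda>x. of_real (f x) * ch (- k) x"]) (auto simp: torfun_def)
  moreover have "of_real (f x) * (of_real (ph (- k) v) * (\<i> * ch (- k) x)) = - (\<i> * of_real (ph k v)) * (of_real (f x) * ch (- k) x)" for x
    by (simp add: ph_uminus)
  ultimately have "(\<integral>x. - (\<i> * of_real (ph k v)) * (of_real (f x) * ch (- k) x) + of_real (dird v f x) * ch (- k) x \<partial>V) = 0"
    by simp
  moreover have "(\<integral>x. - (\<i> * of_real (ph k v)) * (of_real (f x) * ch (- k) x) + of_real (dird v f x) * ch (- k) x \<partial>V)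
     = (\<integral>x. - (\<i> * of_real (ph k v)) * (of_real (f x) * ch (- k) x) \<partial>V) + (\<integral>x. of_real (dird v f x) * ch (- k) x \<partial>V)"
    by (intro Bochner_Integration.integral_add torfun_integrable torfun_mult[OF torfun_const] t1)
  ultimately have "- (\<i> * of_real (ph k v)) * fcr f k + fcr (dird v f) k = 0"
    unfolding fc_def integral_mult_right_zero by simp
  then show ?thesis by (simp add: algebra_simps)
qed

text \<open>Each further power of \<open>sz k\<close> is paid for by one derivative along either
  lattice generator, where the phase is 2 pi times an index of k.\<close>

lemma rapid_fcr:
  assumes "f \<in> smooth_torus c d" shows "rapid (fcr f)"
  unfolding rapid_def
proof
  fix s
  show "\<exists>C. \<forall>k. norm (fcr f k) * sz k ^ s \<le> C" using assms
  proof (induction s arbitrary: f)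
    case 0
    obtain M where "\<And>x. norm (f x) \<le> M" using torfun_bounded[OF torfun_smooth[OF 0]] by blast
    then have "norm (fcr f k) \<le> M" for k
      by (intro norm_fc_le torfun_of_real torfun_smooth 0) auto
    then show ?case by (intro exI[of _ M]) simp
  next
    case (Suc s)
    define v where "v = lat (1, 0)"
    define w where "w = lat (0, 1)"
    obtain C1 C2 C3 where C: "\<And>k. norm (fcr f k) * sz k ^ s \<le> C1"
      "\<And>k. norm (fcr (dird v f) k) * sz k ^ s \<le> C2"
      "\<And>k. norm (fcr (dird w f) k) * sz k ^ s \<le> C3"
      using Suc.IH[OF Suc.prems] Suc.IH[OF smooth_torus_dird[OF Suc.prems]] by metis
    have "norm (fcr f k) * sz k ^ Suc s \<le> C1 + C2 + C3" for k
    proof -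
      have nv: "norm (fcr (dird v f) k) = 2 * pi * \<bar>of_int (fst k)\<bar> * norm (fcr f k)"
        "norm (fcr (dird w f) k) = 2 * pi * \<bar>of_int (snd k)\<bar> * norm (fcr f k)"
        unfolding fcr_dird[OF Suc.prems] v_def w_def by (simp_all add: norm_mult ph_lat abs_mult)
      have p: "1 * y \<le> 2 * pi * y" if "y \<ge> 0" for y
        using that pi_ge_two by (intro mult_right_mono) auto
      have le: "\<bar>of_int (fst k)\<bar> * norm (fcr f k) \<le> norm (fcr (dird v f) k)"
        "\<bar>of_int (snd k)\<bar> * norm (fcr f k) \<le> norm (fcr (dird w f) k)"
        using p[of "\<bar>of_int (fst k)\<bar> * norm (fcr f k)"] p[of "\<bar>of_int (snd k)\<bar> * norm (fcr f k)"] 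
        by (simp_all add: nv mult.assoc)
      have "norm (fcr f k) * sz k ^ Suc s = (norm (fcr f k) + \<bar>of_int (fst k)\<bar> * norm (fcr f k) + \<bar>of_int (snd k)\<bar> * norm (fcr f k)) * sz k ^ s"
        by (simp add: sz_def algebra_simps)
      also have "\<dots> \<le> (norm (fcr f k) + norm (fcr (dird v f) k) + norm (fcr (dird w f) k)) * sz k ^ s"
        using sz_ge_1[of k] le by (intro mult_right_mono add_mono) auto
      also have "\<dots> \<le> C1 + C2 + C3" using C[of k] by (simp add: algebra_simps)
      finally show ?thesis .
    qed
    then show ?case by blast
  qed
qed

text \<open>Conjugation yields the same series, reindexed by negation of the frequencies.\<close>

lemma Im_four_zero:
  assumes a: "asum a" and sym: "\<And>k. cnj (a k) = a (- k)"
  shows "of_real (Re (four a x)) = four a x"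
proof -
  have "((\<lambda>k. cnj (a k * ch k x)) has_sum cnj (four a x)) UNIV"
    using four_has_sum[OF a] by (simp only: has_sum_cnj_iff)
  then have "((\<lambda>k. a (- k) * ch (- k) x) has_sum cnj (four a x)) UNIV"
    by (simp add: sym ch_cnj)
  moreover have "bij (uminus :: freq \<Rightarrow> freq)"
    by (rule bij_betw_byWitness[where f' = uminus]) (simp_all del: split_paired_all)
  ultimately have "((\<lambda>k. a k * ch k x) has_sum cnj (four a x)) UNIV"
    using has_sum_reindex_bij_betw[of uminus UNIV UNIV "\<lambda>k. a k * ch k x"] by simp
  then have "cnj (four a x) = four a x" using four_has_sum[OF a] has_sum_unique by blast
  then show ?thesis by (metis Reals_cnj_iff of_real_Re)
qed

lemma Re_four_fcr:
  assumes a: "asum a" and sym: "\<And>k. cnj (a k) = a (- k)"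
  shows "fcr (\<lambda>x. Re (four a x)) k = a k"
  by (simp add: Im_four_zero[OF a sym] fc_four[OF a])

text \<open>The series converges to a continuous function with the coefficients of f, so uniqueness
  applies to the difference.\<close>

lemma inversion:
  assumes f: "f \<in> smooth_torus c d"
  shows "four (fcr f) x = of_real (f x)"
proof -
  have a: "asum (fcr f)" using f rapid_asum rapid_fcr by blast
  have t: "torfun (\<lambda>x. Re (four (fcr f) x))" using torfun_Re torfun_four a by blast
  have "torfun (\<lambda>x. f x - Re (four (fcr f) x))"
    by (rule torfun_diff[OF torfun_smooth[OF f] t])
  moreover have "fcr (\<lambda>x. f x - Re (four (fcr f) x)) k = 0" for k
    using fc_diff[OF torfun_of_real[OF torfun_smooth[OF f]] torfun_of_real[OF t]]
    by (simp add: Re_four_fcr[OF a fcr_cnj] flip: of_real_diff)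
  ultimately have "f x - Re (four (fcr f) x) = 0" by (rule fcr_unique)
  then show ?thesis using Im_four_zero[OF a fcr_cnj, of x] by simp
qed

lemma parseval:
  assumes f: "f \<in> smooth_torus c d" and g: "torfun g"
  shows "((\<lambda>k. fcr f k * cnj (fcr g k)) has_sum of_real (\<integral>x. f x * g x \<partial>V)) UNIV"
proof -
  have "((\<lambda>k. fcr f k * (\<integral>x. ch k x * of_real (g x) \<partial>V)) has_sum (\<integral>x. four (fcr f) x * of_real (g x) \<partial>V)) UNIV"
    by (intro four_integral rapid_asum rapid_fcr f torfun_of_real g)
  moreover have "(\<integral>x. ch k x * of_real (g x) \<partial>V) = cnj (fcr g k)" for k
    unfolding fcr_cnj by (simp add: fc_def mult.commute)
  moreover have "(\<integral>x. four (fcr f) x * of_real (g x) \<partial>V) = of_real (\<integral>x. f x * g x \<partial>V)"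
    by (simp add: inversion[OF f] flip: of_real_mult)
  ultimately show ?thesis by simp
qed

lemma convolution:
  assumes f: "f \<in> smooth_torus c d" and g: "torfun g"
  shows "((\<lambda>j. fcr f j * fcr g (k - j)) has_sum fcr (\<lambda>x. f x * g x) k) UNIV"
proof -
  have "((\<lambda>j. fcr f j * (\<integral>x. ch j x * (of_real (g x) * ch (- k) x) \<partial>V)) has_sum
      (\<integral>x. four (fcr f) x * (of_real (g x) * ch (- k) x) \<partial>V)) UNIV"
    by (intro four_integral rapid_asum rapid_fcr f torfun_mult torfun_of_real g torfun_ch)
  moreover have "(\<integral>x. ch j x * (of_real (g x) * ch (- k) x) \<partial>V) = fcr g (k - j)" for j
    using ch_add[of j "- k"] by (simp add: fc_def mult_ac)
  moreover have "(\<integral>x. four (fcr f) x * (of_real (g x) * ch (- k) x) \<partial>V) = fcr (\<lambda>x. f x * g x) k"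
    by (simp add: fc_def inversion[OF f] mult.assoc)
  ultimately show ?thesis by simp
qed

end

text \<open>For c > 0 evaluate at the minimiser -b/c; c = 0 forces b = 0, and c < 0 is
  impossible.\<close>

lemma quadratic_nonneg_discriminant:
  fixes a b c :: real
  assumes "\<And>t. a + 2 * b * t + c * t\<^sup>2 \<ge> 0"
  shows "b\<^sup>2 \<le> a * c"
proof (cases "c = 0")
  case True
  have "b = 0"
  proof (rule ccontr)
    assume "b \<noteq> 0"
    then show False using assms[of "- (a + 1) / (2 * b)"] True by simp
  qed
  then show ?thesis using True by simp
next
  case False
  have a: "a \<ge> 0" using assms[of 0] by simp
  have "c > 0"
  proof (rule ccontr)
    assume "\<not> c > 0"
    with False have "c < 0" by simp
    \<comment> \<open>Large enough that c s^2 < -a. The linear terms at s and -s cancel, so the two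
      values cannot both be nonnegative.\<close>
    define s where "s = (a + 1) / (- c) + 1"
    have s1: "s \<ge> 1" using \<open>c < 0\<close> a by (simp add: s_def divide_nonneg_neg)
    have "c * s < - a" using \<open>c < 0\<close> by (simp add: s_def field_simps)
    moreover have "s \<le> s\<^sup>2" using s1 self_le_power[of s 2] by simp
    then have "c * s\<^sup>2 \<le> c * s" using \<open>c < 0\<close> by (intro mult_left_mono_neg) auto
    ultimately have "a + c * s\<^sup>2 < 0" by linarith
    moreover have "a + 2 * b * s + c * s\<^sup>2 \<ge> 0" "a + 2 * b * (- s) + c * (- s)\<^sup>2 \<ge> 0" using assms by blast+
    ultimately show False by simp
  qed
  have "a + 2 * b * (- b / c) + c * (- b / c)\<^sup>2 = a - b\<^sup>2 / c"
    using False by (simp add: field_simps power2_eq_square)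
  then have "b\<^sup>2 / c \<le> a" using assms[of "- b / c"] by simp
  then show ?thesis using \<open>c > 0\<close> by (simp add: pos_divide_le_eq)
qed

lemma dird_cmult: "smooth f \<Longrightarrow> dird v (\<lambda>x. r * f x) x = r * dird v f x"
  and dird_const: "dird v (\<lambda>x. r) x = 0"
  by (rule dird_eq[OF has_derivative_mult_right[OF smooth_has_derivative]], assumption) simp

context rhombic_torus
begin

section \<open>The Dirichlet form\<close>

definition Lam :: real where "Lam = 4 * pi\<^sup>2 / d"

text \<open>The eigenvalue of the character k for the unit-area flat metric, namely d times the
  squared length of the gradient of its phase (\<open>q_eq\<close>). The relation c^2 + d^2 = 1
  gives both squares the same coefficient.\<close>

definition q :: "freq \<Rightarrow> real" where
  "q k = Lam * ((of_int (fst k))\<^sup>2 + (of_int (snd k))\<^sup>2 - 2 * c * of_int (fst k) * of_int (snd k))"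

lemma Lam_pos: "Lam > 0" using d0 by (simp add: Lam_def)

lemma q_eq: "q k = d * ((ph k (1,0))\<^sup>2 + (ph k (0,1))\<^sup>2)"
proof -
  let ?m = "real_of_int (fst k)" and ?n = "real_of_int (snd k)"
  have "d * ((ph k (1,0))\<^sup>2 + (ph k (0,1))\<^sup>2) = 4 * pi\<^sup>2 / d * (?m\<^sup>2 * d\<^sup>2 + (?n - c * ?m)\<^sup>2)"
    using d0 by (simp add: ph_def field_simps power2_eq_square)
  also have "?m\<^sup>2 * d\<^sup>2 + (?n - c * ?m)\<^sup>2 = ?m\<^sup>2 * (c\<^sup>2 + d\<^sup>2) + ?n\<^sup>2 - 2 * c * ?m * ?n"
    by (simp add: power2_eq_square algebra_simps)
  finally show ?thesis by (simp add: q_def Lam_def cd)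
qed

lemma q_lower: "q k \<ge> Lam * ((of_int (fst k))\<^sup>2 + (of_int (snd k))\<^sup>2 - \<bar>of_int (fst k * snd k)\<bar>)"
proof -
  have "2 * c * of_int (fst k) * of_int (snd k) \<le> \<bar>2 * c * of_int (fst k) * of_int (snd k)\<bar>" by simp
  also have "\<dots> = 2 * c * \<bar>real_of_int (fst k * snd k)\<bar>" using c0 by (simp add: abs_mult)
  also have "\<dots> \<le> 1 * \<bar>real_of_int (fst k * snd k)\<bar>" using c_half by (intro mult_right_mono) auto
  finally show ?thesis unfolding q_def using Lam_pos by (intro mult_left_mono) auto
qed

lemma q_ge_half: "q k \<ge> Lam / 2 * ((of_int (fst k))\<^sup>2 + (of_int (snd k))\<^sup>2)"
proof -
  have "2 * \<bar>x * y\<bar> \<le> x\<^sup>2 + y\<^sup>2" for x y :: real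
    using sum_squares_bound[of "\<bar>x\<bar>" "\<bar>y\<bar>"] by (simp add: abs_mult)
  from this[of "of_int (fst k)" "of_int (snd k)"]
  have "Lam * (((of_int (fst k))\<^sup>2 + (of_int (snd k))\<^sup>2) / 2) \<le> Lam * ((of_int (fst k))\<^sup>2 + (of_int (snd k))\<^sup>2 - \<bar>of_int (fst k * snd k)\<bar>)"
    using Lam_pos by (intro mult_left_mono) auto
  with q_lower[of k] show ?thesis by simp
qed

text \<open>By c \<le> 1/2 the quadratic form is at least m^2 + n^2 - |m n|, which is a positive
  integer unless m = n = 0.\<close>

lemma q_ge_Lam: assumes "k \<noteq> 0" shows "q k \<ge> Lam"
proof -
  let ?m = "fst k" and ?n = "snd k"
  have "?m\<^sup>2 + ?n\<^sup>2 > 0" using assms by (auto simp: sum_power2_gt_zero_iff prod_eq_iff)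
  moreover have "2 * \<bar>?m * ?n\<bar> \<le> ?m\<^sup>2 + ?n\<^sup>2"
    using zero_le_power2[of "\<bar>?m\<bar> - \<bar>?n\<bar>"] by (simp add: abs_mult power2_diff)
  ultimately have "1 \<le> ?m\<^sup>2 + ?n\<^sup>2 - \<bar>?m * ?n\<bar>" by linarith
  then have "1 \<le> real_of_int (?m\<^sup>2 + ?n\<^sup>2 - \<bar>?m * ?n\<bar>)" by linarith
  then have "1 \<le> (of_int ?m)\<^sup>2 + (of_int ?n)\<^sup>2 - \<bar>real_of_int (?m * ?n)\<bar>" by simp
  then have "Lam * 1 \<le> Lam * ((of_int ?m)\<^sup>2 + (of_int ?n)\<^sup>2 - \<bar>real_of_int (?m * ?n)\<bar>)"
    using Lam_pos by (intro mult_left_mono) auto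
  with q_lower[of k] show ?thesis by linarith
qed

lemma q_0: "q 0 = 0" by (simp add: q_def)

lemma q_nonneg: "q k \<ge> 0"
  using q_0 q_ge_Lam[of k] Lam_pos by (cases "k = 0") auto

text \<open>Ellipticity: division by q gains two powers of \<open>sz\<close>. Of the factor 12, a 3
  is Cauchy-Schwarz for three terms, a 2 comes from 1 \<le> m^2 + n^2, and a 2 from
  \<open>q_ge_half\<close>.\<close>

lemma sz_le_q: assumes "k \<noteq> 0" shows "sz k * sz k \<le> 12 / Lam * q k"
proof -
  have *: "(1 + x + y)\<^sup>2 \<le> 3 * (1 + x\<^sup>2 + y\<^sup>2)" for x y :: real
  proof -
    have "0 \<le> (1 - x)\<^sup>2 + (1 - y)\<^sup>2 + (x - y)\<^sup>2" by simp
    then show ?thesis by (simp add: power2_eq_square algebra_simps)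
  qed
  have "(fst k)\<^sup>2 + (snd k)\<^sup>2 > 0" using assms by (auto simp: sum_power2_gt_zero_iff prod_eq_iff)
  then have "1 \<le> real_of_int ((fst k)\<^sup>2 + (snd k)\<^sup>2)" by linarith
  then have 1: "1 \<le> (real_of_int (fst k))\<^sup>2 + (real_of_int (snd k))\<^sup>2" by simp
  have "sz k * sz k \<le> 3 * (1 + (real_of_int (fst k))\<^sup>2 + (real_of_int (snd k))\<^sup>2)"
    using *[of "\<bar>of_int (fst k)\<bar>" "\<bar>of_int (snd k)\<bar>"] by (simp add: sz_def power2_eq_square)
  also have "\<dots> \<le> 6 * ((real_of_int (fst k))\<^sup>2 + (real_of_int (snd k))\<^sup>2)" using 1 by simp
  also have "\<dots> = 12 / Lam * (Lam / 2 * ((of_int (fst k))\<^sup>2 + (of_int (snd k))\<^sup>2))" using Lam_pos by (simp add: field_simps)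
  also have "\<dots> \<le> 12 / Lam * q k" using Lam_pos by (intro mult_left_mono q_ge_half) auto
  finally show ?thesis .
qed

lemma finite_q_less: "finite {k. q k < T}"
proof -
  define N :: int where "N = \<lceil>2 * T / Lam\<rceil> + 1"
  have "k \<in> {-N..N} \<times> {-N..N}" if "q k < T" for k
  proof -
    have "Lam / 2 * ((of_int (fst k))\<^sup>2 + (of_int (snd k))\<^sup>2) < T" using that q_ge_half[of k] by linarith
    then have s: "(of_int (fst k))\<^sup>2 + (of_int (snd k))\<^sup>2 < 2 * T / Lam" using Lam_pos by (simp add: field_simps)
    have a: "\<bar>x\<bar> \<le> x\<^sup>2" for x :: int
      using self_le_power[of "\<bar>x\<bar>" 2] by (cases "x = 0") auto
    have b: "real_of_int \<bar>x\<bar> \<le> (real_of_int x)\<^sup>2" for x :: int using a[of x] by (metis of_int_le_iff of_int_power)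
    have "real_of_int \<bar>fst k\<bar> \<le> of_int N" "real_of_int \<bar>snd k\<bar> \<le> of_int N"
      using s b[of "fst k"] b[of "snd k"] le_of_int_ceiling[of "2 * T / Lam"]
        zero_le_power2[of "real_of_int (fst k)"] zero_le_power2[of "real_of_int (snd k)"]
      unfolding N_def of_int_add of_int_1 by linarith+
    then have "\<bar>fst k\<bar> \<le> N" "\<bar>snd k\<bar> \<le> N" by linarith+
    then show ?thesis by (auto simp: mem_Times_iff abs_le_iff)
  qed
  then have "{k. q k < T} \<subseteq> {-N..N} \<times> {-N..N}" by blast
  then show ?thesis by (rule finite_subset) simp
qed

definition gr :: "(plane \<Rightarrow> real) \<Rightarrow> (plane \<Rightarrow> real) \<Rightarrow> plane \<Rightarrow> real" where
  "gr f g x = d * (dird (1,0) f x * dird (1,0) g x + dird (0,1) f x * dird (0,1) g x)"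

definition en :: "(plane \<Rightarrow> real) \<Rightarrow> (plane \<Rightarrow> real) \<Rightarrow> real" where
  "en f g = (\<integral>x. gr f g x \<partial>V)"

text \<open>The nonnegative Laplacian of the flat metric; the factor d is due to the unit-area
  normalisation.\<close>

definition lap :: "(plane \<Rightarrow> real) \<Rightarrow> plane \<Rightarrow> real" where
  "lap f x = - (d * eucl_laplacian f x)"

lemma dirichlet_energy_eq: "dirichlet_energy c d f = en f f"
  unfolding dirichlet_energy_def en_def gr_def norm_eucl_grad by (simp add: power2_eq_square)

lemma torfun_gr: "f \<in> smooth_torus c d \<Longrightarrow> g \<in> smooth_torus c d \<Longrightarrow> torfun (gr f g)"
  unfolding gr_def by (intro torfun_mult torfun_add torfun_const torfun_smooth smooth_torus_dird)

lemma smooth_torus_lap: "f \<in> smooth_torus c d \<Longrightarrow> lap f \<in> smooth_torus c d"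
  unfolding lap_def eucl_laplacian_eq mult_minus_left[symmetric]
  by (intro smooth_torus_cmult smooth_torus_add smooth_torus_dird)

lemma gr_sym: "gr f g = gr g f"
  by (simp add: gr_def fun_eq_iff mult.commute)

lemma en_sym: "en f g = en g f"
  by (simp add: en_def gr_sym)

lemma gr_nonneg: "gr f f x \<ge> 0"
  using d0 by (simp add: gr_def)

lemma en_nonneg: "en f f \<ge> 0"
  unfolding en_def by (intro integral_nonneg_AE) (simp add: gr_nonneg)

lemma gr_lincomb:
  assumes "f \<in> smooth_torus c d" "g \<in> smooth_torus c d"
  shows "gr (\<lambda>x. a * f x + b * g x) h x = a * gr f h x + b * gr g h x"
  using dird_mult_add(2)[OF smooth_mult smooth_mult, OF smooth_const _ smooth_const] dird_cmult assms[THEN smooth_torusD(1)]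
  by (simp add: gr_def algebra_simps)

lemma en_lincomb:
  assumes "f \<in> smooth_torus c d" "g \<in> smooth_torus c d" "h \<in> smooth_torus c d"
  shows "en (\<lambda>x. a * f x + b * g x) h = a * en f h + b * en g h"
  unfolding en_def gr_lincomb[OF assms(1,2)]
  using torfun_integrable[OF torfun_gr] assms by simp

lemma en_lincomb2:
  assumes "f \<in> smooth_torus c d" "g \<in> smooth_torus c d"
  shows "en (\<lambda>x. a * f x + b * g x) (\<lambda>x. a * f x + b * g x) = a\<^sup>2 * en f f + 2 * a * b * en f g + b\<^sup>2 * en g g"
proof -
  let ?h = "\<lambda>x. a * f x + b * g x"
  have h: "?h \<in> smooth_torus c d" using assms by (intro smooth_torus_add smooth_torus_cmult)
  have "en ?h ?h = a * en f ?h + b * en g ?h" by (rule en_lincomb[OF assms h])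
  moreover have "en f ?h = a * en f f + b * en g f"
    using en_lincomb[OF assms assms(1), of a b] by (simp only: en_sym[of ?h f])
  moreover have "en g ?h = a * en f g + b * en g g"
    using en_lincomb[OF assms assms(2), of a b] by (simp only: en_sym[of ?h g])
  ultimately show ?thesis by (simp add: en_sym[of g f] power2_eq_square algebra_simps)
qed

lemma en_cmult: "f \<in> smooth_torus c d \<Longrightarrow> en (\<lambda>x. r * f x) (\<lambda>x. r * f x) = r\<^sup>2 * en f f"
  using en_lincomb2[of f f r 0] by simp

lemma en_const: "f \<in> smooth_torus c d \<Longrightarrow> en f (\<lambda>x. a) = 0"
  by (simp add: en_def gr_def dird_const)

lemma green:
  assumes f: "f \<in> smooth_torus c d" and g: "g \<in> smooth_torus c d"
  shows "en f g = (\<integral>x. g x * lap f x \<partial>V)"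
proof -
  have *: "(\<integral>x. dird v g x * dird v f x + g x * dird v (dird v f) x \<partial>V) = 0" for v
  proof -
    have gf: "(\<lambda>x. g x * dird v f x) \<in> smooth_torus c d"
      using assms by (intro smooth_torus_mult smooth_torus_dird)
    have "(\<integral>x. dird v (\<lambda>x. g x * dird v f x) x \<partial>V) = 0"
      using gf smooth_torusD[OF gf] smooth_torus_dird[OF gf]
      by (intro integral_derivative_zero[where g = "\<lambda>x. g x * dird v f x"] smooth_has_derivative)
        (auto simp: smooth_torus_def smooth_continuous)
    then show ?thesis
      using dird_mult_add(1)[of g "dird v f"] assms smooth_torusD smooth_dird
      by (simp add: add.commute)
  qed
  have t: "torfun (\<lambda>x. dird v g x * dird v f x + g x * dird v (dird v f) x)" for v
    using assms by (intro torfun_add torfun_mult torfun_smooth smooth_torus_dird)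
  have l: "torfun (\<lambda>x. g x * lap f x)"
    using assms by (intro torfun_mult torfun_smooth smooth_torus_lap)
  have "en f g - (\<integral>x. g x * lap f x \<partial>V) = (\<integral>x. gr f g x - g x * lap f x \<partial>V)"
    unfolding en_def using torfun_integrable[OF torfun_gr[OF assms]] torfun_integrable[OF l] by simp
  also have "\<dots> = (\<integral>x. d * (dird (1,0) g x * dird (1,0) f x + g x * dird (1,0) (dird (1,0) f) x)
       + d * (dird (0,1) g x * dird (0,1) f x + g x * dird (0,1) (dird (0,1) f) x) \<partial>V)"
    by (intro Bochner_Integration.integral_cong) (auto simp: gr_def lap_def eucl_laplacian_eq algebra_simps)
  also have "\<dots> = 0"
    using torfun_integrable[OF t] * by (subst Bochner_Integration.integral_add) auto
  finally show ?thesis by simp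
qed

lemma fcr_lap:
  assumes f: "f \<in> smooth_torus c d" shows "fcr (lap f) k = of_real (q k) * fcr f k"
proof -
  have t: "torfun (\<lambda>x. complex_of_real (dird v (dird v f) x))" for v
    using f by (intro torfun_of_real torfun_smooth smooth_torus_dird)
  have "fcr (lap f) k = fc (\<lambda>x. - of_real d * (of_real (dird (1,0) (dird (1,0) f) x) + of_real (dird (0,1) (dird (0,1) f) x))) k"
    by (simp add: lap_def eucl_laplacian_eq)
  also have "\<dots> = - of_real d * (fcr (dird (1,0) (dird (1,0) f)) k + fcr (dird (0,1) (dird (0,1) f)) k)"
    unfolding fc_cmult fc_add[OF t t] ..
  also have "\<dots> = of_real (q k) * fcr f k"
    by (simp add: fcr_dird[OF smooth_torus_dird[OF f]] fcr_dird[OF f] q_eq power2_eq_square algebra_simps)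
  finally show ?thesis .
qed

lemma parseval_L2:
  assumes f: "f \<in> smooth_torus c d"
  shows "((\<lambda>k. (norm (fcr f k))\<^sup>2) has_sum (\<integral>x. (f x)\<^sup>2 \<partial>V)) UNIV"
proof -
  have "((\<lambda>k. complex_of_real ((norm (fcr f k))\<^sup>2)) has_sum of_real (\<integral>x. (f x)\<^sup>2 \<partial>V)) UNIV"
    using parseval[OF f torfun_smooth[OF f]] by (simp add: power2_eq_square complex_norm_square[symmetric, unfolded power2_eq_square])
  then show ?thesis by (simp only: has_sum_of_real_iff)
qed

lemma parseval_en:
  assumes f: "f \<in> smooth_torus c d"
  shows "((\<lambda>k. q k * (norm (fcr f k))\<^sup>2) has_sum en f f) UNIV"
proof -
  have eq: "fcr f k * cnj (fcr (lap f) k) = of_real (q k * (norm (fcr f k))\<^sup>2)" for k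
    unfolding fcr_lap[OF f] of_real_mult complex_norm_square by simp
  have "((\<lambda>k. complex_of_real (q k * (norm (fcr f k))\<^sup>2)) has_sum of_real (en f f)) UNIV"
    using parseval[OF f torfun_smooth[OF smooth_torus_lap[OF f]]] unfolding eq green[OF f f] .
  then show ?thesis by (simp only: has_sum_of_real_iff)
qed

text \<open>Frequencies with q \<ge> T carry at most \<open>en f f / T\<close> of the squared norm.
  For \<open>T = Lam\<close> this is the Poincare inequality; for large T it takes the place of
  Rellich compactness, since only finitely many coefficients remain.\<close>

lemma poincare_tail:
  assumes f: "f \<in> smooth_torus c d" and T: "T > 0"
  shows "(\<integral>x. (f x)\<^sup>2 \<partial>V) \<le> (\<Sum>k | q k < T. (norm (fcr f k))\<^sup>2) + en f f / T"
proof (rule has_sum_mono[OF parseval_L2[OF f]])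
  let ?g = "\<lambda>k. if q k < T then (norm (fcr f k))\<^sup>2 else 0"
  have "(?g has_sum (\<Sum>k | q k < T. (norm (fcr f k))\<^sup>2)) UNIV"
    by (rule has_sum_finite_neutralI[of "{k. q k < T}"]) (auto simp: finite_q_less intro: sum.cong)
  from has_sum_add[OF this has_sum_divide_const[OF parseval_en[OF f], of T]]
  show "((\<lambda>k. ?g k + q k * (norm (fcr f k))\<^sup>2 / T) has_sum (\<Sum>k | q k < T. (norm (fcr f k))\<^sup>2) + en f f / T) UNIV" .
  fix k
  show "(norm (fcr f k))\<^sup>2 \<le> ?g k + q k * (norm (fcr f k))\<^sup>2 / T"
  proof (cases "q k < T")
    case False
    then have "T * (norm (fcr f k))\<^sup>2 \<le> q k * (norm (fcr f k))\<^sup>2" by (intro mult_right_mono) auto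
    then show ?thesis using False T by (simp add: field_simps)
  qed (use T q_nonneg[of k] in auto)
qed

lemma poincare:
  assumes f: "f \<in> smooth_torus c d" and m: "(\<integral>x. f x \<partial>V) = 0"
  shows "Lam * (\<integral>x. (f x)\<^sup>2 \<partial>V) \<le> en f f"
proof -
  have "fcr f k = 0" if "q k < Lam" for k
  proof -
    have "k = 0" using q_ge_Lam[of k] that by (meson not_le)
    moreover have "fcr f 0 = of_real (\<integral>x. f x \<partial>V)" by (simp add: fc_def ch_0)
    ultimately show ?thesis using m by simp
  qed
  then have "(\<Sum>k | q k < Lam. (norm (fcr f k))\<^sup>2) = 0" by simp
  then show ?thesis using poincare_tail[OF f Lam_pos] Lam_pos by (simp add: field_simps)
qed

subsection \<open>Measures on the torus\<close>

lemma torfun_measurable: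
  fixes f :: "plane \<Rightarrow> 'b::euclidean_space"
  assumes \<mu>: "radon_measure c d \<mu>" and f: "torfun f" shows "f \<in> borel_measurable \<mu>"
proof -
  have "f \<in> borel_measurable borel" using f by (auto simp: torfun_def intro: borel_measurable_continuous_onI)
  then have "f \<in> borel_measurable (restrict_space borel dom)" by (rule measurable_restrict_space1)
  then show ?thesis using \<mu> by (simp add: radon_measure_def cong: measurable_cong_sets)
qed

lemma torfun_integrable_radon:
  fixes f :: "plane \<Rightarrow> 'b::euclidean_space"
  assumes \<mu>: "radon_measure c d \<mu>" and f: "torfun f" shows "integrable \<mu> f"
proof -
  interpret finite_measure \<mu> using \<mu> by (simp add: radon_measure_def)
  obtain M where "\<And>x. norm (f x) \<le> M" using torfun_bounded[OF f] by blast
  then show ?thesis by (intro integrable_const_bound[of _ M] torfun_measurable assms) auto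
qed

lemma space_radon: "radon_measure c d \<mu> \<Longrightarrow> space \<mu> = dom"
  unfolding radon_measure_def
  using sets_eq_imp_space_eq[of \<mu> "restrict_space borel dom"] by (simp add: space_restrict_space)

lemma radon_V: "radon_measure c d V"
  using sets_V finite_V by (simp add: radon_measure_def)

text \<open>A mean-zero form of the statement that the first eigenvalue is at least \<nu>, common to
  volume measures of smooth metrics and to admissible measures.\<close>

definition rayleigh_bound :: "real \<Rightarrow> plane measure \<Rightarrow> bool" where
  "rayleigh_bound \<nu> \<mu> \<longleftrightarrow> (\<forall>f\<in>smooth_torus c d. (\<integral>x. f x \<partial>\<mu>) = 0 \<longrightarrow> \<nu> * (\<integral>x. (f x)\<^sup>2 \<partial>\<mu>) \<le> en f f)"

text \<open>Only \<open>f\<close> has to have mean zero: subtracting its mean from \<open>g\<close> does not affect the left-hand side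
  or \<open>en g g\<close>.\<close>

lemma rayleigh_cauchy_schwarz:
  assumes \<mu>: "radon_measure c d \<mu>" and nz: "measure \<mu> (space \<mu>) \<noteq> 0" and \<nu>: "\<nu> \<ge> 0"
    and rb: "rayleigh_bound \<nu> \<mu>"
    and f: "f \<in> smooth_torus c d" and f0: "(\<integral>x. f x \<partial>\<mu>) = 0" and g: "g \<in> smooth_torus c d"
  shows "(en f g - \<nu> * (\<integral>x. f x * g x \<partial>\<mu>))\<^sup>2 \<le> (en f f - \<nu> * (\<integral>x. (f x)\<^sup>2 \<partial>\<mu>)) * en g g"
proof -
  interpret finite_measure \<mu> using \<mu> by (simp add: radon_measure_def)
  define m where "m = (\<integral>x. g x \<partial>\<mu>) / measure \<mu> (space \<mu>)"
  define h where "h x = 1 * g x + (- m) * 1" for x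
  have h: "h \<in> smooth_torus c d" unfolding h_def
    by (intro smooth_torus_add smooth_torus_cmult g smooth_torus_const)

  have [simp]: "integrable \<mu> f" "integrable \<mu> g" "integrable \<mu> h" "integrable \<mu> (\<lambda>x. (f x)\<^sup>2)" "integrable \<mu> (\<lambda>x. (h x)\<^sup>2)"
    "integrable \<mu> (\<lambda>x. f x * h x)" "integrable \<mu> (\<lambda>x. f x * g x)"
    unfolding power2_eq_square by (intro torfun_integrable_radon[OF \<mu>] torfun_smooth f g h torfun_mult)+
  have h0: "(\<integral>x. h x \<partial>\<mu>) = 0"
    using nz by (simp add: h_def m_def)
  have fh: "(\<integral>x. f x * h x \<partial>\<mu>) = (\<integral>x. f x * g x \<partial>\<mu>)"
  proof -
    have "f x * h x = f x * g x - m * f x" for x by (simp add: h_def algebra_simps)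
    then show ?thesis using f0 by simp
  qed
  have "en f h = en g f - m * en (\<lambda>x. 1) f"
    unfolding h_def en_sym[of f] using en_lincomb[OF g smooth_torus_const f, of 1 "-m" 1] by simp
  then have enfh: "en f h = en f g" using en_const[OF f] by (simp add: en_sym)
  have "en h h = en g g"
    unfolding h_def using en_lincomb2[OF g smooth_torus_const, of 1 "-m" 1] en_const[OF g] en_const[OF smooth_torus_const] by simp
  define Q where "Q = en h h - \<nu> * (\<integral>x. (h x)\<^sup>2 \<partial>\<mu>)"
  have "Q \<le> en g g" unfolding Q_def \<open>en h h = en g g\<close> using \<nu> by simp
  have Qf: "en f f - \<nu> * (\<integral>x. (f x)\<^sup>2 \<partial>\<mu>) \<ge> 0"
    using rb f f0 by (simp add: rayleigh_bound_def)
  have "(en f h - \<nu> * (\<integral>x. f x * h x \<partial>\<mu>))\<^sup>2 \<le> (en f f - \<nu> * (\<integral>x. (f x)\<^sup>2 \<partial>\<mu>)) * Q"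
  proof (rule quadratic_nonneg_discriminant)
    fix t :: real
    let ?w = "\<lambda>x. 1 * f x + t * h x"
    have w: "?w \<in> smooth_torus c d" by (intro smooth_torus_add smooth_torus_cmult f h)
    have "(\<integral>x. ?w x \<partial>\<mu>) = 0" using f0 h0 by simp
    with rb w have "\<nu> * (\<integral>x. (?w x)\<^sup>2 \<partial>\<mu>) \<le> en ?w ?w" unfolding rayleigh_bound_def by blast
    moreover have "(\<integral>x. (?w x)\<^sup>2 \<partial>\<mu>) = (\<integral>x. (f x)\<^sup>2 + (2 * t) * (f x * h x) + t\<^sup>2 * (h x)\<^sup>2 \<partial>\<mu>)"
      by (intro Bochner_Integration.integral_cong) (auto simp: power2_eq_square algebra_simps)
    moreover have "\<dots> = (\<integral>x. (f x)\<^sup>2 \<partial>\<mu>) + 2 * t * (\<integral>x. f x * h x \<partial>\<mu>) + t\<^sup>2 * (\<integral>x. (h x)\<^sup>2 \<partial>\<mu>)"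
      by simp
    moreover have "en ?w ?w = en f f + 2 * t * en f h + t\<^sup>2 * en h h"
      using en_lincomb2[OF f h, of 1 t] by simp
    ultimately show "en f f - \<nu> * (\<integral>x. (f x)\<^sup>2 \<partial>\<mu>) + 2 * (en f h - \<nu> * (\<integral>x. f x * h x \<partial>\<mu>)) * t + Q * t\<^sup>2 \<ge> 0"
      by (simp add: Q_def algebra_simps)
  qed
  also have "\<dots> \<le> (en f f - \<nu> * (\<integral>x. (f x)\<^sup>2 \<partial>\<mu>)) * en g g"
    using \<open>Q \<le> en g g\<close> Qf by (rule mult_left_mono)
  finally show ?thesis unfolding fh enfh .
qed

section \<open>Volume measures of smooth conformal metrics\<close>

lemma conformal_classD:
  assumes "\<rho> \<in> conformal_class c d" shows "\<rho> \<in> smooth_torus c d" "\<rho> x > 0" "\<rho> x \<ge> 0"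
  using assms by (auto simp: conformal_class_def less_imp_le)

lemma vol_eq:
  assumes \<rho>: "\<rho> \<in> conformal_class c d"
  shows "vol c d \<rho> = density V (\<lambda>x. ennreal (\<rho> x))"
proof -
  have [measurable]: "\<rho> \<in> borel_measurable borel"
    using smooth_continuous smooth_torusD(1) conformal_classD(1)[OF \<rho>] borel_measurable_continuous_onI by blast
  have "\<rho> \<in> borel_measurable (restrict_space lborel dom)"
    by (intro measurable_restrict_space1) simp
  then show ?thesis
    using d0 conformal_classD(3)[OF \<rho>] by (simp add: vol_def flat_metric_def density_density_eq flip: ennreal_mult)
qed

lemma integral_vol:
  fixes f :: "plane \<Rightarrow> real"
  assumes \<rho>: "\<rho> \<in> conformal_class c d" and f: "torfun f"
  shows "(\<integral>x. f x \<partial>vol c d \<rho>) = (\<integral>x. f x * \<rho> x \<partial>V)"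
  unfolding vol_eq[OF \<rho>] using torfun_measurable[OF radon_V] conformal_classD[OF \<rho>] torfun_smooth f
  by (subst integral_density) (auto simp: mult.commute)

lemma radon_vol:
  assumes \<rho>: "\<rho> \<in> conformal_class c d" shows "radon_measure c d (vol c d \<rho>)"
proof -
  have t: "torfun \<rho>" using conformal_classD(1)[OF \<rho>] by (rule torfun_smooth)
  have m: "\<rho> \<in> borel_measurable V" using torfun_measurable[OF radon_V t] .
  have "emeasure (vol c d \<rho>) (space (vol c d \<rho>)) = (\<integral>\<^sup>+x. ennreal (\<rho> x) \<partial>V)"
    unfolding vol_eq[OF \<rho>] using m by (auto simp: emeasure_density intro!: nn_integral_cong)
  also have "\<dots> = (\<integral>\<^sup>+x. ennreal (norm (\<rho> x)) \<partial>V)" using conformal_classD(3)[OF \<rho>] by simp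
  also have "\<dots> < \<infinity>" using torfun_integrable[OF t] by (simp add: integrable_iff_bounded)
  finally have "finite_measure (vol c d \<rho>)" by (intro finite_measureI) simp
  then show ?thesis by (auto simp: radon_measure_def vol_def sets_restrict_space)
qed

lemma area_eq:
  assumes \<rho>: "\<rho> \<in> conformal_class c d"
  shows "area c d \<rho> = measure (vol c d \<rho>) (space (vol c d \<rho>))" "area c d \<rho> = (\<integral>x. \<rho> x \<partial>V)" "area c d \<rho> > 0"
proof -
  interpret finite_measure "vol c d \<rho>" using radon_vol[OF \<rho>] by (simp add: radon_measure_def)
  show a: "area c d \<rho> = measure (vol c d \<rho>) (space (vol c d \<rho>))"
    by (simp add: area_def space_radon[OF radon_vol[OF \<rho>]])
  have "measure (vol c d \<rho>) (space (vol c d \<rho>)) = (\<integral>x. 1 \<partial>vol c d \<rho>)" by simp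
  also have "\<dots> = (\<integral>x. \<rho> x \<partial>V)" using integral_vol[OF \<rho> torfun_const, of 1] by simp
  finally show b: "area c d \<rho> = (\<integral>x. \<rho> x \<partial>V)" using a by simp
  have t: "torfun \<rho>" using conformal_classD(1)[OF \<rho>] by (rule torfun_smooth)
  have "(\<integral>x. \<rho> x \<partial>V) \<noteq> 0"
  proof
    assume "(\<integral>x. \<rho> x \<partial>V) = 0"
    then have "\<rho> 0 = 0"
      using t conformal_classD(3)[OF \<rho>] integral_V_eq_0[of \<rho>] unfolding torfun_def by blast
    then show False using conformal_classD(2)[OF \<rho>, of 0] by simp
  qed
  moreover have "(\<integral>x. \<rho> x \<partial>V) \<ge> 0" using conformal_classD(3)[OF \<rho>] by (intro integral_nonneg_AE) simp
  ultimately show "area c d \<rho> > 0" unfolding b by linarith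
qed

end

section \<open>The first eigenvalue of a conformal metric\<close>

text \<open>Dominated convergence for series, by exchanging two limits under uniform convergence. It
  passes to the limit in the convolution with the coefficients of the conformal factor.\<close>

lemma has_sum_dominated_tendsto:
  fixes a :: "'i \<Rightarrow> complex"
  assumes a: "(\<lambda>j. norm (a j)) summable_on UNIV" and b: "\<And>n j. norm (b n j) \<le> C"
    and lim: "\<And>j. (\<lambda>n. b n j) \<longlonglongrightarrow> b' j" and S: "\<And>n :: nat. ((\<lambda>j. a j * b n j) has_sum S n) UNIV"
  shows "S \<longlonglongrightarrow> (\<Sum>\<^sub>\<infinity>j. a j * b' j)" "((\<lambda>j. a j * b' j) has_sum (\<Sum>\<^sub>\<infinity>j. a j * b' j)) UNIV"
proof -
  have C: "(\<lambda>j. norm (a j) * C) summable_on UNIV" using a by (intro summable_on_cmult_left)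
  have b': "norm (b' j) \<le> C" for j
    by (rule Lim_bounded[OF tendsto_norm[OF lim[of j]]]) (use b in auto)
  have "(\<lambda>j. norm (a j * b' j)) summable_on UNIV"
    by (rule summable_on_comparison_test[OF C]) (auto simp: norm_mult intro!: mult_left_mono b')
  then show s: "((\<lambda>j. a j * b' j) has_sum (\<Sum>\<^sub>\<infinity>j. a j * b' j)) UNIV"
    by (rule has_sum_infsum[OF abs_summable_summable])
  show "S \<longlonglongrightarrow> (\<Sum>\<^sub>\<infinity>j. a j * b' j)"
  proof (rule swap_uniform_limit')
    show "\<forall>\<^sub>F X in finite_subsets_at_top UNIV. (\<lambda>n. \<Sum>j\<in>X. a j * b n j) \<longlonglongrightarrow> (\<Sum>j\<in>X. a j * b' j)"
      by (intro always_eventually allI tendsto_intros lim)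
    show "((\<lambda>X. \<Sum>j\<in>X. a j * b' j) \<longlongrightarrow> (\<Sum>\<^sub>\<infinity>j. a j * b' j)) (finite_subsets_at_top UNIV)"
      using s by (simp add: has_sum_def)
    show "uniform_limit UNIV (\<lambda>X n. \<Sum>j\<in>X. a j * b n j) S (finite_subsets_at_top UNIV)"
      by (rule Weierstrass_m_test_general'[OF _ S C]) (auto simp: norm_mult intro!: mult_left_mono b)
  qed auto
qed

lemma finite_support_in_span:
  fixes f :: "'k \<Rightarrow> real"
  assumes "finite K" "\<And>k. k \<notin> K \<Longrightarrow> f k = 0"
  shows "f \<in> span ((\<lambda>k j. if j = k then 1 else 0) ` K)"
  using assms
proof (induction K arbitrary: f rule: finite_induct)
  case empty
  then have "f = 0" by (auto simp: fun_eq_iff)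
  then show ?case by (metis span_zero)
next
  case (insert k K)
  let ?e = "\<lambda>k j. if j = k then 1 else (0::real)"
  have "f(k := 0) \<in> span (?e ` K)" by (rule insert.IH) (use insert.prems in auto)
  then have "f(k := 0) \<in> span (?e ` insert k K)"
    using span_mono[of "?e ` K" "?e ` insert k K"] by blast
  moreover have "?e k \<in> span (?e ` insert k K)" by (intro span_base) simp
  ultimately have "f(k := 0) + f k *\<^sub>R ?e k \<in> span (?e ` insert k K)"
    by (intro span_add span_scale)
  moreover have "f(k := 0) + f k *\<^sub>R ?e k = f"
    by (auto simp: fun_eq_iff scaleR_fun_def)
  ultimately show ?case by simp
qed

text \<open>Since \<open>dim\<close> is 0 on infinite-dimensional spaces, a nonzero element alone
  does not make it positive; finitely many functionals that separate the elements of E bound the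
  size of a basis.\<close>

lemma dim_pos_of_injective_functionals:
  fixes E :: "(plane \<Rightarrow> real) set" and L :: "(plane \<Rightarrow> real) \<Rightarrow> 'k \<Rightarrow> real"
  assumes E: "subspace E" and K: "finite K" and supp: "\<And>f k. k \<notin> K \<Longrightarrow> L f k = 0"
    and add: "\<And>f g. f \<in> E \<Longrightarrow> g \<in> E \<Longrightarrow> L (f + g) = L f + L g"
    and scale: "\<And>f r. f \<in> E \<Longrightarrow> L (r *\<^sub>R f) = r *\<^sub>R L f"
    and inj: "\<And>f. f \<in> E \<Longrightarrow> L f = 0 \<Longrightarrow> f = 0"
    and u: "u \<in> E" "u \<noteq> 0"
  shows "1 \<le> dim E"
proof -
  obtain B where B: "B \<subseteq> E" "independent B" "E \<subseteq> span B" "card B = dim E"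
    using basis_exists[of E] by blast
  have spB: "span B = E" using B E by (simp add: span_subspace)
  \<comment> \<open>L is linear only on E, so it is replaced by a linear map on the whole space that
    agrees with it there.\<close>
  obtain G where G: "linear G" "\<And>f. f \<in> B \<Longrightarrow> G f = L f"
    using linear_independent_extend[OF B(2), of L] by blast
  have GL: "G f = L f" if "f \<in> E" for f
  proof -
    from that have "f \<in> span B" using spB by simp
    then have "f \<in> E \<and> G f = L f"
    proof (induction rule: span_induct_alt)
      case base
      have "L (0 *\<^sub>R u) = 0" unfolding scale[OF u(1)] by simp
      then show ?case using linear_0[OF G(1)] subspace_0[OF E] by (simp add: zero_fun_def)
    next
      case (step r f g)
      have fg: "f \<in> E" "g \<in> E" using step B(1) by auto
      then have rf: "r *\<^sub>R f \<in> E" using E by (simp add: subspace_scale)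
      then have "L (r *\<^sub>R f + g) = r *\<^sub>R L f + L g" using add[OF _ fg(2)] scale[OF fg(1)] by simp
      moreover have "G (r *\<^sub>R f + g) = r *\<^sub>R G f + G g" by (simp only: linear_add[OF G(1)] linear_scale[OF G(1)])
      moreover have "G f = L f" "G g = L g" using step G(2) by auto
      ultimately show ?case using subspace_add[OF E rf fg(2)] by metis
    qed
    then show ?thesis ..
  qed
  have injG: "inj_on G (span B)"
    unfolding spB
  proof (rule inj_onI)
    fix f g assume fg: "f \<in> E" "g \<in> E" "G f = G g"
    then have fgE: "f - g \<in> E" using E by (simp add: subspace_diff)
    have "L (f - g) = 0" using fg GL[OF fgE] by (simp add: linear_diff[OF G(1)])
    then show "f = g" using inj[OF fgE] by simp
  qed
  have "independent (G ` B)"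
    by (rule linear_independent_injective_image[OF G(1) B(2) injG])
  moreover have "G ` B \<subseteq> span ((\<lambda>k j. if j = k then 1 else 0) ` K)"
    using finite_support_in_span[OF K] supp GL B(1) by (auto simp: subset_iff)
  ultimately have "finite (G ` B)" using independent_span_bound[OF finite_imageI[OF K]] by blast
  moreover have "inj_on G B" using injG by (rule inj_on_subset) (rule span_superset)
  ultimately have "finite B" using finite_imageD by blast
  moreover have "B \<noteq> {}" using u spB by auto
  ultimately show ?thesis using B(4) by (metis One_nat_def Suc_leI card_gt_0_iff)
qed

context rhombic_torus
begin

section \<open>The infimum of the Rayleigh quotient of a smooth metric\<close>

definition unit_mean_zero :: "(plane \<Rightarrow> real) \<Rightarrow> (plane \<Rightarrow> real) \<Rightarrow> bool" where
  "unit_mean_zero \<rho> f \<longleftrightarrow> f \<in> smooth_torus c d \<and> (\<integral>x. f x * \<rho> x \<partial>V) = 0 \<and> (\<integral>x. (f x)\<^sup>2 * \<rho> x \<partial>V) = 1"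

definition nu :: "(plane \<Rightarrow> real) \<Rightarrow> real" where
  "nu \<rho> = Inf {en f f | f. unit_mean_zero \<rho> f}"

context
  fixes \<rho> assumes \<rho>: "\<rho> \<in> conformal_class c d"
begin

lemma t\<rho>: "torfun \<rho>" and s\<rho>: "\<rho> \<in> smooth_torus c d" and \<rho>_pos: "\<rho> x > 0" and \<rho>_nonneg: "\<rho> x \<ge> 0"
  using conformal_classD[OF \<rho>] torfun_smooth by auto

lemma nu_lower_bdd: "bdd_below {en f f | f. unit_mean_zero \<rho> f}"
  by (rule bdd_belowI[of _ 0]) (auto simp: en_nonneg)

lemma unit_mean_zero_rescale:
  assumes f: "f \<in> smooth_torus c d" and f0: "(\<integral>x. f x * \<rho> x \<partial>V) = 0" and N: "(\<integral>x. (f x)\<^sup>2 * \<rho> x \<partial>V) > 0"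
  shows "unit_mean_zero \<rho> (\<lambda>x. 1 / sqrt (\<integral>x. (f x)\<^sup>2 * \<rho> x \<partial>V) * f x)"
proof -
  define r where "r = 1 / sqrt (\<integral>x. (f x)\<^sup>2 * \<rho> x \<partial>V)"
  have r2: "r\<^sup>2 * (\<integral>x. (f x)\<^sup>2 * \<rho> x \<partial>V) = 1" using N by (simp add: r_def power_divide)
  show ?thesis
    unfolding unit_mean_zero_def r_def[symmetric]
    using f f0 r2 by (simp add: smooth_torus_cmult power_mult_distrib mult.assoc)
qed

lemma nu_le: "f \<in> smooth_torus c d \<Longrightarrow> (\<integral>x. f x * \<rho> x \<partial>V) = 0 \<Longrightarrow> nu \<rho> * (\<integral>x. (f x)\<^sup>2 * \<rho> x \<partial>V) \<le> en f f"
proof -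
  assume f: "f \<in> smooth_torus c d" "(\<integral>x. f x * \<rho> x \<partial>V) = 0"
  define N where "N = (\<integral>x. (f x)\<^sup>2 * \<rho> x \<partial>V)"
  have "N \<ge> 0" unfolding N_def using \<rho>_nonneg by (intro integral_nonneg_AE) simp
  show "nu \<rho> * (\<integral>x. (f x)\<^sup>2 * \<rho> x \<partial>V) \<le> en f f"
  proof (cases "N = 0")
    case True
    then show ?thesis using en_nonneg by (simp add: N_def)
  next
    case False
    with \<open>N \<ge> 0\<close> have N: "N > 0" by simp
    define r where "r = 1 / sqrt N"
    have r2: "r\<^sup>2 = 1 / N" using N by (simp add: r_def power_divide)
    have "unit_mean_zero \<rho> (\<lambda>x. r * f x)"
      using unit_mean_zero_rescale[OF f] N by (simp only: r_def N_def)
    then have "nu \<rho> \<le> en (\<lambda>x. r * f x) (\<lambda>x. r * f x)"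
      unfolding nu_def by (intro cInf_lower nu_lower_bdd) auto
    also have "\<dots> = en f f / N" using en_cmult[OF f(1)] by (simp add: r2)
    finally show ?thesis using N by (simp add: N_def[symmetric] pos_le_divide_eq)
  qed
qed

lemma unit_mean_zero_exists: "\<exists>f. unit_mean_zero \<rho> f"
proof -
  define A where "A = (\<integral>x. \<rho> x \<partial>V)"
  have A: "A > 0" using area_eq[OF \<rho>] by (simp add: A_def)
  define g where "g x = cos (ph (1,0) x)" for x
  define m where "m = (\<integral>x. g x * \<rho> x \<partial>V) / A"
  define f where "f x = g x + (- m)" for x
  have g: "g \<in> smooth_torus c d" unfolding g_def by (rule smooth_torus_trig)
  have f: "f \<in> smooth_torus c d" unfolding f_def by (intro smooth_torus_add g smooth_torus_const)
  have int: "integrable V (\<lambda>x. g x * \<rho> x)" "integrable V \<rho>"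
    by (intro torfun_integrable torfun_mult torfun_smooth g t\<rho>)+
  have "(\<integral>x. f x * \<rho> x \<partial>V) = (\<integral>x. g x * \<rho> x - m * \<rho> x \<partial>V)"
    by (simp add: f_def algebra_simps)
  also have "\<dots> = 0" using int A by (simp add: m_def A_def)
  finally have f0: "(\<integral>x. f x * \<rho> x \<partial>V) = 0" .
  define N where "N = (\<integral>x. (f x)\<^sup>2 * \<rho> x \<partial>V)"
  have "N \<ge> 0" unfolding N_def using \<rho>_nonneg by (intro integral_nonneg_AE) simp
  have "N \<noteq> 0"
  proof
    assume "N = 0"
    have t: "torfun (\<lambda>x. (f x)\<^sup>2 * \<rho> x)" unfolding power2_eq_square by (intro torfun_mult torfun_smooth f t\<rho>)
    have "(f x)\<^sup>2 * \<rho> x = 0" for x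
      using integral_V_eq_0[of "\<lambda>x. (f x)\<^sup>2 * \<rho> x" x] t \<open>N = 0\<close> \<rho>_nonneg by (simp add: torfun_def N_def)
    then have "f x = 0" for x using \<rho>_pos[of x] by (metis less_irrefl mult_eq_0_iff power_eq_0_iff)
    \<comment> \<open>The cosine equals 1 and -1 at these points, so no constant shift makes f
      vanish at both.\<close>
    from this[of "lat (0,0)"] this[of "lat (1/2,0)"] show False
      by (simp add: f_def g_def ph_lat)
  qed
  with \<open>N \<ge> 0\<close> have "N > 0" by simp
  from unit_mean_zero_rescale[OF f f0 this[unfolded N_def]] show ?thesis by blast
qed

text \<open>Recentring f for V keeps its energy and, as its weighted mean is zero, can only increase
  its weighted norm; then \<open>\<rho> \<le> R\<close> and the flat Poincare inequality apply. The
  flat metric with R = 1 gets the sharp bound \<open>Lam\<close>.\<close>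

lemma nu_ge: assumes R: "\<And>x. \<rho> x \<le> R" shows "nu \<rho> \<ge> Lam / R"
  unfolding nu_def
proof (rule cInf_greatest)
  show "{en f f |f. unit_mean_zero \<rho> f} \<noteq> {}" using unit_mean_zero_exists by auto
  have Rpos: "R > 0" using R \<rho>_pos by (meson less_le_trans)
  fix e assume "e \<in> {en f f |f. unit_mean_zero \<rho> f}"
  then obtain f where e: "e = en f f" and f: "f \<in> smooth_torus c d" 
    and f0: "(\<integral>x. f x * \<rho> x \<partial>V) = 0" and f1: "(\<integral>x. (f x)\<^sup>2 * \<rho> x \<partial>V) = 1"
    by (auto simp: unit_mean_zero_def)
  define m where "m = (\<integral>x. f x \<partial>V)"
  define h where "h x = 1 * f x + (- m) * 1" for x
  have h: "h \<in> smooth_torus c d" unfolding h_def by (intro smooth_torus_add smooth_torus_cmult f smooth_torus_const)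
  have int: "integrable V (\<lambda>x. f x * \<rho> x)" "integrable V \<rho>" "integrable V f" "integrable V (\<lambda>x. (f x)\<^sup>2 * \<rho> x)" 
     "integrable V (\<lambda>x. (h x)\<^sup>2)" "integrable V (\<lambda>x. (h x)\<^sup>2 * \<rho> x)"
    unfolding power2_eq_square by (intro torfun_integrable torfun_mult torfun_smooth f h s\<rho>)+
  have h0: "(\<integral>x. h x \<partial>V) = 0"
    using int torfun_integrable[OF torfun_const, of "- m * 1 :: real"] by (simp add: h_def m_def space_V measure_V)
  have enh: "en h h = en f f"
    unfolding h_def using en_lincomb2[OF f smooth_torus_const, of 1 "-m" 1] en_const[OF f] en_const[OF smooth_torus_const] by simp
  have "(\<integral>x. (h x)\<^sup>2 * \<rho> x \<partial>V) = (\<integral>x. (f x)\<^sup>2 * \<rho> x + (- 2 * m) * (f x * \<rho> x) + m\<^sup>2 * \<rho> x \<partial>V)"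
    by (intro Bochner_Integration.integral_cong) (auto simp: h_def power2_eq_square algebra_simps)
  also have "\<dots> = 1 + m\<^sup>2 * (\<integral>x. \<rho> x \<partial>V)" using int f0 f1 by simp
  finally have "1 \<le> (\<integral>x. (h x)\<^sup>2 * \<rho> x \<partial>V)" using area_eq(2,3)[OF \<rho>] by simp
  also have "\<dots> \<le> (\<integral>x. R * (h x)\<^sup>2 \<partial>V)"
    using int R by (intro integral_mono) (auto simp: mult.commute[of R] intro: mult_left_mono)
  also have "\<dots> = R * (\<integral>x. (h x)\<^sup>2 \<partial>V)" by simp
  finally have "Lam * 1 \<le> Lam * (R * (\<integral>x. (h x)\<^sup>2 \<partial>V))" using Lam_pos by (intro mult_left_mono) auto
  also have "\<dots> = R * (Lam * (\<integral>x. (h x)\<^sup>2 \<partial>V))" by simp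
  also have "\<dots> \<le> R * en f f" using poincare[OF h h0] Rpos by (intro mult_left_mono) (auto simp: enh)
  finally show "Lam / R \<le> e" using Rpos by (simp add: e field_simps)
qed

lemma \<rho>_upper: obtains R where "R > 0" "\<And>x. \<rho> x \<le> R"
proof -
  obtain R where R: "R > 0" "\<And>x. norm (\<rho> x) \<le> R" using torfun_bounded[OF t\<rho>] by blast
  have "\<rho> x \<le> R" for x using R(2)[of x] by simp
  with R(1) that show ?thesis by blast
qed

lemma \<rho>_lower: obtains M where "M > 0" "\<And>x. 1 \<le> M * \<rho> x"
proof -
  have "(\<lambda>x. inverse (\<rho> x)) \<in> smooth_torus c d"
    using \<rho>_pos by (intro smooth_torus_inverse s\<rho>) (simp add: less_imp_neq[symmetric])
  then obtain M where M: "M > 0" "\<And>x. norm (inverse (\<rho> x)) \<le> M" using torfun_bounded torfun_smooth by blast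
  have "1 \<le> M * \<rho> x" for x using M(2)[of x] \<rho>_pos[of x] by (simp add: field_simps)
  with M(1) that show ?thesis by blast
qed

lemma nu_pos: "nu \<rho> > 0"
proof -
  obtain R where "R > 0" "\<And>x. \<rho> x \<le> R" using \<rho>_upper by blast
  with nu_ge[of R] Lam_pos show ?thesis by (meson divide_pos_pos less_le_trans)
qed

lemma rayleigh_bound_nu: "rayleigh_bound (nu \<rho>) (vol c d \<rho>)"
  unfolding rayleigh_bound_def
proof (intro ballI impI)
  fix f assume f: "f \<in> smooth_torus c d" "(\<integral>x. f x \<partial>vol c d \<rho>) = 0"
  have t: "torfun (\<lambda>x. (f x)\<^sup>2)" unfolding power2_eq_square by (intro torfun_mult torfun_smooth f)
  show "nu \<rho> * (\<integral>x. (f x)\<^sup>2 \<partial>vol c d \<rho>) \<le> en f f"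
    using nu_le[OF f(1)] f integral_vol[OF \<rho> torfun_smooth[OF f(1)]] integral_vol[OF \<rho> t] by simp
qed

text \<open>Transfers statements tested with real functions to complex coefficients.\<close>

lemma fcr_eq_cos_sin:
  assumes "torfun h"
  shows "fcr h k = of_real (\<integral>x. cos (ph k x) * h x \<partial>V) - \<i> * of_real (\<integral>x. sin (ph k x) * h x \<partial>V)"
proof -
  have t: "torfun (\<lambda>x. cos (ph k x) * h x)" "torfun (\<lambda>x. sin (ph k x) * h x)"
    by (intro torfun_mult torfun_smooth smooth_torus_trig assms)+
  have "fcr h k = (\<integral>x. complex_of_real (cos (ph k x) * h x) - \<i> * complex_of_real (sin (ph k x) * h x) \<partial>V)"
    unfolding fc_def 
    by (intro Bochner_Integration.integral_cong) (auto simp: ch_def ph_uminus complex_eq_iff)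
  also have "\<dots> = (\<integral>x. complex_of_real (cos (ph k x) * h x) \<partial>V) - (\<integral>x. \<i> * complex_of_real (sin (ph k x) * h x) \<partial>V)"
    by (intro Bochner_Integration.integral_diff torfun_integrable torfun_mult[OF torfun_const] torfun_of_real t)
  finally show ?thesis by (simp only: integral_complex_of_real integral_mult_right_zero)
qed

text \<open>Along a minimising sequence the weak eigenvalue equation holds asymptotically, by the
  Cauchy-Schwarz inequality for the form \<open>en f g - nu \<integral> f g \<rho>\<close>.\<close>

lemma minimising_coefficients:
  "\<exists>F. (\<forall>n. unit_mean_zero \<rho> (F n)) \<and> (\<forall>n. en (F n) (F n) \<le> nu \<rho> + 1) \<and>
    (\<forall>k. (\<lambda>n. of_real (q k) * fcr (F n) k - of_real (nu \<rho>) * fcr (\<lambda>x. \<rho> x * F n x) k) \<longlonglongrightarrow> 0)"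
proof -
  have "\<exists>f. unit_mean_zero \<rho> f \<and> en f f < nu \<rho> + inverse (real (Suc n))" for n
  proof -
    have "Inf {en f f | f. unit_mean_zero \<rho> f} < nu \<rho> + inverse (real (Suc n))" by (simp add: nu_def)
    from cInf_lessD[OF _ this] unit_mean_zero_exists show ?thesis by auto
  qed
  then obtain F where F: "\<And>n. unit_mean_zero \<rho> (F n)" and Fe: "\<And>n. en (F n) (F n) < nu \<rho> + inverse (real (Suc n))"
    by metis
  have Fs: "F n \<in> smooth_torus c d" for n using F by (simp add: unit_mean_zero_def)
  define B where "B g n = en (F n) g - nu \<rho> * (\<integral>x. F n x * g x * \<rho> x \<partial>V)" for g n
  have B: "B g \<longlonglongrightarrow> 0" if g: "g \<in> smooth_torus c d" for g
  proof -
    have sq: "(B g n)\<^sup>2 \<le> inverse (real (Suc n)) * en g g" for n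
    proof -
      have t2: "torfun (\<lambda>x. (F n x)\<^sup>2)" unfolding power2_eq_square by (intro torfun_mult torfun_smooth Fs)
      have "(en (F n) g - nu \<rho> * (\<integral>x. F n x * g x \<partial>vol c d \<rho>))\<^sup>2
          \<le> (en (F n) (F n) - nu \<rho> * (\<integral>x. (F n x)\<^sup>2 \<partial>vol c d \<rho>)) * en g g"
      proof (rule rayleigh_cauchy_schwarz[OF radon_vol[OF \<rho>] _ _ rayleigh_bound_nu Fs _ g])
        show "measure (vol c d \<rho>) (space (vol c d \<rho>)) \<noteq> 0" using area_eq(1,3)[OF \<rho>] by simp
        show "0 \<le> nu \<rho>" using nu_pos by simp
        show "(\<integral>x. F n x \<partial>vol c d \<rho>) = 0"
          using F[of n] integral_vol[OF \<rho> torfun_smooth[OF Fs]] by (simp add: unit_mean_zero_def)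
      qed
      then have "(B g n)\<^sup>2 \<le> (en (F n) (F n) - nu \<rho>) * en g g"
        using F[of n] integral_vol[OF \<rho> t2] integral_vol[OF \<rho> torfun_mult[OF torfun_smooth[OF Fs] torfun_smooth[OF g]]]
        by (simp add: B_def unit_mean_zero_def)
      also have "\<dots> \<le> inverse (real (Suc n)) * en g g"
        using Fe[of n] by (intro mult_right_mono en_nonneg) auto
      finally show ?thesis .
    qed
    have "(\<lambda>n. (B g n)\<^sup>2) \<longlonglongrightarrow> 0"
    proof (rule tendsto_sandwich[OF _ _ tendsto_const])
      show "(\<lambda>n. inverse (real (Suc n)) * en g g) \<longlonglongrightarrow> 0"
        using tendsto_mult_left_zero[OF LIMSEQ_inverse_real_of_nat] .
      show "\<forall>\<^sub>F n in sequentially. (B g n)\<^sup>2 \<le> inverse (real (Suc n)) * en g g"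
        using sq by (intro always_eventually allI)
    qed simp
    from tendsto_real_sqrt[OF this] have "(\<lambda>n. \<bar>B g n\<bar>) \<longlonglongrightarrow> 0" by simp
    then show ?thesis by (rule tendsto_rabs_zero_cancel)
  qed
  have eq: "of_real (q k) * fcr (F n) k - of_real (nu \<rho>) * fcr (\<lambda>x. \<rho> x * F n x) k =
      of_real (B (\<lambda>x. cos (ph k x)) n) - \<i> * of_real (B (\<lambda>x. sin (ph k x)) n)" for k n
  proof -
    have Bc: "B g n = (\<integral>x. g x * lap (F n) x \<partial>V) - nu \<rho> * (\<integral>x. g x * (\<rho> x * F n x) \<partial>V)"
      if "g \<in> smooth_torus c d" for g
      unfolding B_def green[OF Fs that] by (simp add: mult_ac)
    show ?thesis
      unfolding fcr_lap[OF Fs, symmetric] Bc[OF smooth_torus_trig(1)] Bc[OF smooth_torus_trig(2)]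
        fcr_eq_cos_sin[OF torfun_smooth[OF smooth_torus_lap[OF Fs]]]
        fcr_eq_cos_sin[OF torfun_mult[OF t\<rho> torfun_smooth[OF Fs]]]
      by (simp add: algebra_simps)
  qed
  show ?thesis
  proof (intro exI[of _ F] conjI allI)
    show "en (F n) (F n) \<le> nu \<rho> + 1" for n
    proof -
      have "inverse (real (Suc n)) \<le> 1" by (simp add: inverse_le_1_iff)
      then show ?thesis using Fe[of n] by linarith
    qed
    show "(\<lambda>n. of_real (q k) * fcr (F n) k - of_real (nu \<rho>) * fcr (\<lambda>x. \<rho> x * F n x) k) \<longlonglongrightarrow> 0" for k
    proof -
      have "(\<lambda>n. complex_of_real (B (\<lambda>x. cos (ph k x)) n) - \<i> * of_real (B (\<lambda>x. sin (ph k x)) n)) \<longlonglongrightarrow> of_real 0 - \<i> * of_real 0"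
        by (intro tendsto_intros B smooth_torus_trig)
      then show ?thesis unfolding eq by simp
    qed
  qed (rule F)
qed

text \<open>Elliptic regularity: a bounded solution of \<open>q u = nu (fcr \<rho> * u)\<close> decays rapidly, since
  convolution with \<open>fcr \<rho>\<close> preserves polynomial decay and division by \<open>q\<close> improves it.\<close>

lemma bootstrap:
  assumes bd: "\<And>k. norm (u k) \<le> C0"
    and conv: "\<And>k. ((\<lambda>j. fcr \<rho> j * u (k - j)) has_sum w k) UNIV"
    and eq: "\<And>k. of_real (q k) * u k = of_real (nu \<rho>) * w k"
  shows "rapid u"
  unfolding rapid_def
proof
  fix s
  show "\<exists>C. \<forall>k. norm (u k) * sz k ^ s \<le> C"
  proof (induction s)
    case 0
    show ?case using bd by (intro exI[of _ C0]) simp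
  next
    case (Suc s)
    then obtain C where C: "\<And>k. norm (u k) * sz k ^ s \<le> C" by blast
    define A where "A = (\<Sum>\<^sub>\<infinity>j. norm (fcr \<rho> j) * sz j ^ s)"
    have A: "((\<lambda>j. norm (fcr \<rho> j) * sz j ^ s) has_sum A) UNIV"
      unfolding A_def by (intro has_sum_infsum rapid_asum_sz rapid_fcr s\<rho>)
    have w: "norm (w k) * sz k ^ s \<le> A * C" for k
    proof -
      have "norm (w k * of_real (sz k ^ s)) \<le> A * C"
      proof (rule norm_infsum_le)
        show "((\<lambda>j. fcr \<rho> j * u (k - j) * of_real (sz k ^ s)) has_sum w k * of_real (sz k ^ s)) UNIV"
          by (intro has_sum_cmult_left conv)
        show "((\<lambda>j. norm (fcr \<rho> j) * sz j ^ s * C) has_sum A * C) UNIV"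
          by (intro has_sum_cmult_left A)
        fix j
        have "sz k ^ s \<le> (sz j * sz (k - j)) ^ s"
          using sz_add[of j "k - j"] sz_ge_1[of k] by (intro power_mono) auto
        then have "norm (u (k - j)) * sz k ^ s \<le> norm (u (k - j)) * (sz j ^ s * sz (k - j) ^ s)"
          by (intro mult_left_mono) (auto simp: power_mult_distrib)
        also have "\<dots> = sz j ^ s * (norm (u (k - j)) * sz (k - j) ^ s)" by (simp add: mult_ac)
        also have "\<dots> \<le> sz j ^ s * C" using sz_ge_1[of j] by (intro mult_left_mono C) auto
        finally have "norm (fcr \<rho> j) * (norm (u (k - j)) * sz k ^ s) \<le> norm (fcr \<rho> j) * (sz j ^ s * C)"
          by (intro mult_left_mono) auto
        then show "norm (fcr \<rho> j * u (k - j) * of_real (sz k ^ s)) \<le> norm (fcr \<rho> j) * sz j ^ s * C"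
          using sz_ge_1[of k] by (simp add: norm_mult norm_power mult_ac)
      qed
      then show ?thesis using sz_ge_1[of k] by (simp add: norm_mult norm_power)
    qed
    define K where "K = 12 / Lam * (nu \<rho> * (A * C))"

    have "norm (u k) * sz k ^ Suc s \<le> max C0 K" for k
    proof (cases "k = 0")
      \<comment> \<open>Here q vanishes and gives nothing, but \<open>sz k = 1\<close>, so the a
        priori bound suffices.\<close>
      case True
      then show ?thesis using bd[of 0] by (simp add: sz_def)
    next
      case False
      have "q k * (norm (u k) * sz k ^ s) = norm (of_real (q k) * u k) * sz k ^ s"
        using q_nonneg[of k] by (simp add: norm_mult)
      also have "\<dots> = nu \<rho> * (norm (w k) * sz k ^ s)"
        unfolding eq using nu_pos by (simp add: norm_mult)
      also have "\<dots> \<le> nu \<rho> * (A * C)" using nu_pos by (intro mult_left_mono w) auto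
      finally have 1: "q k * (norm (u k) * sz k ^ s) \<le> nu \<rho> * (A * C)" .
      \<comment> \<open>Two powers of \<open>sz\<close> are available from \<open>sz_le_q\<close>;
        one is given away so that the induction advances in single steps.\<close>
      have "norm (u k) * sz k ^ Suc s \<le> norm (u k) * sz k ^ s * (sz k * sz k)"
        using sz_ge_1[of k] mult_left_mono[of 1 "sz k" "norm (u k) * sz k ^ s * sz k"] by (simp add: mult_ac)
      also have "\<dots> \<le> norm (u k) * sz k ^ s * (12 / Lam * q k)"
        using sz_ge_1[of k] by (intro mult_left_mono sz_le_q False) auto
      also have "\<dots> = 12 / Lam * (q k * (norm (u k) * sz k ^ s))" by (simp add: mult_ac)
      also have "\<dots> \<le> K" unfolding K_def using 1 Lam_pos by (intro mult_left_mono) auto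
      finally show ?thesis by simp
    qed
    then show ?case by blast
  qed
qed

text \<open>Besides convergence and regularity two points matter: the limit coefficients inherit
  conjugate symmetry, so taking the real part of the series loses nothing, and they are not all
  zero, because a fixed share of the mass stays in finitely many frequencies.\<close>

lemma eigenfunction_exists:
  obtains U where "U \<in> smooth_torus c d" "\<And>x. lap U x = nu \<rho> * (\<rho> x * U x)" "U \<noteq> (\<lambda>x. 0)"
proof -
  obtain F where F: "\<And>n. unit_mean_zero \<rho> (F n)" and Fe: "\<And>n. en (F n) (F n) \<le> nu \<rho> + 1"
    and lim: "\<And>k. (\<lambda>n. of_real (q k) * fcr (F n) k - of_real (nu \<rho>) * fcr (\<lambda>x. \<rho> x * F n x) k) \<longlonglongrightarrow> 0"
    using minimising_coefficients by blast
  have Fs: "F n \<in> smooth_torus c d" and F1: "(\<integral>x. (F n x)\<^sup>2 * \<rho> x \<partial>V) = 1" for n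
    using F by (auto simp: unit_mean_zero_def)
  have tF2: "torfun (\<lambda>x. (F n x)\<^sup>2)" for n unfolding power2_eq_square by (intro torfun_mult torfun_smooth Fs)
  have int: "integrable V (\<lambda>x. (F n x)\<^sup>2)" "integrable V (\<lambda>x. (F n x)\<^sup>2 * \<rho> x)" for n
    by (intro torfun_integrable torfun_mult tF2 t\<rho>)+
  obtain M where M: "M > 0" "\<And>x. 1 \<le> M * \<rho> x" using \<rho>_lower by blast
  have bound: "norm (fcr (F n) k) \<le> sqrt M" for n k
  proof -
    have "(norm (fcr (F n) k))\<^sup>2 \<le> (\<integral>x. (F n x)\<^sup>2 \<partial>V)"
      using finite_sum_le_has_sum[OF parseval_L2[OF Fs], of "{k}"] by simp
    also have "\<dots> \<le> (\<integral>x. M * ((F n x)\<^sup>2 * \<rho> x) \<partial>V)"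
    proof (rule integral_mono)
      show "(F n x)\<^sup>2 \<le> M * ((F n x)\<^sup>2 * \<rho> x)" for x
        using mult_left_mono[OF M(2)[of x], of "(F n x)\<^sup>2"] by (simp add: mult_ac)
    qed (use int in auto)
    also have "\<dots> = M" by (simp add: F1)
    finally show ?thesis by (simp add: real_le_rsqrt)
  qed
  obtain r where r: "strict_mono r" and "\<And>k. k \<in> UNIV \<Longrightarrow> \<exists>l. (\<lambda>n. fcr (F (r n)) k) \<longlonglongrightarrow> l"
    using function_convergent_subsequence[of UNIV "\<lambda>n. fcr (F n)" "sqrt M"] bound by (metis countableI_type)
  then obtain u where u: "\<And>k. (\<lambda>n. fcr (F (r n)) k) \<longlonglongrightarrow> u k" by (metis UNIV_I)
  have ub: "norm (u k) \<le> sqrt M" for k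
    by (rule Lim_bounded[OF tendsto_norm[OF u]]) (use bound in auto)
  have asum\<rho>: "asum (fcr \<rho>)" by (intro rapid_asum rapid_fcr s\<rho>)
  define w where "w k = (\<Sum>\<^sub>\<infinity>j. fcr \<rho> j * u (k - j))" for k
  have wlim: "(\<lambda>n. fcr (\<lambda>x. \<rho> x * F (r n) x) k) \<longlonglongrightarrow> w k" 
    and w: "((\<lambda>j. fcr \<rho> j * u (k - j)) has_sum w k) UNIV" for k
    unfolding w_def
    using has_sum_dominated_tendsto[OF asum\<rho>, of "\<lambda>n j. fcr (F (r n)) (k - j)" "sqrt M" "\<lambda>j. u (k - j)",
        OF bound u convolution[OF s\<rho> torfun_smooth[OF Fs]]]
    by blast+
  have eq: "of_real (q k) * u k = of_real (nu \<rho>) * w k" for k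
  proof -
    have "(\<lambda>n. of_real (q k) * fcr (F (r n)) k - of_real (nu \<rho>) * fcr (\<lambda>x. \<rho> x * F (r n) x) k)
        \<longlonglongrightarrow> of_real (q k) * u k - of_real (nu \<rho>) * w k"
      by (intro tendsto_intros u wlim)
    moreover have "(\<lambda>n. of_real (q k) * fcr (F (r n)) k - of_real (nu \<rho>) * fcr (\<lambda>x. \<rho> x * F (r n) x) k) \<longlonglongrightarrow> 0"
      using LIMSEQ_subseq_LIMSEQ[OF lim r] by (simp add: o_def)
    ultimately show ?thesis using LIMSEQ_unique by fastforce
  qed
  have rap: "rapid u" by (rule bootstrap[OF ub w eq])
  have sym: "cnj (u k) = u (- k)" for k
  proof -
    have "(\<lambda>n. cnj (fcr (F (r n)) k)) \<longlonglongrightarrow> cnj (u k)" by (intro tendsto_cnj u)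
    then show ?thesis using u[of "- k"] LIMSEQ_unique unfolding fcr_cnj by blast
  qed
  define U where "U x = Re (four u x)" for x
  have U: "U \<in> smooth_torus c d" unfolding U_def by (rule smooth_torus_Re_four[OF rap])
  have fU: "fcr U k = u k" for k
    unfolding U_def by (rule Re_four_fcr[OF rapid_asum[OF rap] sym])
  have pde: "lap U x = nu \<rho> * (\<rho> x * U x)" for x
  proof -
    have tl: "torfun (lap U)" and tr: "torfun (\<lambda>x. \<rho> x * U x)"
      by (intro torfun_smooth smooth_torus_lap smooth_torus_mult U s\<rho>)+
    have "lap U x - nu \<rho> * (\<rho> x * U x) = 0"
    proof (rule fcr_unique)
      show "torfun (\<lambda>x. lap U x - nu \<rho> * (\<rho> x * U x))"
        by (intro torfun_diff torfun_mult[OF torfun_const] tl tr)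
      fix k
      have "fcr (\<lambda>x. lap U x - nu \<rho> * (\<rho> x * U x)) k = fcr (lap U) k - fc (\<lambda>x. of_real (nu \<rho>) * of_real (\<rho> x * U x)) k"
        using fc_diff[OF torfun_of_real[OF tl] torfun_mult[OF torfun_const torfun_of_real[OF tr]]]
        by (simp only: of_real_diff of_real_mult)
      also have "\<dots> = of_real (q k) * u k - of_real (nu \<rho>) * fcr (\<lambda>x. \<rho> x * U x) k"
        unfolding fc_cmult fcr_lap[OF U] fU ..
      also have "fcr (\<lambda>x. \<rho> x * U x) k = w k"
        using has_sum_unique[OF convolution[OF s\<rho> torfun_smooth[OF U]]] w[of k] by (simp add: fU)
      finally show "fcr (\<lambda>x. lap U x - nu \<rho> * (\<rho> x * U x)) k = 0" using eq[of k] by simp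
    qed
    then show ?thesis by simp
  qed
  have "U \<noteq> (\<lambda>x. 0)"
  proof
    assume "U = (\<lambda>x. 0)"
    then have u0: "u k = 0" for k using fU[of k] by (simp add: fc_def)
    obtain R where R: "R > 0" "\<And>x. \<rho> x \<le> R" using \<rho>_upper by blast
    \<comment> \<open>The squared V-norm is at least 1/R, and beyond this cutoff at most half of
      that amount can sit.\<close>
    define T where "T = 2 * R * (nu \<rho> + 1)"
    have T: "T > 0" using R nu_pos by (simp add: T_def)
    have "1 / (2 * R) \<le> (\<Sum>k | q k < T. (norm (fcr (F (r n)) k))\<^sup>2)" for n
    proof -
      let ?f = "F (r n)"
      have "1 \<le> (\<integral>x. R * (?f x)\<^sup>2 \<partial>V)"
        unfolding F1[of "r n", symmetric]
        using int R by (intro integral_mono) (auto simp: mult.commute[of R] intro: mult_left_mono)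
      then have "1 \<le> R * (\<integral>x. (?f x)\<^sup>2 \<partial>V)" by simp
      then have a: "1 / R \<le> (\<integral>x. (?f x)\<^sup>2 \<partial>V)" using R by (simp add: field_simps)
      have "en ?f ?f / T \<le> (nu \<rho> + 1) / T" using Fe T by (intro divide_right_mono) auto
      also have "\<dots> = 1 / (2 * R)" using nu_pos R by (simp add: T_def)
      finally show ?thesis using a poincare_tail[OF Fs T, of "r n"] by (simp add: field_simps)
    qed
    moreover have "(\<lambda>n. \<Sum>k | q k < T. (norm (fcr (F (r n)) k))\<^sup>2) \<longlonglongrightarrow> (\<Sum>k | q k < T. (norm (u k))\<^sup>2)"
      by (intro tendsto_intros u)
    ultimately have "1 / (2 * R) \<le> (\<Sum>k | q k < T. (norm (u k))\<^sup>2)"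
      by (intro Lim_bounded2) auto
    then show False using R by (simp add: u0)
  qed
  with U pde that show ?thesis by blast
qed

section \<open>Eigenspaces and the first eigenvalue of a smooth metric\<close>

lemma regular_points_UNIV: "regular_points \<rho> = UNIV"
  unfolding regular_points_def using smooth_on_ball smooth_torusD(1)[OF s\<rho>] \<rho>_pos
  by (auto intro!: exI[of _ "1::real"])

text \<open>Every point is regular for a smooth positive factor, so the conditions at cone points
  disappear and the equation may be multiplied by \<open>\<rho>\<close>.\<close>

lemma eigenspace_eq:
  "eigenspace c d \<rho> \<nu> = {f \<in> smooth_torus c d. \<forall>x. lap f x = \<nu> * (\<rho> x * f x)}"
proof -
  have "- laplacian d \<rho> f x = \<nu> * f x \<longleftrightarrow> lap f x = \<nu> * (\<rho> x * f x)" for f x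
    using \<rho>_pos[of x] by (simp add: laplacian_def lap_def field_simps)
  then show ?thesis
    unfolding eigenspace_def regular_points_UNIV smooth_torus_def using smooth_continuous by auto
qed

text \<open>Green's formula tested with f itself and with the constant 1.\<close>

lemma eigenfunction_energy:
  assumes f: "f \<in> smooth_torus c d" and e: "\<And>x. lap f x = \<nu> * (\<rho> x * f x)"
  shows "en f f = \<nu> * (\<integral>x. (f x)\<^sup>2 * \<rho> x \<partial>V)" "\<nu> \<noteq> 0 \<Longrightarrow> (\<integral>x. f x * \<rho> x \<partial>V) = 0"
proof -
  have "en f f = (\<integral>x. \<nu> * ((f x)\<^sup>2 * \<rho> x) \<partial>V)"
    unfolding green[OF f f] e by (simp add: power2_eq_square mult_ac)
  then show "en f f = \<nu> * (\<integral>x. (f x)\<^sup>2 * \<rho> x \<partial>V)" by simp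
  have "en f (\<lambda>x. 1) = (\<integral>x. \<nu> * (f x * \<rho> x) \<partial>V)"
    unfolding green[OF f smooth_torus_const] e by (simp add: mult_ac)
  then show "(\<integral>x. f x * \<rho> x \<partial>V) = 0" if "\<nu> \<noteq> 0" using that en_const[OF f] by simp
qed

lemma weighted_L2_eq_0:
  assumes f: "f \<in> smooth_torus c d" and 0: "(\<integral>x. (f x)\<^sup>2 * \<rho> x \<partial>V) \<le> 0"
  shows "f = (\<lambda>x. 0)"
proof
  fix x
  have "torfun (\<lambda>x. (f x)\<^sup>2 * \<rho> x)" unfolding power2_eq_square by (intro torfun_mult torfun_smooth f s\<rho>)
  moreover have "(\<integral>x. (f x)\<^sup>2 * \<rho> x \<partial>V) \<ge> 0" using \<rho>_nonneg by (intro integral_nonneg_AE) simp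
  moreover from this have "(\<integral>x. (f x)\<^sup>2 * \<rho> x \<partial>V) = 0" using 0 by (rule antisym[rotated])
  ultimately have "(f x)\<^sup>2 * \<rho> x = 0"
    using \<rho>_nonneg unfolding torfun_def
    by (intro integral_V_eq_0[of "\<lambda>x. (f x)\<^sup>2 * \<rho> x" x]) simp_all
  then show "f x = 0" using \<rho>_pos[of x] by simp
qed

text \<open>For \<nu> > 0 an eigenfunction has weighted mean zero, so a nonzero one would have a
  Rayleigh quotient \<nu> below the infimum.\<close>

lemma eigenspace_trivial:
  assumes "0 < \<nu>" "\<nu> < nu \<rho>" shows "eigenspace c d \<rho> \<nu> = {0}"
proof -
  have "f = 0" if f: "f \<in> smooth_torus c d" "\<And>x. lap f x = \<nu> * (\<rho> x * f x)" for f
  proof -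
    let ?N = "\<integral>x. (f x)\<^sup>2 * \<rho> x \<partial>V"
    have "nu \<rho> * ?N \<le> \<nu> * ?N"
      using nu_le[OF f(1) eigenfunction_energy(2)[OF f]] eigenfunction_energy(1)[OF f] assms by simp
    then have "(nu \<rho> - \<nu>) * ?N \<le> 0" by (simp add: algebra_simps)
    then have "?N \<le> 0" using assms by (simp add: mult_le_0_iff)
    from weighted_L2_eq_0[OF f(1) this] show ?thesis by (simp add: zero_fun_def)
  qed
  moreover have "(0 :: plane \<Rightarrow> real) \<in> smooth_torus c d" "lap 0 x = \<nu> * (\<rho> x * 0)" for x
    using smooth_torus_const[of 0] by (simp_all add: zero_fun_def lap_def eucl_laplacian_eq dird_const)
  ultimately show ?thesis unfolding eigenspace_eq by auto
qed

lemma subspace_eigenspace: "subspace (eigenspace c d \<rho> \<nu>)"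
proof -
  have lapadd: "lap (\<lambda>x. f x + g x) x = lap f x + lap g x" if "f \<in> smooth_torus c d" "g \<in> smooth_torus c d" for f g x
    using that smooth_dird smooth_torusD(1) dird_mult_add(2)
    by (simp add: lap_def eucl_laplacian_eq algebra_simps)
  have lapcmult: "lap (\<lambda>x. r * f x) x = r * lap f x" if "f \<in> smooth_torus c d" for f r x
    using that smooth_dird smooth_torusD(1) dird_cmult by (simp add: lap_def eucl_laplacian_eq algebra_simps)
  have "(0 :: plane \<Rightarrow> real) \<in> smooth_torus c d" "lap 0 x = \<nu> * (\<rho> x * 0)" for x
    using smooth_torus_const[of 0] by (simp_all add: zero_fun_def lap_def eucl_laplacian_eq dird_const)
  then show ?thesis
    unfolding subspace_def eigenspace_eq
    using lapadd lapcmult smooth_torus_add smooth_torus_cmult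
    by (auto simp: plus_fun_def scaleR_fun_def algebra_simps)
qed

text \<open>The coefficients with q < T determine an eigenfunction: if they vanish,
  \<open>T \<integral> f^2 \<le> en f f \<le> nu R \<integral> f^2\<close>, while T exceeds nu R.
  Their real and imaginary parts are the finitely many separating functionals.\<close>

lemma dim_eigenspace: "1 \<le> dim (eigenspace c d \<rho> (nu \<rho>))"
proof -
  obtain R where R: "R > 0" "\<And>x. \<rho> x \<le> R" using \<rho>_upper by blast
  obtain U where U: "U \<in> smooth_torus c d" "\<And>x. lap U x = nu \<rho> * (\<rho> x * U x)" "U \<noteq> (\<lambda>x. 0)"
    using eigenfunction_exists by blast
  define T where "T = nu \<rho> * R + 1"
  have T: "T > 0" using nu_pos R by (simp add: T_def add_pos_pos)
  define L where "L f = (\<lambda>(k, b). if q k < T then (if b then Re (fcr f k) else Im (fcr f k)) else 0)" for f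
  let ?E = "eigenspace c d \<rho> (nu \<rho>)"
  have E: "f \<in> smooth_torus c d" if "f \<in> ?E" for f using that by (simp add: eigenspace_eq)
  show ?thesis
  proof (rule dim_pos_of_injective_functionals[OF subspace_eigenspace, where K = "{k. q k < T} \<times> UNIV" and L = L and u = U])
    show "L f kb = 0" if "kb \<notin> {k. q k < T} \<times> UNIV" for f kb
      using that by (cases kb) (auto simp: L_def)
    show "L (f + g) = L f + L g" if "f \<in> ?E" "g \<in> ?E" for f g
    proof -
      have "fcr (f + g) k = fcr f k + fcr g k" for k
        using fc_add[OF torfun_of_real torfun_of_real, OF torfun_smooth torfun_smooth, OF E E] that by simp
      then show ?thesis by (auto simp: L_def fun_eq_iff)
    qed
    show "L (r *\<^sub>R f) = r *\<^sub>R L f" if "f \<in> ?E" for f r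
    proof -
      have "fcr (r *\<^sub>R f) k = of_real r * fcr f k" for k
        by (simp add: scaleR_fun_def fc_cmult)
      then show ?thesis by (auto simp: L_def fun_eq_iff scaleR_fun_def)
    qed
    show "f = 0" if f: "f \<in> ?E" "L f = 0" for f
    proof -
      have "fcr f k = 0" if "q k < T" for k
        using fun_cong[OF f(2), of "(k, True)"] fun_cong[OF f(2), of "(k, False)"] that
        by (auto simp: L_def complex_eq_iff)
      then have *: "T * (\<integral>x. (f x)\<^sup>2 \<partial>V) \<le> en f f"
        using poincare_tail[OF E[OF f(1)] T] T by (simp add: field_simps)
      have t2: "torfun (\<lambda>x. (f x)\<^sup>2)" unfolding power2_eq_square by (intro torfun_mult torfun_smooth E f)
      have le: "(\<integral>x. (f x)\<^sup>2 * \<rho> x \<partial>V) \<le> R * (\<integral>x. (f x)\<^sup>2 \<partial>V)"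
      proof -
        have "(\<integral>x. (f x)\<^sup>2 * \<rho> x \<partial>V) \<le> (\<integral>x. R * (f x)\<^sup>2 \<partial>V)"
          using torfun_integrable[OF t2] torfun_integrable[OF torfun_mult[OF t2 t\<rho>]] R
          by (intro integral_mono) (auto simp: mult.commute[of R] intro: mult_left_mono)
        then show ?thesis by simp
      qed
      have "en f f = nu \<rho> * (\<integral>x. (f x)\<^sup>2 * \<rho> x \<partial>V)"
        using eigenfunction_energy(1)[of f "nu \<rho>"] f(1) by (simp add: eigenspace_eq)
      also have "\<dots> \<le> nu \<rho> * (R * (\<integral>x. (f x)\<^sup>2 \<partial>V))" using nu_pos le by (intro mult_left_mono) auto
      finally have "(\<integral>x. (f x)\<^sup>2 \<partial>V) \<le> 0" using * by (simp add: T_def algebra_simps)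
      then have "R * (\<integral>x. (f x)\<^sup>2 \<partial>V) \<le> 0" using R by (simp add: mult_le_0_iff)
      with le have "(\<integral>x. (f x)\<^sup>2 * \<rho> x \<partial>V) \<le> 0" by linarith
      from weighted_L2_eq_0[OF E[OF f(1)] this] show ?thesis by (simp add: zero_fun_def)
    qed
    show "U \<in> ?E" "U \<noteq> 0" using U by (auto simp: eigenspace_eq zero_fun_def)
  qed (simp add: finite_q_less)
qed

text \<open>The union over (0, l] contains at most 0 for l < nu and is exactly the eigenspace of nu
  for l = nu, so the infimum is a minimum.\<close>

lemma laplace_eigenvalue_eq: "laplace_eigenvalue 1 c d \<rho> = nu \<rho>"
proof -
  have z: "0 \<in> eigenspace c d \<rho> \<nu>" for \<nu> using subspace_eigenspace by (rule subspace_0)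
  have low: "(\<Union>\<nu>\<in>{0<..l}. eigenspace c d \<rho> \<nu>) \<subseteq> {0}" if "l < nu \<rho>" for l
    using that eigenspace_trivial by fastforce
  have "dim (\<Union>\<nu>\<in>{0<..l}. eigenspace c d \<rho> \<nu>) = 0" if "l < nu \<rho>" for l
  proof -
    have "(\<Union>\<nu>\<in>{0<..l}. eigenspace c d \<rho> \<nu>) = {} \<or> (\<Union>\<nu>\<in>{0<..l}. eigenspace c d \<rho> \<nu>) = {0}"
      using low[OF that] by blast
    then have "span (\<Union>\<nu>\<in>{0<..l}. eigenspace c d \<rho> \<nu>) = span {}" by auto
    then show ?thesis
      using real_vector.dim_span real_vector.dim_eq_card_independent[OF independent_empty] by (metis card.empty)
  qed
  then have lower: "nu \<rho> \<le> l" if "1 \<le> dim (\<Union>\<nu>\<in>{0<..l}. eigenspace c d \<rho> \<nu>)" for l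
    using that by (metis not_le not_one_le_zero)
  have "(\<Union>\<nu>\<in>{0<..nu \<rho>}. eigenspace c d \<rho> \<nu>) = eigenspace c d \<rho> (nu \<rho>)"
  proof
    show "(\<Union>\<nu>\<in>{0<..nu \<rho>}. eigenspace c d \<rho> \<nu>) \<subseteq> eigenspace c d \<rho> (nu \<rho>)"
    proof
      fix f assume "f \<in> (\<Union>\<nu>\<in>{0<..nu \<rho>}. eigenspace c d \<rho> \<nu>)"
      then obtain \<nu> where n: "0 < \<nu>" "\<nu> \<le> nu \<rho>" "f \<in> eigenspace c d \<rho> \<nu>" by auto
      show "f \<in> eigenspace c d \<rho> (nu \<rho>)"
        using n eigenspace_trivial[of \<nu>] z by (cases "\<nu> = nu \<rho>") auto
    qed
    show "eigenspace c d \<rho> (nu \<rho>) \<subseteq> (\<Union>\<nu>\<in>{0<..nu \<rho>}. eigenspace c d \<rho> \<nu>)" using nu_pos by auto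
  qed
  then have "1 \<le> dim (\<Union>\<nu>\<in>{0<..nu \<rho>}. eigenspace c d \<rho> \<nu>)" using dim_eigenspace by simp
  then show ?thesis
    unfolding laplace_eigenvalue_def using lower
    by (intro cInf_eq_minimum) auto
qed

end

end

lemma norm_scaleR_add_square:
  "(norm (s *\<^sub>R u + t *\<^sub>R v))\<^sup>2 = s\<^sup>2 * (norm u)\<^sup>2 + 2 * s * t * (u \<bullet> v) + t\<^sup>2 * (norm v)\<^sup>2"
  for u v :: "'a::real_inner"
  unfolding power2_norm_eq_inner by (simp add: inner_simps inner_commute power2_eq_square algebra_simps)

context rhombic_torus
begin

section \<open>Conformal images of the Clifford torus\<close>

text \<open>Real functions of frequency k with complex amplitude z; up to the phase factor,
  differentiation multiplies the amplitude by -i.\<close>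

definition cc :: "freq \<Rightarrow> complex \<Rightarrow> plane \<Rightarrow> real" where "cc k z x = ch k x \<bullet> z"

lemma cc_eq: "cc k z x = cos (ph k x) * Re z + sin (ph k x) * Im z"
  by (simp add: cc_def ch_def inner_complex_def)

lemma smooth_torus_cc: "cc k z \<in> smooth_torus c d"
  unfolding cc_eq[abs_def] by (intro smooth_torus_add smooth_torus_mult smooth_torus_trig smooth_torus_const)

lemma has_derivative_cc: "(cc k z has_derivative (\<lambda>v. ph k v * cc k (- \<i> * z) x)) (at x)"
proof -
  have "((\<lambda>x. ch k x \<bullet> z) has_derivative (\<lambda>v. (of_real (ph k v) * (\<i> * ch k x)) \<bullet> z)) (at x)"
    by (rule has_derivative_inner_left[OF has_derivative_ch])
  moreover have "(of_real r * (\<i> * u)) \<bullet> z = r * (u \<bullet> (- \<i> * z))" for r :: real and u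
    by (simp add: inner_complex_def algebra_simps)
  ultimately show ?thesis by (simp add: cc_def[abs_def])
qed

lemma cc_i_i: "cc k (- \<i> * (- \<i> * z)) x = - cc k z x"
  by (simp add: cc_eq)

lemma cc_pythagoras: "(cc k z x)\<^sup>2 + (cc k (- \<i> * z) x)\<^sup>2 = (norm z)\<^sup>2"
proof -
  have *: "(C * a + S * b)\<^sup>2 + (C * b - S * a)\<^sup>2 = (C\<^sup>2 + S\<^sup>2) * (a\<^sup>2 + b\<^sup>2)" for C S a b :: real
    by (simp add: power2_eq_square algebra_simps)
  show ?thesis using *[of "cos (ph k x)" "Re z" "sin (ph k x)" "Im z"] by (simp add: cc_eq cmod_power2)
qed

definition Phi :: "plane \<Rightarrow> complex \<times> complex" where "Phi x = (1 / sqrt 2) *\<^sub>R emb x"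

lemma norm_Phi: "norm (Phi x) = 1"
  by (simp add: Phi_def emb_def norm_Pair power_divide)

lemma Phi_inner: "Phi x \<bullet> z = cc (1,0) (fst z /\<^sub>R sqrt 2) x + cc (0,1) (snd z /\<^sub>R sqrt 2) x"
  by (simp add: Phi_def emb_def cc_def inner_prod_def inverse_eq_divide add_divide_distrib)

lemma torfun_Phi: "torfun Phi"
  using continuous_on_emb torfun_ch unfolding torfun_def periodic_def Phi_def
  by (auto intro!: continuous_intros simp: emb_def)

definition dPhi :: "plane \<Rightarrow> plane \<Rightarrow> complex \<times> complex" where
  "dPhi x v = (1 / sqrt 2) *\<^sub>R (of_real (ph (1,0) v) * (\<i> * ch (1,0) x), of_real (ph (0,1) v) * (\<i> * ch (0,1) x))"

lemma has_derivative_Phi: "(Phi has_derivative dPhi x) (at x)"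
  unfolding Phi_def[abs_def] emb_def dPhi_def[abs_def]
  by (intro has_derivative_scaleR_right has_derivative_Pair has_derivative_ch)

lemma norm_dPhi: "(norm (dPhi x v))\<^sup>2 = ((ph (1,0) v)\<^sup>2 + (ph (0,1) v)\<^sup>2) / 2"
  by (simp add: dPhi_def norm_Pair norm_mult power_mult_distrib power_divide)

text \<open>Both generating frequencies have \<open>q = Lam\<close>, and each contributes
  half.\<close>

lemma energy_density_Phi: "d * ((norm (dPhi x (1,0)))\<^sup>2 + (norm (dPhi x (0,1)))\<^sup>2) = Lam"
proof -
  have "d * ((norm (dPhi x (1,0)))\<^sup>2 + (norm (dPhi x (0,1)))\<^sup>2) = (q (1,0) + q (0,1)) / 2"
    unfolding norm_dPhi q_eq by (simp add: algebra_simps add_divide_distrib)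
  then show ?thesis by (simp add: q_def)
qed

text \<open>\<open>mob a\<close> is the conformal automorphism \<open>z \<mapsto> - a + (1 - |a|\<^sup>2) (z - a) / |z - a|\<^sup>2\<close> of the unit
  sphere composed with \<open>Phi\<close>. For \<open>|a| = 1\<close> it degenerates to the constant \<open>- a\<close> (also where
  \<open>Phi x = a\<close>, since division by zero gives zero).\<close>

definition wt :: "complex \<times> complex \<Rightarrow> plane \<Rightarrow> real" where "wt a x = (norm (Phi x - a))\<^sup>2"

definition mob :: "complex \<times> complex \<Rightarrow> plane \<Rightarrow> complex \<times> complex" where
  "mob a x = - a + ((1 - (norm a)\<^sup>2) / wt a x) *\<^sub>R (Phi x - a)"

lemma wt_eq: "wt a x = 1 + (norm a)\<^sup>2 - 2 * (Phi x \<bullet> a)"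
  by (simp add: wt_def power2_norm_eq_inner inner_diff inner_commute norm_Phi[unfolded norm_eq_1] algebra_simps)

lemma wt_lower: "norm a \<le> 1 \<Longrightarrow> (1 - norm a)\<^sup>2 \<le> wt a x"
  unfolding wt_def using norm_triangle_ineq2[of "Phi x" a] by (intro power_mono) (simp_all add: norm_Phi)

lemma wt_pos: "norm a < 1 \<Longrightarrow> wt a x > 0"
  using wt_lower[of a x] by (smt (verit) zero_less_power)

lemma wt_upper: assumes "norm a \<le> 1" shows "wt a x \<le> 4"
proof -
  have "norm (Phi x - a) \<le> 2" using norm_triangle_ineq4[of "Phi x" a] assms by (simp add: norm_Phi)
  then have "(norm (Phi x - a))\<^sup>2 \<le> 2\<^sup>2" by (intro power_mono) auto
  then show ?thesis by (simp add: wt_def)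
qed

lemma norm_mob: assumes a: "norm a \<le> 1" shows "norm (mob a x) = 1"
proof (cases "wt a x = 0")
  case True
  then have "Phi x = a" by (simp add: wt_def)
  then show ?thesis using norm_Phi[of x] by (simp add: mob_def)
next
  case False
  define s where "s = (1 - (norm a)\<^sup>2) / wt a x"
  have sw: "s * wt a x = 1 - (norm a)\<^sup>2" using False by (simp add: s_def)
  have "(norm (mob a x))\<^sup>2 = (norm a)\<^sup>2 - 2 * s * (Phi x \<bullet> a - (norm a)\<^sup>2) + s * (s * wt a x)"
  proof -
    have "mob a x = (- 1) *\<^sub>R a + s *\<^sub>R (Phi x - a)" by (simp add: mob_def s_def)
    then have "(norm (mob a x))\<^sup>2 = (norm a)\<^sup>2 - 2 * s * (a \<bullet> (Phi x - a)) + s * (s * wt a x)"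
      unfolding wt_def by (simp only: norm_scaleR_add_square) (simp add: power2_eq_square)
    then show ?thesis by (simp add: inner_diff_right inner_commute power2_norm_eq_inner)
  qed
  also have "\<dots> = (norm a)\<^sup>2 + s * (1 + (norm a)\<^sup>2 - 2 * (Phi x \<bullet> a))" unfolding sw by (simp add: algebra_simps)
  also have "\<dots> = 1\<^sup>2" unfolding wt_eq[symmetric] sw by simp
  finally show ?thesis by (rule power2_eq_imp_eq) auto
qed

lemma smooth_torus_Phi_inner: "(\<lambda>x. Phi x \<bullet> z) \<in> smooth_torus c d"
  unfolding Phi_inner by (intro smooth_torus_add smooth_torus_cc)

lemma smooth_torus_wt: "wt a \<in> smooth_torus c d"
proof -
  have "(\<lambda>x. 1 + (norm a)\<^sup>2 + (- 2) * (Phi x \<bullet> a)) \<in> smooth_torus c d"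
    by (intro smooth_torus_add smooth_torus_cmult smooth_torus_const smooth_torus_Phi_inner)
  then show ?thesis by (simp add: wt_eq[abs_def])
qed

lemma smooth_torus_mob:
  assumes "norm a < 1" shows "(\<lambda>x. mob a x \<bullet> z) \<in> smooth_torus c d"
proof -
  have "(\<lambda>x. - (a \<bullet> z) + (1 - (norm a)\<^sup>2) * (inverse (wt a x) * (Phi x \<bullet> z + - (a \<bullet> z)))) \<in> smooth_torus c d"
    using wt_pos[OF assms]
    by (intro smooth_torus_add smooth_torus_cmult smooth_torus_const smooth_torus_mult smooth_torus_inverse
        smooth_torus_wt smooth_torus_Phi_inner) (metis less_irrefl)
  then show ?thesis by (simp add: mob_def[abs_def] inner_simps divide_inverse mult.assoc)
qed

lemma torfun_mob: assumes "norm a < 1" shows "torfun (mob a)"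
  using torfun_Phi torfun_smooth[OF smooth_torus_wt[of a]] wt_pos[OF assms]
  unfolding torfun_def periodic_def mob_def
  by (auto intro!: continuous_intros simp: less_imp_neq[symmetric])

definition tau :: "complex \<times> complex \<Rightarrow> plane \<Rightarrow> real" where
  "tau a x = (1 - (norm a)\<^sup>2) / wt a x"

text \<open>As \<open>wt\<close> is the squared length of \<open>Phi x - a\<close>, D is
  \<open>tau a x\<close> times \<open>dPhi\<close> followed by the reflection in the hyperplane
  orthogonal to that vector. Reflections are isometric, so \<open>tau\<close> is the conformal
  factor.\<close>

lemma has_derivative_mob:
  assumes a: "norm a < 1"
  obtains D where "(mob a has_derivative D) (at x)" "\<And>v. (norm (D v))\<^sup>2 = (tau a x)\<^sup>2 * (norm (dPhi x v))\<^sup>2"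
proof -
  let ?P = "Phi x - a" and ?w = "wt a x" and ?S = "1 - (norm a)\<^sup>2"
  define D where "D v = (?S / ?w) *\<^sub>R dPhi x v - (?S * (2 * (?P \<bullet> dPhi x v)) / ?w\<^sup>2) *\<^sub>R ?P" for v
  have wd: "(wt a has_derivative (\<lambda>v. 2 * (?P \<bullet> dPhi x v))) (at x)"
    unfolding wt_def[abs_def] power2_norm_eq_inner
    by (rule has_derivative_eq_rhs, (rule derivative_intros has_derivative_Phi)+) (simp add: inner_commute fun_eq_iff)
  have "(mob a has_derivative D) (at x)"
  proof -
    have Pd: "((\<lambda>x. Phi x - a) has_derivative dPhi x) (at x)"
      using has_derivative_diff[OF has_derivative_Phi has_derivative_const[of a]] by simp
    have "?w \<noteq> 0" using wt_pos[OF a, of x] by simp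
    from has_derivative_add[OF has_derivative_const[of "- a"] has_derivative_scaleR[OF has_derivative_divide'[OF has_derivative_const wd this] Pd]]
    show ?thesis
      unfolding mob_def[abs_def]
      by (rule has_derivative_eq_rhs) (simp add: D_def fun_eq_iff power2_eq_square)
  qed
  moreover have "(norm (D v))\<^sup>2 = (tau a x)\<^sup>2 * (norm (dPhi x v))\<^sup>2" for v
  proof -
    have w0: "?w \<noteq> 0" using wt_pos[OF a, of x] by simp
    let ?p = "?P \<bullet> dPhi x v"
    have "(norm (D v))\<^sup>2 = (?S / ?w)\<^sup>2 * (norm (dPhi x v))\<^sup>2 - 2 * (?S / ?w) * (?S * (2 * ?p) / ?w\<^sup>2) * ?p
        + (?S * (2 * ?p) / ?w\<^sup>2)\<^sup>2 * ?w"
    proof -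
      have "D v = (?S / ?w) *\<^sub>R dPhi x v + (- (?S * (2 * ?p) / ?w\<^sup>2)) *\<^sub>R ?P" by (simp add: D_def)
      then show ?thesis unfolding wt_def[of a x]
        by (simp only: norm_scaleR_add_square) (simp add: inner_commute)
    qed
    also have "2 * (?S / ?w) * (?S * (2 * ?p) / ?w\<^sup>2) * ?p = (?S * (2 * ?p) / ?w\<^sup>2)\<^sup>2 * ?w"
      using w0 by (simp add: power2_eq_square)
    finally show ?thesis by (simp add: tau_def)
  qed
  ultimately show ?thesis by (rule that)
qed

lemma sum_Basis_inner_square: "(\<Sum>b\<in>Basis. (z \<bullet> b)\<^sup>2) = (norm z)\<^sup>2" for z :: "'b::euclidean_space"
  unfolding power2_norm_eq_inner euclidean_inner[of z z] by (simp add: power2_eq_square)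

lemma energy_density_mob:
  assumes a: "norm a < 1"
  shows "(\<Sum>b\<in>Basis. gr (\<lambda>x. mob a x \<bullet> b) (\<lambda>x. mob a x \<bullet> b) x) = Lam * (tau a x)\<^sup>2"
proof -
  obtain D where D: "(mob a has_derivative D) (at x)" "\<And>v. (norm (D v))\<^sup>2 = (tau a x)\<^sup>2 * (norm (dPhi x v))\<^sup>2"
    using has_derivative_mob[OF a] by blast
  have dd: "dird v (\<lambda>x. mob a x \<bullet> b) x = D v \<bullet> b" for v b
    by (rule dird_eq[OF has_derivative_inner_left[OF D(1)]])
  have "(\<Sum>b\<in>Basis. gr (\<lambda>x. mob a x \<bullet> b) (\<lambda>x. mob a x \<bullet> b) x) =
      d * ((\<Sum>b\<in>Basis. (D (1,0) \<bullet> b)\<^sup>2) + (\<Sum>b\<in>Basis. (D (0,1) \<bullet> b)\<^sup>2))"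
    unfolding gr_def dd by (simp add: sum.distrib power2_eq_square flip: sum_distrib_left)
  also have "\<dots> = (tau a x)\<^sup>2 * (d * ((norm (dPhi x (1,0)))\<^sup>2 + (norm (dPhi x (0,1)))\<^sup>2))"
    unfolding sum_Basis_inner_square D(2) by (simp add: algebra_simps)
  finally show ?thesis unfolding energy_density_Phi by simp
qed

text \<open>The Clifford torus is minimal in the three-sphere: integrating the divergences of \<open>A' / wt\<close> and
  \<open>B' / wt\<close>, where \<open>Phi \<bullet> a = A + B\<close>, evaluates the integral up to the defect
  \<open>4 \<integral> (A - B)\<^sup>2 / wt\<^sup>2\<close>, which comes from the normal component of \<open>a\<close>.\<close>

lemma integral_tau_le:
  assumes a: "norm a < 1"
  shows "(\<integral>x. (tau a x)\<^sup>2 \<partial>V) \<le> 1 - (norm a)\<^sup>2 / 16"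
proof -
  define \<alpha> where "\<alpha> = fst a /\<^sub>R sqrt 2"
  define \<beta> where "\<beta> = snd a /\<^sub>R sqrt 2"
  define A where "A = cc (1,0) \<alpha>"
  define A' where "A' = cc (1,0) (- \<i> * \<alpha>)"
  define B where "B = cc (0,1) \<beta>"
  define B' where "B' = cc (0,1) (- \<i> * \<beta>)"
  define S where "S = (norm a)\<^sup>2"
  define w where "w = wt a"
  have w: "w x = 1 + S - 2 * A x - 2 * B x" for x
    by (simp add: w_def wt_eq Phi_inner A_def B_def \<alpha>_def \<beta>_def S_def)
  have wpos: "w x > 0" for x unfolding w_def by (rule wt_pos[OF a])
  have w4: "w x \<le> 4" for x unfolding w_def using a by (intro wt_upper) simp
  have S\<alpha>\<beta>: "(norm \<alpha>)\<^sup>2 + (norm \<beta>)\<^sup>2 = S / 2"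
    by (simp add: \<alpha>_def \<beta>_def S_def norm_prod_def power_divide power_mult_distrib inverse_eq_divide)
  have PA: "(A x)\<^sup>2 + (A' x)\<^sup>2 = (norm \<alpha>)\<^sup>2" and PB: "(B x)\<^sup>2 + (B' x)\<^sup>2 = (norm \<beta>)\<^sup>2" for x
    unfolding A_def A'_def B_def B'_def by (rule cc_pythagoras)+
  have dA: "(A has_derivative (\<lambda>v. ph (1,0) v * A' x)) (at x)"
    and dA': "(A' has_derivative (\<lambda>v. ph (1,0) v * - A x)) (at x)"
    and dB: "(B has_derivative (\<lambda>v. ph (0,1) v * B' x)) (at x)"
    and dB': "(B' has_derivative (\<lambda>v. ph (0,1) v * - B x)) (at x)" for x
    unfolding A_def A'_def B_def B'_def
    using has_derivative_cc has_derivative_cc[of _ "- \<i> * _"] by (metis cc_i_i)+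
  have dw: "(w has_derivative (\<lambda>v. - 2 * (ph (1,0) v * A' x) - 2 * (ph (0,1) v * B' x))) (at x)" for x
    unfolding w[abs_def]
    by (rule has_derivative_eq_rhs, (rule derivative_intros dA dB)+) (simp add: fun_eq_iff)
  have sm: "A \<in> smooth_torus c d" "A' \<in> smooth_torus c d" "B \<in> smooth_torus c d" "B' \<in> smooth_torus c d" "w \<in> smooth_torus c d"
    unfolding A_def A'_def B_def B'_def w_def by (intro smooth_torus_cc smooth_torus_wt)+
  have cont: "continuous_on X A" "continuous_on X A'" "continuous_on X B" "continuous_on X B'" "continuous_on X w" for X
    using sm smooth_continuous smooth_torusD(1) by blast+
  have per: "periodic c d A" "periodic c d A'" "periodic c d B" "periodic c d B'" "periodic c d w"
    using sm smooth_torusD(2) by blast+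
  define v1 where "v1 = lat (1,0)"
  define v2 where "v2 = lat (0,1)"
  have ph12: "ph (1,0) v1 = 2 * pi" "ph (0,1) v1 = 0" "ph (1,0) v2 = 0" "ph (0,1) v2 = 2 * pi"
    by (simp_all add: v1_def v2_def ph_lat)
  have wne: "w x \<noteq> 0" for x using wpos[of x] by simp
  \<comment> \<open>The derivative of A'/w along v1, a direction in which only the first phase
    moves.\<close>
  have I1: "(\<integral>x. (- A x * w x + 2 * (A' x)\<^sup>2) / (w x)\<^sup>2 \<partial>V) = 0"
  proof -
    have "(\<integral>x. (ph (1,0) v1 * - A x * w x - A' x * (- 2 * (ph (1,0) v1 * A' x) - 2 * (ph (0,1) v1 * B' x))) / (w x * w x) \<partial>V) = 0"
    proof (rule integral_derivative_zero[where g = "\<lambda>x. A' x / w x"])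
      show "periodic c d (\<lambda>x. A' x / w x)" using per unfolding periodic_def by simp
      show "((\<lambda>x. A' x / w x) has_derivative (\<lambda>v. (ph (1,0) v * - A x * w x - A' x * (- 2 * (ph (1,0) v * A' x) - 2 * (ph (0,1) v * B' x))) / (w x * w x))) (at x)" for x
        by (rule has_derivative_divide'[OF dA' dw wne])
      show "continuous_on UNIV (\<lambda>x. (ph (1,0) v * - A x * w x - A' x * (- 2 * (ph (1,0) v * A' x) - 2 * (ph (0,1) v * B' x))) / (w x * w x))" for v
        by (intro continuous_intros cont) (simp add: wne)
    qed
    moreover have "(ph (1,0) v1 * - A x * w x - A' x * (- 2 * (ph (1,0) v1 * A' x) - 2 * (ph (0,1) v1 * B' x))) / (w x * w x)
      = 2 * pi * ((- A x * w x + 2 * (A' x)\<^sup>2) / (w x)\<^sup>2)" for x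
      by (simp add: ph12 power2_eq_square algebra_simps diff_divide_distrib add_divide_distrib)
    ultimately have "2 * pi * (\<integral>x. (- A x * w x + 2 * (A' x)\<^sup>2) / (w x)\<^sup>2 \<partial>V) = 0"
      by (simp only: integral_mult_right_zero)
    then show ?thesis by (simp only: mult_eq_0_iff) simp
  qed
  have I2: "(\<integral>x. (- B x * w x + 2 * (B' x)\<^sup>2) / (w x)\<^sup>2 \<partial>V) = 0"
  proof -
    have "(\<integral>x. (ph (0,1) v2 * - B x * w x - B' x * (- 2 * (ph (1,0) v2 * A' x) - 2 * (ph (0,1) v2 * B' x))) / (w x * w x) \<partial>V) = 0"
    proof (rule integral_derivative_zero[where g = "\<lambda>x. B' x / w x"])
      show "periodic c d (\<lambda>x. B' x / w x)" using per unfolding periodic_def by simp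
      show "((\<lambda>x. B' x / w x) has_derivative (\<lambda>v. (ph (0,1) v * - B x * w x - B' x * (- 2 * (ph (1,0) v * A' x) - 2 * (ph (0,1) v * B' x))) / (w x * w x))) (at x)" for x
        by (rule has_derivative_divide'[OF dB' dw wne])
      show "continuous_on UNIV (\<lambda>x. (ph (0,1) v * - B x * w x - B' x * (- 2 * (ph (1,0) v * A' x) - 2 * (ph (0,1) v * B' x))) / (w x * w x))" for v
        by (intro continuous_intros cont) (simp add: wne)
    qed
    moreover have "(ph (0,1) v2 * - B x * w x - B' x * (- 2 * (ph (1,0) v2 * A' x) - 2 * (ph (0,1) v2 * B' x))) / (w x * w x)
      = 2 * pi * ((- B x * w x + 2 * (B' x)\<^sup>2) / (w x)\<^sup>2)" for x
      by (simp add: ph12 power2_eq_square algebra_simps diff_divide_distrib add_divide_distrib)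
    ultimately have "2 * pi * (\<integral>x. (- B x * w x + 2 * (B' x)\<^sup>2) / (w x)\<^sup>2 \<partial>V) = 0"
      by (simp only: integral_mult_right_zero)
    then show ?thesis by (simp only: mult_eq_0_iff) simp
  qed
  \<comment> \<open>The identities I3, I4 and I5, from derivatives of A A', B B' and A' B, serve to
    evaluate the integral of N^2.\<close>
  have I3: "(\<integral>x. (A' x)\<^sup>2 - (A x)\<^sup>2 \<partial>V) = 0"
  proof -
    have "(\<integral>x. A x * (ph (1,0) v1 * - A x) + ph (1,0) v1 * A' x * A' x \<partial>V) = 0"
      by (rule integral_derivative_zero[where g = "\<lambda>x. A x * A' x", OF _ has_derivative_mult[OF dA dA']])
        (use per cont in \<open>auto simp: periodic_def intro!: continuous_intros\<close>)
    moreover have "A x * (ph (1,0) v1 * - A x) + ph (1,0) v1 * A' x * A' x = 2 * pi * ((A' x)\<^sup>2 - (A x)\<^sup>2)" for x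
      by (simp add: ph12 power2_eq_square algebra_simps)
    ultimately show ?thesis by simp
  qed
  have I4: "(\<integral>x. (B' x)\<^sup>2 - (B x)\<^sup>2 \<partial>V) = 0"
  proof -
    have "(\<integral>x. B x * (ph (0,1) v2 * - B x) + ph (0,1) v2 * B' x * B' x \<partial>V) = 0"
      by (rule integral_derivative_zero[where g = "\<lambda>x. B x * B' x", OF _ has_derivative_mult[OF dB dB']])
        (use per cont in \<open>auto simp: periodic_def intro!: continuous_intros\<close>)
    moreover have "B x * (ph (0,1) v2 * - B x) + ph (0,1) v2 * B' x * B' x = 2 * pi * ((B' x)\<^sup>2 - (B x)\<^sup>2)" for x
      by (simp add: ph12 power2_eq_square algebra_simps)
    ultimately show ?thesis by simp
  qed
  have I5: "(\<integral>x. A x * B x \<partial>V) = 0"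
  proof -
    have "(\<integral>x. A' x * (ph (0,1) v1 * B' x) + ph (1,0) v1 * - A x * B x \<partial>V) = 0"
      by (rule integral_derivative_zero[where g = "\<lambda>x. A' x * B x", OF _ has_derivative_mult[OF dA' dB]])
        (use per cont in \<open>auto simp: periodic_def intro!: continuous_intros\<close>)
    moreover have "A' x * (ph (0,1) v1 * B' x) + ph (1,0) v1 * - A x * B x = (- 2 * pi) * (A x * B x)" for x
      by (simp add: ph12)
    ultimately show ?thesis by simp
  qed
  \<comment> \<open>The component of a along the unit normal (z, -w) / sqrt 2 of the Clifford torus
    at its point (z, w) / sqrt 2.\<close>
  define N where "N x = A x - B x" for x
  have contN: "continuous_on X N" for X unfolding N_def by (intro continuous_intros cont)
  note intg = V_integral(1)
  have iN: "integrable V (\<lambda>x. (N x)\<^sup>2)" "integrable V (\<lambda>x. (N x)\<^sup>2 / (w x)\<^sup>2)" "integrable V (\<lambda>x. (tau a x)\<^sup>2)"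
    "integrable V (\<lambda>x. (- A x * w x + 2 * (A' x)\<^sup>2) / (w x)\<^sup>2)" "integrable V (\<lambda>x. (- B x * w x + 2 * (B' x)\<^sup>2) / (w x)\<^sup>2)"
    unfolding tau_def w_def[symmetric] using wne by (intro intg continuous_intros cont contN; simp)+
  have iAB: "integrable V (\<lambda>x. (A' x)\<^sup>2 - (A x)\<^sup>2)" "integrable V (\<lambda>x. (B' x)\<^sup>2 - (B x)\<^sup>2)" "integrable V (\<lambda>x. A x * B x)"
    by (intro intg continuous_intros cont)+
  have mV: "measure V (space V) = 1" using measure_V by (simp add: space_V)
  have const: "integrable V (\<lambda>x. r)" for r :: real
    using intg[of "\<lambda>_. r"] by simp
  have "(N x)\<^sup>2 = S / 4 - ((A' x)\<^sup>2 - (A x)\<^sup>2) / 2 - ((B' x)\<^sup>2 - (B x)\<^sup>2) / 2 - 2 * (A x * B x)" for x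
    using PA[of x] PB[of x] S\<alpha>\<beta> by (simp add: N_def power2_diff field_simps)
  then have intN: "(\<integral>x. (N x)\<^sup>2 \<partial>V) = S / 4"
    using I3 I4 I5 iAB const by (simp add: mV)
  \<comment> \<open>Once \<open>PA\<close> and \<open>PB\<close> remove A' and B', the numerator is
    a combination of the squares of w, 1 - S and N; division by w^2 produces
    \<open>tau\<close>.\<close>
  have key: "(- A x * w x + 2 * (A' x)\<^sup>2) / (w x)\<^sup>2 + (- B x * w x + 2 * (B' x)\<^sup>2) / (w x)\<^sup>2
      = 1 / 4 - (tau a x)\<^sup>2 / 4 - (N x)\<^sup>2 / (w x)\<^sup>2" for x
  proof -
    have "(- A x * w x + 2 * (A' x)\<^sup>2) + (- B x * w x + 2 * (B' x)\<^sup>2) = (w x)\<^sup>2 / 4 - (1 - S)\<^sup>2 / 4 - (N x)\<^sup>2"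
    proof -
      have "2 * (A' x)\<^sup>2 + 2 * (B' x)\<^sup>2 = S - 2 * (A x)\<^sup>2 - 2 * (B x)\<^sup>2"
        using PA[of x] PB[of x] S\<alpha>\<beta> by linarith
      then show ?thesis by (simp add: w N_def power2_eq_square field_simps)
    qed
    then have "(- A x * w x + 2 * (A' x)\<^sup>2) / (w x)\<^sup>2 + (- B x * w x + 2 * (B' x)\<^sup>2) / (w x)\<^sup>2
      = ((w x)\<^sup>2 / 4 - (1 - S)\<^sup>2 / 4 - (N x)\<^sup>2) / (w x)\<^sup>2" by (simp only: add_divide_distrib[symmetric])
    also have "\<dots> = 1 / 4 - (tau a x)\<^sup>2 / 4 - (N x)\<^sup>2 / (w x)\<^sup>2"
      using wne[of x] unfolding tau_def w_def[symmetric] S_def[symmetric] power_divide by (simp add: diff_divide_distrib)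
    finally show ?thesis .
  qed
  have "0 = (\<integral>x. 1 / 4 - (tau a x)\<^sup>2 / 4 - (N x)\<^sup>2 / (w x)\<^sup>2 \<partial>V)"
    unfolding key[symmetric] using I1 I2 iN by simp
  also have "\<dots> = 1 / 4 - (\<integral>x. (tau a x)\<^sup>2 \<partial>V) / 4 - (\<integral>x. (N x)\<^sup>2 / (w x)\<^sup>2 \<partial>V)"
    using iN const by (simp add: mV)
  finally have eq: "(\<integral>x. (tau a x)\<^sup>2 \<partial>V) = 1 - 4 * (\<integral>x. (N x)\<^sup>2 / (w x)\<^sup>2 \<partial>V)" by simp
  \<comment> \<open>Origin of the constant 1/16: as w \<le> 4 and N^2 integrates to S/4, the defect
    4 \<integral> N^2 / w^2 is at least 4 (S/4) / 16.\<close>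
  have "(\<integral>x. (N x)\<^sup>2 / 16 \<partial>V) \<le> (\<integral>x. (N x)\<^sup>2 / (w x)\<^sup>2 \<partial>V)"
  proof (rule integral_mono)
    show "(N x)\<^sup>2 / 16 \<le> (N x)\<^sup>2 / (w x)\<^sup>2" for x
    proof -
      have "(w x)\<^sup>2 \<le> 4\<^sup>2" using wpos[of x] w4[of x] by (intro power_mono) auto
      then show ?thesis using wpos[of x] by (intro divide_left_mono) auto
    qed
  qed (use iN in auto)
  with eq intN show ?thesis by (simp add: S_def)
qed

lemma energy_mob_le:
  assumes a: "norm a < 1"
  shows "(\<Sum>b\<in>Basis. en (\<lambda>x. mob a x \<bullet> b) (\<lambda>x. mob a x \<bullet> b)) \<le> Lam * (1 - (norm a)\<^sup>2 / 16)"
proof -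
  have "(\<Sum>b\<in>Basis. en (\<lambda>x. mob a x \<bullet> b) (\<lambda>x. mob a x \<bullet> b))
      = (\<integral>x. (\<Sum>b\<in>Basis. gr (\<lambda>x. mob a x \<bullet> b) (\<lambda>x. mob a x \<bullet> b) x) \<partial>V)"
    unfolding en_def
    by (intro Bochner_Integration.integral_sum[symmetric] torfun_integrable torfun_gr smooth_torus_mob a)
  also have "\<dots> = Lam * (\<integral>x. (tau a x)\<^sup>2 \<partial>V)" unfolding energy_density_mob[OF a] by simp
  also have "\<dots> \<le> Lam * (1 - (norm a)\<^sup>2 / 16)"
    using Lam_pos integral_tau_le[OF a] by (intro mult_left_mono) auto
  finally show ?thesis .
qed

section \<open>Balancing a measure\<close>

text \<open>The reduction h of a point to the fundamental domain is periodic, hence a function of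
  the two characters, and it is the identity on \<open>dom\<close>.\<close>

lemma inj_on_Phi: "inj_on Phi dom"
proof (rule inj_onI)
  fix x y assume xy: "x \<in> dom" "y \<in> dom" "Phi x = Phi y"
  define h where "h x = lat (frac (fst (coord x)), frac (snd (coord x)))" for x
  have id: "h x = x" if "x \<in> dom" for x
  proof -
    have "coord x \<in> sq" using that dom_eq by auto
    then have "frac (fst (coord x)) = fst (coord x)" "frac (snd (coord x)) = snd (coord x)"
      by (auto simp: sq_def mem_Times_iff frac_eq)
    then show ?thesis by (simp add: h_def)
  qed
  have per: "periodic c d h"
    unfolding periodic_iff_lat h_def by (simp add: frac_def)
  have "emb x = emb y" using xy(3) by (simp add: Phi_def)
  then have "h x = h y" by (intro ch_eq_imp_torfun_eq[OF per]) (auto simp: emb_def)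
  then show "x = y" using id xy by simp
qed

text \<open>As a function of a, \<open>mob a x\<close> can be discontinuous only at
  \<open>a = Phi x\<close>; for given a this concerns at most one x, a null set. So H is continuous
  on the closed ball by dominated convergence, and on the sphere it is -a times the total mass. If H
  had no zero, its normalisation would have a Brouwer fixed point, necessarily on the sphere, where
  it is the antipodal map.\<close>

theorem balancing:
  assumes \<mu>: "radon_measure c d \<mu>" and nz: "measure \<mu> (space \<mu>) \<noteq> 0"
    and noatom: "\<And>p. p \<in> dom \<Longrightarrow> measure \<mu> {p} = 0"
  obtains a where "norm a < 1" "\<And>b. (\<integral>x. mob a x \<bullet> b \<partial>\<mu>) = 0"
proof -
  interpret finite_measure \<mu> using \<mu> by (simp add: radon_measure_def)
  define H where "H a = (\<integral>x. mob a x \<partial>\<mu>)" for a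
  have [measurable]: "Phi \<in> borel_measurable \<mu>" by (rule torfun_measurable[OF \<mu> torfun_Phi])
  have [measurable]: "mob a \<in> borel_measurable \<mu>" for a
    unfolding mob_def wt_def by measurable
  have ae: "AE x in \<mu>. Phi x \<noteq> a" for a
  proof (cases "\<exists>p\<in>dom. Phi p = a")
    case True
    then obtain p where p: "p \<in> dom" "Phi p = a" by blast
    have "{p} \<in> sets \<mu>"
      using \<mu> p by (auto simp: radon_measure_def sets_restrict_space_iff)
    moreover have "emeasure \<mu> {p} = 0" using noatom[OF p(1)] by (simp add: emeasure_eq_measure)
    moreover have "{x \<in> space \<mu>. \<not> Phi x \<noteq> a} \<subseteq> {p}"
      using p inj_on_Phi by (auto simp: space_radon[OF \<mu>] inj_on_def)
    ultimately show ?thesis by (intro AE_I[of _ _ "{p}"]) auto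
  next
    case False
    then show ?thesis by (intro AE_I2) (auto simp: space_radon[OF \<mu>])
  qed
  have cont: "continuous_on (cball 0 1) H"
    unfolding continuous_on_sequentially
  proof (intro allI ballI impI)
    fix s :: "nat \<Rightarrow> complex \<times> complex" and a
    assume a: "a \<in> cball 0 1" and s: "(\<forall>n. s n \<in> cball 0 1) \<and> s \<longlonglongrightarrow> a"
    have "(\<lambda>n. \<integral>x. mob (s n) x \<partial>\<mu>) \<longlonglongrightarrow> (\<integral>x. mob a x \<partial>\<mu>)"
    proof (rule integral_dominated_convergence[where w = "\<lambda>_. 1"])
      show "AE x in \<mu>. (\<lambda>n. mob (s n) x) \<longlonglongrightarrow> mob a x"
        using ae[of a]
      proof eventually_elim
        case (elim x)
        then have "wt a x \<noteq> 0" by (simp add: wt_def)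
        moreover have "(\<lambda>n. wt (s n) x) \<longlonglongrightarrow> wt a x"
          unfolding wt_def by (intro tendsto_intros s[THEN conjunct2])
        ultimately show ?case
          unfolding mob_def by (intro tendsto_intros s[THEN conjunct2])
      qed
      show "AE x in \<mu>. norm (mob (s n) x) \<le> 1" for n
        using s norm_mob by (intro AE_I2) (auto simp: mem_cball_0)
    qed auto
    then show "(H \<circ> s) \<longlonglongrightarrow> H a" by (simp add: H_def o_def)
  qed
  have bdry: "H a = measure \<mu> (space \<mu>) *\<^sub>R (- a)" if "norm a = 1" for a
    using that by (simp add: H_def mob_def)
  have "\<exists>a. norm a < 1 \<and> H a = 0"
  proof (rule ccontr)
    assume "\<not> ?thesis"
    then have H0: "H a \<noteq> 0" if "a \<in> cball 0 1" for a
      using that bdry[of a] nz by (cases "norm a = 1") (auto simp: mem_cball_0)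
    define g where "g a = (1 / norm (H a)) *\<^sub>R H a" for a
    have "continuous_on (cball 0 1) g"
      unfolding g_def by (intro continuous_intros cont) (use H0 in auto)
    moreover have ng: "norm (g a) = 1" if "a \<in> cball 0 1" for a
      using H0[OF that] by (simp add: g_def)
    moreover have "g \<in> cball 0 1 \<rightarrow> cball 0 1"
    proof
      show "g a \<in> cball 0 1" if "a \<in> cball 0 1" for a using ng[OF that] by simp
    qed
    ultimately obtain a where a: "a \<in> cball 0 1" "g a = a"
      using brouwer_ball[of 1 0 g] by (metis zero_less_one)
    then have "norm a = 1" using ng by metis
    then have "g a = - a" using bdry[of a] nz measure_nonneg[of \<mu> "space \<mu>"] by (simp add: g_def)
    with a(2) have "a = - a" by simp
    then have "a = 0" by (simp add: prod_eq_iff complex_eq_iff)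
    then show False using \<open>norm a = 1\<close> by simp
  qed
  then obtain a where a: "norm a < 1" "H a = 0" by blast
  have "integrable \<mu> (mob a)" by (rule torfun_integrable_radon[OF \<mu> torfun_mob[OF a(1)]])
  then have "(\<integral>x. mob a x \<bullet> b \<partial>\<mu>) = H a \<bullet> b" for b
    unfolding H_def by (rule integral_inner_left)
  with a that show ?thesis by simp
qed

end

text \<open>\<open>Sup\<close> on the reals is the \<open>LEAST\<close> upper bound; two sets
  without any upper bound give the same predicate and hence the same value.\<close>

lemma Sup_real_not_bdd_above:
  fixes X :: "real set"
  assumes "\<not> bdd_above X" shows "Sup X = Sup UNIV"
proof -
  have "(\<forall>x\<in>X. x \<le> z) = (\<forall>x\<in>UNIV. x \<le> z)" for z
    using assms by (meson UNIV_I bdd_aboveI gt_ex not_le)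
  then show ?thesis by (simp add: Sup_real_def)
qed

context rhombic_torus
begin

section \<open>Admissible measures have no atoms\<close>

lemma vol_no_atom:
  assumes \<rho>: "\<rho> \<in> conformal_class c d" and p: "p \<in> dom"
  shows "measure (vol c d \<rho>) {p} = 0"
proof -
  have p': "{p} \<in> sets (restrict_space lborel dom)" using p by (auto simp: sets_restrict_space_iff)
  have "AE x in restrict_space lborel dom. x \<noteq> p"
    using AE_lborel_singleton[of p] by (subst AE_restrict_space_iff) auto
  then have "(\<integral>\<^sup>+x. ennreal (\<rho> x / d) * indicator {p} x \<partial>restrict_space lborel dom) = 0"
    by (subst nn_integral_cong_AE[where v = "\<lambda>_. 0"]) (auto elim!: eventually_mono)
  moreover have "(\<lambda>x. ennreal (\<rho> x / d)) \<in> borel_measurable (restrict_space lborel dom)"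
    using conformal_classD(1)[OF \<rho>, THEN smooth_torusD(1), THEN smooth_continuous, of UNIV] 
    by (intro measurable_restrict_space1) (auto intro!: borel_measurable_continuous_onI measurable_compose[OF _ measurable_ennreal] continuous_intros simp: d0[THEN less_imp_neq, symmetric])
  ultimately have "emeasure (vol c d \<rho>) {p} = 0"
    unfolding vol_def using p' by (subst emeasure_density) auto
  then show ?thesis by (simp add: measure_def)
qed

section \<open>Orthogonality of real trigonometric polynomials\<close>

lemma cc_mult: "cc k z x * cc j w x = Re (ch (k + j) x * (cnj z * cnj w) + ch (k - j) x * (cnj z * w)) / 2"
proof -
  have *: "(u \<bullet> z) * (v \<bullet> w) = Re (u * v * (cnj z * cnj w) + u * cnj v * (cnj z * w)) / 2" for u v :: complex
    by (simp add: inner_complex_def algebra_simps)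
  show ?thesis
    unfolding cc_def * ch_cnj ch_add[symmetric] by simp
qed

text \<open>Of the two frequencies in the product formula, k + j is excluded by assumption, so a
  contribution arises only from k - j = 0.\<close>

lemma integral_cc_mult:
  assumes "k + j \<noteq> 0"
  shows "(\<integral>x. cc k z x * cc j w x \<partial>V) = (if k = j then Re (cnj z * w) / 2 else 0)"
proof -
  have t: "torfun (\<lambda>x. ch l x * u)" for l u by (intro torfun_mult torfun_ch torfun_const)
  have "(\<integral>x. cc k z x * cc j w x \<partial>V) = Re (\<integral>x. ch (k + j) x * (cnj z * cnj w) + ch (k - j) x * (cnj z * w) \<partial>V) / 2"
    unfolding cc_mult by (simp only: integral_divide_zero integral_Re[OF torfun_integrable[OF torfun_add[OF t t]]])
  also have "(\<integral>x. ch (k + j) x * (cnj z * cnj w) + ch (k - j) x * (cnj z * w) \<partial>V)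
      = (\<integral>x. ch (k + j) x \<partial>V) * (cnj z * cnj w) + (\<integral>x. ch (k - j) x \<partial>V) * (cnj z * w)"
    using torfun_integrable[OF t] by (simp only: Bochner_Integration.integral_add integral_mult_left_zero)
  finally show ?thesis using assms by (cases "k = j") (simp_all add: integral_ch)
qed

definition trig :: "'i set \<Rightarrow> ('i \<Rightarrow> real) \<Rightarrow> ('i \<Rightarrow> freq) \<Rightarrow> ('i \<Rightarrow> complex) \<Rightarrow> plane \<Rightarrow> real" where
  "trig I a k z x = (\<Sum>i\<in>I. a i * cc (k i) (z i) x)"

lemma smooth_torus_trig_poly: "finite I \<Longrightarrow> trig I a k z \<in> smooth_torus c d"
proof (induction I rule: finite_induct)
  case empty
  then show ?case using smooth_torus_const[of 0] by (simp add: trig_def[abs_def])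
next
  case (insert i I)
  have "(\<lambda>x. a i * cc (k i) (z i) x + trig I a k z x) \<in> smooth_torus c d"
    by (intro smooth_torus_add smooth_torus_cmult smooth_torus_cc insert)
  then show ?case using insert by (simp add: trig_def[abs_def])
qed

lemma dird_trig: "dird v (trig I a k z) x = trig I (\<lambda>i. a i * ph (k i) v) k (\<lambda>i. - \<i> * z i) x"
proof -
  have "(trig I a k z has_derivative (\<lambda>v. \<Sum>i\<in>I. a i * (ph (k i) v * cc (k i) (- \<i> * z i) x))) (at x)"
    unfolding trig_def[abs_def] by (intro has_derivative_sum has_derivative_mult_right has_derivative_cc)
  from dird_eq[OF this] show ?thesis by (simp add: trig_def mult.assoc)
qed

lemma integral_trig_square:
  assumes I: "finite I" "inj_on k I" "\<And>i j. i \<in> I \<Longrightarrow> j \<in> I \<Longrightarrow> k i + k j \<noteq> 0"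
  shows "(\<integral>x. (trig I a k z x)\<^sup>2 \<partial>V) = (\<Sum>i\<in>I. (a i)\<^sup>2 * (norm (z i))\<^sup>2) / 2"
proof -
  have int: "integrable V (\<lambda>x. a i * a j * (cc (k i) (z i) x * cc (k j) (z j) x))" for i j
    by (intro torfun_integrable torfun_mult torfun_const torfun_smooth smooth_torus_cc)
  have "(trig I a k z x)\<^sup>2 = (\<Sum>i\<in>I. \<Sum>j\<in>I. a i * a j * (cc (k i) (z i) x * cc (k j) (z j) x))" for x
    unfolding trig_def power2_eq_square sum_product by (simp add: mult_ac)
  then have "(\<integral>x. (trig I a k z x)\<^sup>2 \<partial>V) = (\<Sum>i\<in>I. \<Sum>j\<in>I. a i * a j * (\<integral>x. cc (k i) (z i) x * cc (k j) (z j) x \<partial>V))"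
    using int by (simp add: Bochner_Integration.integral_sum)
  also have "\<dots> = (\<Sum>i\<in>I. \<Sum>j\<in>I. if i = j then (a i)\<^sup>2 * (norm (z i))\<^sup>2 / 2 else 0)"
  proof (intro sum.cong refl)
    fix i j assume ij: "i \<in> I" "j \<in> I"
    have "Re (cnj u * u) = (norm u)\<^sup>2" for u unfolding cmod_power2 by (simp add: power2_eq_square)
    then show "a i * a j * (\<integral>x. cc (k i) (z i) x * cc (k j) (z j) x \<partial>V) = (if i = j then (a i)\<^sup>2 * (norm (z i))\<^sup>2 / 2 else 0)"
      using ij I(2,3) by (simp only: integral_cc_mult[OF I(3)[OF ij]]) (auto simp: inj_on_def power2_eq_square)
  qed
  also have "\<dots> = (\<Sum>i\<in>I. (a i)\<^sup>2 * (norm (z i))\<^sup>2) / 2"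
    using I(1) by (simp add: sum.delta' sum_divide_distrib)
  finally show ?thesis .
qed

text \<open>Differentiation keeps the frequencies and rescales the amplitudes, so orthogonality
  applies to both partial derivatives, and \<open>q_eq\<close> combines the phase factors.\<close>

lemma en_trig:
  assumes I: "finite I" "inj_on k I" "\<And>i j. i \<in> I \<Longrightarrow> j \<in> I \<Longrightarrow> k i + k j \<noteq> 0"
  shows "en (trig I a k z) (trig I a k z) = (\<Sum>i\<in>I. (a i)\<^sup>2 * q (k i) * (norm (z i))\<^sup>2) / 2"
proof -
  let ?D = "\<lambda>v x. trig I (\<lambda>i. a i * ph (k i) v) k (\<lambda>i. - \<i> * z i) x"
  have int: "integrable V (\<lambda>x. (?D v x)\<^sup>2)" for v
    unfolding power2_eq_square by (intro torfun_integrable torfun_mult torfun_smooth smooth_torus_trig_poly I)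
  have "en (trig I a k z) (trig I a k z) = (\<integral>x. d * ((?D (1,0) x)\<^sup>2 + (?D (0,1) x)\<^sup>2) \<partial>V)"
    by (simp add: en_def gr_def dird_trig power2_eq_square)
  also have "\<dots> = d * ((\<integral>x. (?D (1,0) x)\<^sup>2 \<partial>V) + (\<integral>x. (?D (0,1) x)\<^sup>2 \<partial>V))"
    using int by simp
  also have "\<dots> = d * ((\<Sum>i\<in>I. (a i * ph (k i) (1,0))\<^sup>2 * (norm (- \<i> * z i))\<^sup>2) / 2
      + (\<Sum>i\<in>I. (a i * ph (k i) (0,1))\<^sup>2 * (norm (- \<i> * z i))\<^sup>2) / 2)"
    by (intro arg_cong2[where f = "\<lambda>s t. d * (s + t)"] integral_trig_square I)
  also have "\<dots> = (\<Sum>i\<in>I. (a i)\<^sup>2 * q (k i) * (norm (z i))\<^sup>2) / 2"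
    unfolding q_eq by (simp add: sum_distrib_left norm_mult power_mult_distrib algebra_simps flip: sum.distrib add_divide_distrib)
  finally show ?thesis .
qed

lemma W12_norm_smooth:
  "W12_norm c d f (eucl_grad f) = sqrt ((\<integral>x. (f x)\<^sup>2 \<partial>V) + en f f)"
  by (simp add: W12_norm_def dirichlet_energy_eq[symmetric] dirichlet_energy_def)

lemma smooth_in_W12:
  assumes f: "f \<in> smooth_torus c d" shows "(f, eucl_grad f) \<in> W12 c d"
proof -
  have t: "torfun f" "torfun (dird v f)" for v using f by (auto intro: torfun_smooth smooth_torus_dird)
  have g: "torfun (eucl_grad f)"
    using t(2) unfolding torfun_def periodic_def eucl_grad_eq by (auto intro: continuous_intros)
  have "torfun (\<lambda>x. (norm (f x))\<^sup>2)" "torfun (\<lambda>x. (norm (eucl_grad f x))\<^sup>2)"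
    using t(1) g unfolding torfun_def periodic_def by (auto intro!: continuous_intros)
  then have "f \<in> L2 V" "eucl_grad f \<in> L2 V"
    unfolding L2_def using torfun_measurable[OF radon_V] torfun_integrable t(1) g by blast+
  moreover have "W12_norm c d (f - f) (eucl_grad f - eucl_grad f) = 0" by (simp add: W12_norm_def)
  ultimately show ?thesis
    unfolding W12_def using f t g by (auto simp: torfun_def intro!: exI[of _ "\<lambda>_. f"])
qed

text \<open>Points have zero capacity: the logarithmically divergent sums \<open>\<Sum> cos (k (x - p)) / |k|\<^sup>2\<close>,
  suitably normalised, are bounded in \<open>W\<^sup>1\<^sup>,\<^sup>2\<close> and blow up at \<open>p\<close>.\<close>

lemma peak_functions:
  obtains g :: "nat \<Rightarrow> plane \<Rightarrow> real" where "\<And>n. g n \<in> smooth_torus c d"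
    "bounded (range (\<lambda>n. W12_norm c d (g n) (eucl_grad (g n))))" "filterlim (\<lambda>n. (g n p)\<^sup>2) at_top sequentially"
proof -
  \<comment> \<open>With positive indices two frequencies never add up to zero, as orthogonality
    demands, and the mixed term of q has the favourable sign.\<close>
  define I :: "nat \<Rightarrow> (nat \<times> nat) set" where "I n = {1..Suc n} \<times> {1..Suc n}" for n
  define k :: "nat \<times> nat \<Rightarrow> freq" where "k i = (int (fst i), int (snd i))" for i
  define r :: "nat \<times> nat \<Rightarrow> real" where "r i = (real (fst i))\<^sup>2 + (real (snd i))\<^sup>2" for i
  define S where "S n = (\<Sum>i\<in>I n. 1 / r i)" for n
  have I: "finite (I n)" "inj_on k (I n)" "\<And>i j. i \<in> I n \<Longrightarrow> j \<in> I n \<Longrightarrow> k i + k j \<noteq> 0" for n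
    by (auto simp: I_def k_def inj_on_def prod_eq_iff)
  have r1: "r i \<ge> 1" if "i \<in> I n" for i n
  proof -
    have "real (fst i) \<ge> 1" using that by (auto simp: I_def)
    then have "(real (fst i))\<^sup>2 \<ge> 1" by simp
    then show ?thesis unfolding r_def by (meson add_increasing2 zero_le_power2)
  qed
  have Sharm: "S n \<ge> harm (Suc n) / 2" for n
  proof -
    have "harm (Suc n) / 2 = (\<Sum>i = 1..Suc n. 1 / (2 * real i))"
      unfolding harm_def sum_divide_distrib by (intro sum.cong) (auto simp: inverse_eq_divide)
    also have "\<dots> \<le> (\<Sum>i = 1..Suc n. \<Sum>j = 1..Suc n. 1 / r (i, j))"
    proof (rule sum_mono)
      fix i assume i: "i \<in> {1..Suc n}"
      \<comment> \<open>For fixed i the i terms with j \<le> i are each at least 1 / (2 i^2), which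
        leaves half of the harmonic series.\<close>
      have "1 / (2 * real i) = (\<Sum>j = 1..i. 1 / (2 * (real i)\<^sup>2))" using i by (simp add: power2_eq_square)
      also have "\<dots> \<le> (\<Sum>j = 1..i. 1 / r (i, j))"
      proof (rule sum_mono)
        fix j assume j: "j \<in> {1..i}"
        have "(real j)\<^sup>2 \<le> (real i)\<^sup>2" using j by (intro power_mono) auto
        moreover have "0 < r (i, j)" using r1[of "(i,j)" n] i j by (auto simp: I_def)
        ultimately show "1 / (2 * (real i)\<^sup>2) \<le> 1 / r (i, j)"
          using i by (intro divide_left_mono) (auto simp: r_def)
      qed
      also have "\<dots> \<le> (\<Sum>j = 1..Suc n. 1 / r (i, j))"
        using i by (intro sum_mono2) (auto simp: r_def)
      finally show "1 / (2 * real i) \<le> (\<Sum>j = 1..Suc n. 1 / r (i, j))" .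
    qed
    also have "\<dots> = S n" unfolding S_def I_def sum.cartesian_product by (intro sum.cong) auto
    finally show ?thesis .
  qed
  have Stop: "filterlim S at_top sequentially"
  proof (rule filterlim_at_top_mono)
    show "filterlim (\<lambda>n. 1 / 2 * harm (Suc n) :: real) at_top sequentially"
      by (rule filterlim_tendsto_pos_mult_at_top[OF tendsto_const _ filterlim_compose[OF harm_at_top filterlim_Suc]]) simp
    show "\<forall>\<^sub>F n in sequentially. 1 / 2 * harm (Suc n) \<le> S n" using Sharm by (intro always_eventually) simp
  qed
  have Spos: "S n > 0" for n
  proof -
    have "(0 :: real) < harm (Suc n)" by (rule harm_pos) simp
    then show ?thesis using Sharm[of n] by linarith
  qed
  \<comment> \<open>The amplitudes align all phases at p, where the value becomes
    \<open>sqrt (S n)\<close>, while the same normalisation keeps the W12 norm below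
    \<open>sqrt (1 + Lam)\<close>.\<close>
  define g where "g n = trig (I n) (\<lambda>i. 1 / (r i * sqrt (S n))) k (\<lambda>i. ch (k i) p)" for n
  show ?thesis
  proof
    show "g n \<in> smooth_torus c d" for n unfolding g_def using I by (intro smooth_torus_trig_poly)
    have gp: "g n p = sqrt (S n)" for n
    proof -
      have "g n p = (\<Sum>i\<in>I n. 1 / r i) / sqrt (S n)"
        unfolding g_def trig_def sum_divide_distrib
        by (intro sum.cong) (simp_all add: cc_def norm_ch[unfolded norm_eq_1])
      then show ?thesis using Spos[of n] by (simp add: S_def[symmetric] real_div_sqrt)
    qed
    show "filterlim (\<lambda>n. (g n p)\<^sup>2) at_top sequentially"
      using Stop Spos by (simp add: gp less_imp_le)
    have "(\<integral>x. (g n x)\<^sup>2 \<partial>V) + en (g n) (g n) \<le> 1 + Lam" for n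
    proof -
      have "(\<integral>x. (g n x)\<^sup>2 \<partial>V) + en (g n) (g n) = (\<Sum>i\<in>I n. (1 + q (k i)) / ((r i)\<^sup>2 * S n)) / 2"
      proof -
        have "(\<integral>x. (g n x)\<^sup>2 \<partial>V) = (\<Sum>i\<in>I n. (1 / (r i * sqrt (S n)))\<^sup>2 * (norm (ch (k i) p))\<^sup>2) / 2"
          unfolding g_def by (intro integral_trig_square I)
        moreover have "en (g n) (g n) = (\<Sum>i\<in>I n. (1 / (r i * sqrt (S n)))\<^sup>2 * q (k i) * (norm (ch (k i) p))\<^sup>2) / 2"
          unfolding g_def by (intro en_trig I)
        ultimately show ?thesis
          using Spos[of n] by (simp add: power_divide power_mult_distrib less_imp_le add_divide_distrib flip: sum.distrib)
      qed
      also have "\<dots> \<le> (\<Sum>i\<in>I n. (1 + Lam) * (1 / r i) / S n) / 2"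
      proof (intro divide_right_mono sum_mono)
        fix i assume i: "i \<in> I n"
        have "0 \<le> 2 * c * real (fst i) * real (snd i)" using c0 by simp
        then have "q (k i) \<le> Lam * r i"
          unfolding q_def k_def r_def using Lam_pos by (intro mult_left_mono) auto
        then have "1 + q (k i) \<le> (1 + Lam) * r i" using r1[OF i] by (simp add: distrib_right)
        then have "(1 + q (k i)) / (r i * (r i * S n)) \<le> (1 + Lam) * r i / (r i * (r i * S n))"
          using r1[OF i] Spos[of n] by (intro divide_right_mono mult_nonneg_nonneg) auto
        then show "(1 + q (k i)) / ((r i)\<^sup>2 * S n) \<le> (1 + Lam) * (1 / r i) / S n"
          using r1[OF i] by (simp add: power2_eq_square mult.assoc)
      qed simp
      also have "(\<Sum>i\<in>I n. (1 + Lam) * (1 / r i) / S n) = 1 + Lam"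
        using Spos[of n] by (simp only: sum_divide_distrib[symmetric] sum_distrib_left[symmetric] S_def[symmetric]) simp
      finally show ?thesis using Lam_pos by simp
    qed
    then have "norm (W12_norm c d (g n) (eucl_grad (g n))) \<le> sqrt (1 + Lam)" for n
      using en_nonneg[of "g n"] unfolding W12_norm_smooth by simp
    then show "bounded (range (\<lambda>n. W12_norm c d (g n) (eucl_grad (g n))))"
      unfolding bounded_iff by blast
  qed
qed

text \<open>Compactness makes a subsequence of the peak functions converge in L2 of \<mu>, hence
  stay bounded there. Since \<open>(g n p)^2 * measure \<mu> {p}\<close> is at most the squared norm
  of \<open>g n\<close>, an atom at p contradicts the blow-up.\<close>

lemma admissible_no_atom:
  assumes adm: "admissible c d \<mu>" and p: "p \<in> dom"
  shows "measure \<mu> {p} = 0"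
proof (rule ccontr)
  assume m0: "measure \<mu> {p} \<noteq> 0"
  have \<mu>: "radon_measure c d \<mu>" using adm by (simp add: admissible_def)
  interpret finite_measure \<mu> using \<mu> by (simp add: radon_measure_def)
  have pm: "{p} \<in> sets \<mu>" using \<mu> p by (auto simp: radon_measure_def sets_restrict_space_iff)
  have m: "measure \<mu> {p} > 0" using m0 by (simp add: zero_less_measure_iff)
  obtain T where T: "compact_W12_L2 c d \<mu> T" and Tf: "\<And>f. f \<in> smooth_torus c d \<Longrightarrow> AE x in \<mu>. T f x = f x"
    using adm unfolding admissible_def by blast
  obtain g :: "nat \<Rightarrow> plane \<Rightarrow> real" where g: "\<And>n. g n \<in> smooth_torus c d"
    "bounded (range (\<lambda>n. W12_norm c d (g n) (eucl_grad (g n))))" "filterlim (\<lambda>n. (g n p)\<^sup>2) at_top sequentially"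
    using peak_functions by blast
  have W: "(g n, eucl_grad (g n)) \<in> W12 c d" for n by (rule smooth_in_W12[OF g(1)])
  obtain w r where w: "w \<in> L2 \<mu>" and r: "strict_mono r" and lim: "(\<lambda>n. \<integral>x. (T (g (r n)) x - w x)\<^sup>2 \<partial>\<mu>) \<longlonglongrightarrow> 0"
  proof -
    have "(\<forall>n. (g n, eucl_grad (g n)) \<in> W12 c d) \<and> bounded (range (\<lambda>n. W12_norm c d (g n) (eucl_grad (g n))))"
      using W g(2) by blast
    moreover have "\<forall>u G. (\<forall>n :: nat. (u n, G n) \<in> W12 c d) \<and> bounded (range (\<lambda>n. W12_norm c d (u n) (G n))) \<longrightarrow>
        (\<exists>w\<in>L2 \<mu>. \<exists>r. strict_mono r \<and> (\<lambda>n. \<integral>x. (T (u (r n)) x - w x)\<^sup>2 \<partial>\<mu>) \<longlonglongrightarrow> 0)"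
      using T unfolding compact_W12_L2_def by (elim conjE)
    ultimately have "\<exists>w\<in>L2 \<mu>. \<exists>r. strict_mono r \<and> (\<lambda>n. \<integral>x. (T (g (r n)) x - w x)\<^sup>2 \<partial>\<mu>) \<longlonglongrightarrow> 0"
      by (elim allE[of _ g] allE[of _ "\<lambda>n. eucl_grad (g n)"] mp)
    then show ?thesis using that by blast
  qed
  have wi: "w \<in> borel_measurable \<mu>" "integrable \<mu> (\<lambda>x. (w x)\<^sup>2)" using w by (auto simp: L2_def)
  have gi: "g n \<in> borel_measurable \<mu>" "integrable \<mu> (\<lambda>x. (g n x)\<^sup>2)" for n
    unfolding power2_eq_square
    by (intro torfun_measurable[OF \<mu>] torfun_integrable_radon[OF \<mu>] torfun_mult torfun_smooth g)+
  have Tm: "T (g n) \<in> borel_measurable \<mu>" for n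
  proof -
    have "g n \<in> fst ` W12 c d" using W[of n] by force
    then show ?thesis using T unfolding compact_W12_L2_def L2_def by blast
  qed
  have bound: "(g n p)\<^sup>2 * measure \<mu> {p} \<le> 2 * (\<integral>x. (T (g n) x - w x)\<^sup>2 \<partial>\<mu>) + 2 * (\<integral>x. (w x)\<^sup>2 \<partial>\<mu>)" for n
  proof -
    have sq: "(s - t)\<^sup>2 \<le> 2 * s\<^sup>2 + 2 * t\<^sup>2" "s\<^sup>2 \<le> 2 * (s - t)\<^sup>2 + 2 * t\<^sup>2" for s t :: real
    proof -
      have "0 \<le> (s + t)\<^sup>2" "0 \<le> (s - 2 * t)\<^sup>2" by simp_all
      then show "(s - t)\<^sup>2 \<le> 2 * s\<^sup>2 + 2 * t\<^sup>2" "s\<^sup>2 \<le> 2 * (s - t)\<^sup>2 + 2 * t\<^sup>2"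
        by (simp_all add: power2_eq_square algebra_simps)
    qed
    have gw: "integrable \<mu> (\<lambda>x. (g n x - w x)\<^sup>2)"
    proof (rule Bochner_Integration.integrable_bound)
      show "integrable \<mu> (\<lambda>x. 2 * (g n x)\<^sup>2 + 2 * (w x)\<^sup>2)" using gi wi by simp
      show "AE x in \<mu>. norm ((g n x - w x)\<^sup>2) \<le> norm (2 * (g n x)\<^sup>2 + 2 * (w x)\<^sup>2)"
        using sq(1) by (intro AE_I2) simp
    qed (use gi wi in measurable)
    have "(g n p)\<^sup>2 * measure \<mu> {p} = (\<integral>x. (g n p)\<^sup>2 * indicator {p} x \<partial>\<mu>)"
      using pm by simp
    also have "\<dots> \<le> (\<integral>x. (g n x)\<^sup>2 \<partial>\<mu>)"
      using pm gi by (intro integral_mono) (auto split: split_indicator simp: less_top[symmetric])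
    also have "\<dots> \<le> (\<integral>x. 2 * (g n x - w x)\<^sup>2 + 2 * (w x)\<^sup>2 \<partial>\<mu>)"
      using gi gw wi sq(2) by (intro integral_mono) auto
    also have "\<dots> = 2 * (\<integral>x. (g n x - w x)\<^sup>2 \<partial>\<mu>) + 2 * (\<integral>x. (w x)\<^sup>2 \<partial>\<mu>)"
      using gw wi by simp
    also have "(\<integral>x. (g n x - w x)\<^sup>2 \<partial>\<mu>) = (\<integral>x. (T (g n) x - w x)\<^sup>2 \<partial>\<mu>)"
      using Tf[OF g(1), of n] gi wi Tm by (intro integral_cong_AE) (auto elim!: eventually_mono)
    finally show ?thesis .
  qed
  define C where "C = (2 + 2 * (\<integral>x. (w x)\<^sup>2 \<partial>\<mu>)) / measure \<mu> {p}"
  have "\<forall>\<^sub>F n in sequentially. (\<integral>x. (T (g (r n)) x - w x)\<^sup>2 \<partial>\<mu>) < 1"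
    by (rule order_tendstoD(2)[OF lim]) simp
  then have "\<forall>\<^sub>F n in sequentially. (g (r n) p)\<^sup>2 \<le> C"
  proof eventually_elim
    case (elim n)
    then have "(g (r n) p)\<^sup>2 * measure \<mu> {p} \<le> 2 + 2 * (\<integral>x. (w x)\<^sup>2 \<partial>\<mu>)" using bound[of "r n"] by linarith
    then show ?case using m by (simp add: C_def pos_le_divide_eq)
  qed
  moreover have "\<forall>\<^sub>F n in sequentially. C < (g (r n) p)\<^sup>2"
    using filterlim_compose[OF g(3) filterlim_subseq[OF r]] by (auto simp: filterlim_at_top_dense)
  ultimately have "\<forall>\<^sub>F n in sequentially. False" by eventually_elim simp
  then show False by simp
qed

section \<open>The isoperimetric inequality\<close>

text \<open>Hersch's summation: over all coordinates the squares add up to |mob a|^2 = 1, so the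
  mass terms add up to the total mass and only the total energy matters.\<close>

lemma rayleigh_deficit:
  assumes \<mu>: "radon_measure c d \<mu>" and a: "norm a < 1"
  shows "(\<Sum>b\<in>Basis. en (\<lambda>x. mob a x \<bullet> b) (\<lambda>x. mob a x \<bullet> b) - \<nu> * (\<integral>x. (mob a x \<bullet> b)\<^sup>2 \<partial>\<mu>))
     \<le> Lam * (1 - (norm a)\<^sup>2 / 16) - \<nu> * measure \<mu> (space \<mu>)"
proof -
  interpret finite_measure \<mu> using \<mu> by (simp add: radon_measure_def)
  have int: "integrable \<mu> (\<lambda>x. (mob a x \<bullet> b)\<^sup>2)" for b
    unfolding power2_eq_square by (intro torfun_integrable_radon[OF \<mu>] torfun_mult torfun_smooth smooth_torus_mob a)
  have "(\<Sum>b\<in>Basis. \<integral>x. (mob a x \<bullet> b)\<^sup>2 \<partial>\<mu>) = (\<integral>x. (\<Sum>b\<in>Basis. (mob a x \<bullet> b)\<^sup>2) \<partial>\<mu>)"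
    using int by (intro Bochner_Integration.integral_sum[symmetric])
  also have "\<dots> = measure \<mu> (space \<mu>)"
    unfolding sum_Basis_inner_square using a by (simp add: norm_mob)
  finally have "(\<Sum>b\<in>Basis. \<nu> * (\<integral>x. (mob a x \<bullet> b)\<^sup>2 \<partial>\<mu>)) = \<nu> * measure \<mu> (space \<mu>)"
    by (simp add: sum_distrib_left[symmetric])
  with energy_mob_le[OF a] show ?thesis by (simp add: sum_subtractf)
qed

lemma nu_area_le:
  assumes \<rho>: "\<rho> \<in> conformal_class c d" shows "nu \<rho> * area c d \<rho> \<le> Lam"
proof -
  let ?\<mu> = "vol c d \<rho>"
  have \<mu>: "radon_measure c d ?\<mu>" by (rule radon_vol[OF \<rho>])
  have "measure ?\<mu> (space ?\<mu>) \<noteq> 0" using area_eq(1,3)[OF \<rho>] by simp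
  then obtain a where a: "norm a < 1" and bal: "\<And>b. (\<integral>x. mob a x \<bullet> b \<partial>?\<mu>) = 0"
    using balancing[OF \<mu>] vol_no_atom[OF \<rho>] by metis
  have "0 \<le> (\<Sum>b\<in>Basis. en (\<lambda>x. mob a x \<bullet> b) (\<lambda>x. mob a x \<bullet> b) - nu \<rho> * (\<integral>x. (mob a x \<bullet> b)\<^sup>2 \<partial>?\<mu>))"
    using rayleigh_bound_nu[OF \<rho>] smooth_torus_mob[OF a] bal by (intro sum_nonneg) (simp add: rayleigh_bound_def)
  also have "\<dots> \<le> Lam * (1 - (norm a)\<^sup>2 / 16) - nu \<rho> * measure ?\<mu> (space ?\<mu>)"
    by (rule rayleigh_deficit[OF \<mu> a])
  also have "\<dots> \<le> Lam * 1 - nu \<rho> * measure ?\<mu> (space ?\<mu>)"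
    using Lam_pos by (intro diff_right_mono mult_left_mono) auto
  finally show ?thesis using area_eq(1)[OF \<rho>] by simp
qed

lemma flat_in_class: "flat_metric \<in> conformal_class c d"
  using smooth_torus_const[of 1] by (simp add: conformal_class_def flat_metric_def)

lemma area_flat: "area c d flat_metric = 1"
  by (simp add: area_def measure_V)

text \<open>The lower bound is the Poincare inequality, and the upper bound is the isoperimetric
  inequality applied to the flat metric itself.\<close>

lemma flat_eigenvalue: "laplace_eigenvalue 1 c d flat_metric = Lam"
proof -
  have "nu flat_metric \<ge> Lam / 1" by (rule nu_ge[OF flat_in_class]) (simp add: flat_metric_def)
  moreover have "nu flat_metric \<le> Lam" using nu_area_le[OF flat_in_class] by (simp add: area_flat)
  ultimately have "nu flat_metric = Lam" by linarith
  with laplace_eigenvalue_eq[OF flat_in_class] show ?thesis by (rule trans)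
qed

lemma norm_eigenvalue_le: "\<rho> \<in> conformal_class c d \<Longrightarrow> norm_eigenvalue 1 c d \<rho> \<le> Lam"
  using nu_area_le laplace_eigenvalue_eq by (simp add: norm_eigenvalue_def)

lemma norm_eigenvalue_flat: "norm_eigenvalue 1 c d flat_metric = Lam"
  unfolding norm_eigenvalue_def flat_eigenvalue area_flat by simp

lemma conf_eigenvalue_eq: "conf_eigenvalue 1 c d = Lam"
  unfolding conf_eigenvalue_def
  by (rule cSup_eq_maximum) (use norm_eigenvalue_flat flat_in_class norm_eigenvalue_le in \<open>auto simp: image_iff intro!: bexI[of _ flat_metric]\<close>)

lemma conformally_maximal_flat: "conformally_maximal 1 c d flat_metric"
  unfolding conformally_maximal_def conical_conformal_class_def
  using regular_points_UNIV[OF flat_in_class] smooth_torusD(2)[OF conformal_classD(1)[OF flat_in_class]]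
  by (simp add: norm_eigenvalue_flat conf_eigenvalue_eq del: One_nat_def)

section \<open>Stability\<close>

text \<open>The infimum runs over possibly unbounded suprema, whose value is the same junk real \<open>Sup UNIV\<close>,
  so it is still taken over a set that is bounded below.\<close>

lemma rayleigh_bound_meas_eigenvalue:
  assumes \<mu>: "radon_measure c d \<mu>" and nz: "measure \<mu> (space \<mu>) \<noteq> 0"
  shows "rayleigh_bound (meas_eigenvalue 1 c d \<mu>) \<mu>"
  unfolding rayleigh_bound_def
proof (intro ballI impI)
  fix f assume f: "f \<in> smooth_torus c d" and f0: "(\<integral>x. f x \<partial>\<mu>) = 0"
  interpret finite_measure \<mu> using \<mu> by (simp add: radon_measure_def)
  let ?M = "measure \<mu> (space \<mu>)" and ?N = "\<integral>x. (f x)\<^sup>2 \<partial>\<mu>"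
  have int: "integrable \<mu> f" "integrable \<mu> (\<lambda>x. (f x)\<^sup>2)"
    unfolding power2_eq_square by (intro torfun_integrable_radon[OF \<mu>] torfun_smooth torfun_mult f)+
  have N0: "?N \<ge> 0" by (intro integral_nonneg_AE) simp
  have M: "?M > 0" using nz by (simp add: zero_less_measure_iff)
  show "meas_eigenvalue 1 c d \<mu> * ?N \<le> en f f"
  proof (cases "?N = 0")
    case True
    then show ?thesis using en_nonneg by simp
  next
    case False
    with N0 have N: "?N > 0" by linarith
    let ?h = "\<lambda>s t x. s * 1 + t * f x"
    \<comment> \<open>The span of 1 and f. As f has mean zero, mass and energy are both diagonal in
      s and t, and the quotient is largest at s = 0, where it is that of f.\<close>
    define E where "E = {?h s t | s t. True}"
    have hs: "?h s t \<in> smooth_torus c d" for s t by (intro smooth_torus_add smooth_torus_cmult smooth_torus_const f)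
    have hN: "(\<integral>x. (?h s t x)\<^sup>2 \<partial>\<mu>) = s\<^sup>2 * ?M + t\<^sup>2 * ?N" for s t
    proof -
      have "(?h s t x)\<^sup>2 = s\<^sup>2 + (2 * s * t) * f x + t\<^sup>2 * (f x)\<^sup>2" for x by (simp add: power2_eq_square algebra_simps)
      then show ?thesis using int f0 by simp
    qed
    have he: "en (?h s t) (?h s t) = t\<^sup>2 * en f f" for s t
    proof -
      have "en (\<lambda>x. 1) f = 0" "en (\<lambda>x. 1) (\<lambda>x. 1) = 0"
        using en_const[OF f, of 1] en_const[OF smooth_torus_const, of 1 1] en_sym[of f "\<lambda>x. 1"] by simp_all
      then show ?thesis using en_lincomb2[OF smooth_torus_const f, of s 1 t] by simp
    qed
    have h0: "s = 0 \<and> t = 0" if "(\<integral>x. (?h s t x)\<^sup>2 \<partial>\<mu>) = 0" for s t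
    proof -
      have "s\<^sup>2 * ?M + t\<^sup>2 * ?N = 0" using that hN by simp
      moreover have "s\<^sup>2 * ?M \<ge> 0" "t\<^sup>2 * ?N \<ge> 0" using M N by auto
      ultimately have "s\<^sup>2 * ?M = 0" "t\<^sup>2 * ?N = 0" by linarith+
      then show ?thesis using M N by simp
    qed
    have hne: "?h s t \<noteq> 0" if "s \<noteq> 0 \<or> t \<noteq> 0" for s t
    proof
      assume "?h s t = 0"
      then have "(?h s t x)\<^sup>2 = 0" for x by (simp add: fun_eq_iff)
      then show False using h0[of s t] that by simp
    qed
    let ?one = "(\<lambda>_. 1) :: plane \<Rightarrow> real"
    have Espan: "E = span {?one, f}"
    proof -
      have "u \<in> E \<longleftrightarrow> (\<exists>s t. u = s *\<^sub>R ?one + t *\<^sub>R f)" for u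
        by (simp add: E_def scaleR_fun_def plus_fun_def)
      moreover have "u \<in> span {?one, f} \<longleftrightarrow> (\<exists>s t. u = s *\<^sub>R ?one + t *\<^sub>R f)" for u
        unfolding span_insert span_singleton by (simp add: image_iff diff_eq_eq add.commute)
      ultimately show ?thesis by blast
    qed
    have "f \<noteq> 0" using hne[of 0 1] by simp
    moreover have "?one \<notin> span {f}"
    proof
      assume "?one \<in> span {f}"
      then obtain t where "?one = t *\<^sub>R f" by (auto simp: span_singleton)
      then have "?h 1 (- t) = 0" by (auto simp: fun_eq_iff scaleR_fun_def)
      then show False using hne[of 1 "- t"] by simp
    qed
    ultimately have ind: "independent {?one, f}"
      by (simp add: independent_insert)
    have "?one \<noteq> f" using \<open>?one \<notin> span {f}\<close> span_base[of f "{f}"] by auto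
    have "dim E = card {?one, f}"
      unfolding Espan real_vector.dim_span by (rule real_vector.dim_eq_card_independent[OF ind])
    then have dimE: "dim E = 1 + 1" using \<open>?one \<noteq> f\<close> by simp
    have "E \<in> test_subspaces 1 c d \<mu>"
      unfolding test_subspaces_def
    proof (intro CollectI conjI ballI impI)
      show "subspace E" unfolding Espan by (rule subspace_span)
      show "E \<subseteq> smooth_torus c d" using hs by (auto simp: E_def)
      show "dim E = 1 + 1" by (rule dimE)
      fix u assume "u \<in> E" and ae: "AE x in \<mu>. u x = 0"
      then obtain s t where u: "u = ?h s t" by (auto simp: E_def)
      have "AE x in \<mu>. (?h s t x)\<^sup>2 = 0" using ae unfolding u by eventually_elim simp
      then have "(\<integral>x. (?h s t x)\<^sup>2 \<partial>\<mu>) = 0" by (rule integral_eq_zero_AE)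
      from h0[OF this] show "u = 0" unfolding u by (simp add: zero_fun_def)
    qed
    moreover have "bdd_below ((\<lambda>E. SUP f\<in>E - {0}. dirichlet_energy c d f / (\<integral>x. (f x)\<^sup>2 \<partial>\<mu>)) ` test_subspaces 1 c d \<mu>)"
    proof (rule bdd_belowI2)
      fix E' assume "E' \<in> test_subspaces 1 c d \<mu>"
      then have E': "dim E' = 2" by (simp add: test_subspaces_def)
      have "E' - {0} \<noteq> {}"
      proof
        assume "E' - {0} = {}"
        then have "E' \<subseteq> span {}" by auto
        then have "dim E' \<le> card ({} :: (plane \<Rightarrow> real) set)" by (intro real_vector.dim_le_card) auto
        then show False using E' by simp
      qed
      then obtain u where u: "u \<in> E' - {0}" by blast
      let ?Q = "\<lambda>f. dirichlet_energy c d f / (\<integral>x. (f x)\<^sup>2 \<partial>\<mu>)"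
      show "min 0 (Sup UNIV) \<le> (SUP f\<in>E' - {0}. ?Q f)"
      proof (cases "bdd_above (?Q ` (E' - {0}))")
        case True
        have "0 \<le> ?Q u" unfolding dirichlet_energy_eq by (intro divide_nonneg_nonneg en_nonneg integral_nonneg_AE) simp
        also have "\<dots> \<le> (SUP f\<in>E' - {0}. ?Q f)" by (rule cSUP_upper[OF u True])
        finally show ?thesis by simp
      next
        case False
        then show ?thesis by (simp add: Sup_real_not_bdd_above)
      qed
    qed
    ultimately have "meas_eigenvalue 1 c d \<mu> \<le> (SUP f\<in>E - {0}. dirichlet_energy c d f / (\<integral>x. (f x)\<^sup>2 \<partial>\<mu>))"
      unfolding meas_eigenvalue_def by (intro cINF_lower)
    also have "\<dots> \<le> en f f / ?N"
    proof (rule cSUP_least)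
      have "?h 0 1 \<in> E" unfolding E_def by blast
      then show "E - {0} \<noteq> {}" using hne[of 0 1] by auto
      fix u assume u: "u \<in> E - {0}"
      then obtain s t where ust: "u = ?h s t" by (auto simp: E_def)
      have "s \<noteq> 0 \<or> t \<noteq> 0" using u ust by (auto simp: fun_eq_iff)
      then have pos: "s\<^sup>2 * ?M + t\<^sup>2 * ?N > 0"
        using M N by (auto intro: add_pos_nonneg add_nonneg_pos)
      have "en f f * (t\<^sup>2 * ?N) \<le> en f f * (s\<^sup>2 * ?M + t\<^sup>2 * ?N)"
        using M en_nonneg by (intro mult_left_mono) auto
      then show "dirichlet_energy c d u / (\<integral>x. (u x)\<^sup>2 \<partial>\<mu>) \<le> en f f / ?N"
        unfolding dirichlet_energy_eq ust he hN using pos N by (simp add: field_simps)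
    qed
    finally show ?thesis using N by (simp add: pos_le_divide_eq)
  qed
qed

text \<open>Differentiate |mob a|^2 = 1.\<close>

lemma mob_orthogonal_derivative:
  assumes a: "norm a < 1"
  shows "(\<Sum>b\<in>Basis. (mob a x \<bullet> b) * dird v (\<lambda>x. mob a x \<bullet> b) x) = 0"
proof -
  obtain D where D: "(mob a has_derivative D) (at x)" using has_derivative_mob[OF a] by blast
  have "((\<lambda>x. mob a x \<bullet> mob a x) has_derivative (\<lambda>v. mob a x \<bullet> D v + D v \<bullet> mob a x)) (at x)"
    by (rule has_derivative_inner[OF D D])
  moreover have "(\<lambda>x. mob a x \<bullet> mob a x) = (\<lambda>x. 1)"
    using norm_mob[of a] a by (auto simp: norm_eq_1[symmetric])
  ultimately have "((\<lambda>x. 1) has_derivative (\<lambda>v. mob a x \<bullet> D v + D v \<bullet> mob a x)) (at x)" by simp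
  from has_derivative_unique[OF this has_derivative_const]
  have "mob a x \<bullet> D v + D v \<bullet> mob a x = 0" by (rule fun_cong)
  then have "mob a x \<bullet> D v = 0" by (simp add: inner_commute)
  moreover have "dird v (\<lambda>x. mob a x \<bullet> b) x = D v \<bullet> b" for b
    by (rule dird_eq[OF has_derivative_inner_left[OF D]])
  ultimately show ?thesis by (simp add: euclidean_inner[of "mob a x" "D v"])
qed

text \<open>In the product rule the mixed terms pair \<open>mob a\<close> with its own derivative
  and drop out by orthogonality; |mob a| = 1 collapses what is left of the second sum.\<close>

lemma gr_mob_mult:
  assumes a: "norm a < 1" and f: "f \<in> smooth_torus c d"
  shows "(\<Sum>b\<in>Basis. gr (\<lambda>x. mob a x \<bullet> b) (\<lambda>x. f x * (mob a x \<bullet> b)) x) = f x * (Lam * (tau a x)\<^sup>2)"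
    and "(\<Sum>b\<in>Basis. gr (\<lambda>x. f x * (mob a x \<bullet> b)) (\<lambda>x. f x * (mob a x \<bullet> b)) x) = gr f f x + (f x)\<^sup>2 * (Lam * (tau a x)\<^sup>2)"
proof -
  let ?m = "\<lambda>b x. mob a x \<bullet> b"
  have dm: "dird v (\<lambda>x. f x * ?m b x) x = f x * dird v (?m b) x + dird v f x * ?m b x" for v b
    by (rule dird_mult_add(1)) (use f smooth_torus_mob[OF a] smooth_torusD(1) in auto)
  have one: "(\<Sum>b\<in>Basis. (?m b x)\<^sup>2) = 1"
    unfolding sum_Basis_inner_square using norm_mob[of a x] a by simp
  have orth: "(\<Sum>b\<in>Basis. ?m b x * dird v (?m b) x) = 0" for v by (rule mob_orthogonal_derivative[OF a])
  have "(\<Sum>b\<in>Basis. gr (?m b) (\<lambda>x. f x * ?m b x) x) =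
     (\<Sum>b\<in>Basis. f x * gr (?m b) (?m b) x + d * dird (1,0) f x * (?m b x * dird (1,0) (?m b) x) + d * dird (0,1) f x * (?m b x * dird (0,1) (?m b) x))"
    unfolding gr_def dm by (intro sum.cong) (auto simp: algebra_simps)
  also have "\<dots> = f x * (\<Sum>b\<in>Basis. gr (?m b) (?m b) x)"
    by (simp only: sum.distrib sum_distrib_left[symmetric] orth mult_zero_right add_0_right)
  finally show "(\<Sum>b\<in>Basis. gr (?m b) (\<lambda>x. f x * ?m b x) x) = f x * (Lam * (tau a x)\<^sup>2)"
    unfolding energy_density_mob[OF a] .
  have "(\<Sum>b\<in>Basis. gr (\<lambda>x. f x * ?m b x) (\<lambda>x. f x * ?m b x) x) =
     (\<Sum>b\<in>Basis. (f x)\<^sup>2 * gr (?m b) (?m b) x + gr f f x * (?m b x)\<^sup>2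
        + 2 * d * f x * dird (1,0) f x * (?m b x * dird (1,0) (?m b) x) + 2 * d * f x * dird (0,1) f x * (?m b x * dird (0,1) (?m b) x))"
    unfolding gr_def dm by (intro sum.cong) (auto simp: algebra_simps power2_eq_square)
  also have "\<dots> = (f x)\<^sup>2 * (\<Sum>b\<in>Basis. gr (?m b) (?m b) x) + gr f f x * (\<Sum>b\<in>Basis. (?m b x)\<^sup>2)"
    by (simp only: sum.distrib sum_distrib_left[symmetric] orth mult_zero_right add_0_right)
  finally show "(\<Sum>b\<in>Basis. gr (\<lambda>x. f x * ?m b x) (\<lambda>x. f x * ?m b x) x) = gr f f x + (f x)\<^sup>2 * (Lam * (tau a x)\<^sup>2)"
    unfolding energy_density_mob[OF a] one by simp
qed

text \<open>For |a| \<le> 1/2 the denominator \<open>wt\<close> is at least 1/4, so 0 \<le> tau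
  \<le> 4. The numerator of 1 - tau is at most 3 |a|, so |1 - tau| \<le> 12 |a|, and the factor 1 +
  tau \<le> 5 gives 60.\<close>

lemma tau_bounds:
  assumes a: "norm a \<le> 1 / 2"
  shows "(tau a x)\<^sup>2 \<le> 16" "\<bar>1 - (tau a x)\<^sup>2\<bar> \<le> 60 * norm a"
proof -
  define w where "w = wt a x"
  have "(1 / 2)\<^sup>2 \<le> (1 - norm a)\<^sup>2" using a by (intro power_mono) auto
  then have w: "w \<ge> 1 / 4" using wt_lower[of a x] a by (simp add: w_def power2_eq_square)
  have S: "(norm a)\<^sup>2 \<le> norm a / 2" using mult_left_mono[OF a, of "norm a"] by (simp add: power2_eq_square)
  have S1: "0 \<le> 1 - (norm a)\<^sup>2" using S a by linarith
  have t0: "0 \<le> tau a x" using S1 w by (simp add: tau_def w_def)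
  have t4: "tau a x \<le> 4"
  proof -
    have "tau a x \<le> 1 / (1/4)" unfolding tau_def w_def[symmetric] using w S1 by (intro frac_le) auto
    then show ?thesis by simp
  qed
  show "(tau a x)\<^sup>2 \<le> 16" using power_mono[OF t4 t0, of 2] by simp
  have "1 - tau a x = (w - (1 - (norm a)\<^sup>2)) / w" using w by (simp add: tau_def w_def diff_divide_distrib)
  also have "w - (1 - (norm a)\<^sup>2) = 2 * (norm a)\<^sup>2 - 2 * (Phi x \<bullet> a)" by (simp add: w_def wt_eq)
  finally have eq: "1 - tau a x = (2 * (norm a)\<^sup>2 - 2 * (Phi x \<bullet> a)) / w" .
  have "\<bar>Phi x \<bullet> a\<bar> \<le> norm a" using Cauchy_Schwarz_ineq2[of "Phi x" a] by (simp add: norm_Phi)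
  then have "\<bar>2 * (norm a)\<^sup>2 - 2 * (Phi x \<bullet> a)\<bar> \<le> 3 * norm a" using S zero_le_power2[of "norm a"] by linarith
  then have "\<bar>1 - tau a x\<bar> \<le> (3 * norm a) / (1/4)" unfolding eq abs_divide using w by (intro frac_le) auto
  then have "\<bar>1 - tau a x\<bar> * \<bar>1 + tau a x\<bar> \<le> (12 * norm a) * 5" using t0 t4 by (intro mult_mono) auto
  moreover have "1 - (tau a x)\<^sup>2 = (1 - tau a x) * (1 + tau a x)" by (simp add: power2_eq_square algebra_simps)
  ultimately show "\<bar>1 - (tau a x)\<^sup>2\<bar> \<le> 60 * norm a" by (simp add: abs_mult)
qed

text \<open>The first term is \<open>60 * Lam * norm a\<close> with |a| \<le> 4 sqrt (\<epsilon> /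
  Lam). The second collects four real coordinates, each with the energy bound 1 + 16
  \<open>Lam\<close> that comes from tau^2 \<le> 16.\<close>

definition C_stab :: real where "C_stab = 240 * sqrt Lam + 4 * sqrt (1 + 16 * Lam)"

lemma C_stab_pos: "C_stab > 0"
  unfolding C_stab_def using Lam_pos by (intro add_pos_pos) auto

text \<open>Testing the form \<open>en u v - \<nu> \<integral> u v d\<mu>\<close> between the balanced coordinates \<open>mob a \<bullet> b\<close> and
  \<open>f (mob a \<bullet> b)\<close> produces \<open>\<integral> f |\<nabla> mob a|\<^sup>2 - \<nu> \<integral> f d\<mu>\<close>, because \<open>|mob a| = 1\<close>.\<close>

lemma stability:
  assumes adm: "admissible c d \<mu>" and gap: "Lam - norm_meas_eigenvalue 1 c d \<mu> < Lam / 64"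
    and f: "f \<in> smooth_torus c d" and f1: "W12_norm c d f (eucl_grad f) = 1"
  defines "\<epsilon> \<equiv> Lam - norm_meas_eigenvalue 1 c d \<mu>"
  shows "\<epsilon> \<ge> 0" "Lam * (\<integral>x. f x \<partial>V) - meas_eigenvalue 1 c d \<mu> * (\<integral>x. f x \<partial>\<mu>) \<le> C_stab * sqrt \<epsilon>"
proof -
  define \<nu> where "\<nu> = meas_eigenvalue 1 c d \<mu>"
  define M where "M = measure \<mu> (space \<mu>)"
  have \<mu>: "radon_measure c d \<mu>" and nz: "measure \<mu> (space \<mu>) \<noteq> 0" using adm by (auto simp: admissible_def)
  interpret finite_measure \<mu> using \<mu> by (simp add: radon_measure_def)
  have M: "M > 0" using nz by (simp add: M_def zero_less_measure_iff)
  have \<epsilon>: "\<epsilon> = Lam - \<nu> * M" by (simp add: \<epsilon>_def norm_meas_eigenvalue_def \<nu>_def M_def)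
  have "\<nu> * M > 0" using gap Lam_pos \<epsilon> unfolding \<epsilon>_def by linarith
  then have \<nu>: "\<nu> \<ge> 0" using M by (simp add: zero_less_mult_iff)
  have rb: "rayleigh_bound \<nu> \<mu>" unfolding \<nu>_def by (rule rayleigh_bound_meas_eigenvalue[OF \<mu> nz])
  obtain a where a: "norm a < 1" and bal: "\<And>b. (\<integral>x. mob a x \<bullet> b \<partial>\<mu>) = 0"
    using balancing[OF \<mu> nz] admissible_no_atom[OF adm] by metis
  let ?m = "\<lambda>b x. mob a x \<bullet> b"
  have ms: "?m b \<in> smooth_torus c d" for b by (rule smooth_torus_mob[OF a])
  define Q where "Q b = en (?m b) (?m b) - \<nu> * (\<integral>x. (?m b x)\<^sup>2 \<partial>\<mu>)" for b
  have Q0: "Q b \<ge> 0" for b using rb ms bal unfolding Q_def rayleigh_bound_def by simp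
  have "(\<Sum>b\<in>Basis. Q b) \<le> Lam * (1 - (norm a)\<^sup>2 / 16) - \<nu> * M"
    unfolding Q_def M_def by (rule rayleigh_deficit[OF \<mu> a])
  then have SQ: "(\<Sum>b\<in>Basis. Q b) \<le> \<epsilon> - Lam * (norm a)\<^sup>2 / 16" by (simp add: \<epsilon> algebra_simps)
  have "(\<Sum>b\<in>Basis. Q b) \<ge> 0" using Q0 by (intro sum_nonneg)
  with SQ have a2: "Lam * (norm a)\<^sup>2 / 16 \<le> \<epsilon>" by linarith
  then show \<epsilon>0: "\<epsilon> \<ge> 0" using Lam_pos by (meson divide_nonneg_pos mult_nonneg_nonneg order_trans zero_le_power2 less_imp_le zero_less_numeral)
  have Qb: "Q b \<le> \<epsilon>" if "b \<in> Basis" for b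
  proof -
    have "Q b \<le> (\<Sum>b\<in>Basis. Q b)" using that Q0 by (intro member_le_sum) auto
    also have "\<dots> \<le> \<epsilon>" using SQ Lam_pos by (smt (verit) divide_nonneg_pos mult_nonneg_nonneg zero_le_power2)
    finally show ?thesis .
  qed
  \<comment> \<open>The threshold \<open>Lam / 64\<close> enters here, through 16/64 =
    (1/2)^2.\<close>
  have "Lam * (norm a)\<^sup>2 / 16 < Lam / 64" using a2 gap unfolding \<epsilon>_def by linarith
  then have "(norm a)\<^sup>2 < (1/2)\<^sup>2" using Lam_pos by (simp add: power2_eq_square field_simps)
  then have ahalf: "norm a \<le> 1 / 2" by (metis less_imp_le power2_less_imp_less zero_le_divide_1_iff zero_le_numeral)
  note tb = tau_bounds[OF ahalf]
  have fW: "(\<integral>x. (f x)\<^sup>2 \<partial>V) + en f f = 1"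
    using f1 unfolding W12_norm_smooth by (simp add: real_sqrt_eq_1_iff)
  have f2nn: "(\<integral>x. (f x)\<^sup>2 \<partial>V) \<ge> 0" by (intro integral_nonneg_AE) simp
  have f2: "(\<integral>x. (f x)\<^sup>2 \<partial>V) \<le> 1" using fW en_nonneg[of f] by linarith
  have tt: "torfun (\<lambda>x. (tau a x)\<^sup>2)"
  proof -
    have "(\<lambda>x. (1 - (norm a)\<^sup>2) * inverse (wt a x)) \<in> smooth_torus c d"
      using wt_pos[OF a] by (intro smooth_torus_cmult smooth_torus_inverse smooth_torus_wt) (metis less_irrefl)
    then have "torfun (tau a)" by (simp add: tau_def[abs_def] divide_inverse torfun_smooth)
    then show ?thesis unfolding power2_eq_square by (intro torfun_mult)
  qed
  have tf: "torfun f" by (rule torfun_smooth[OF f])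
  have tf2: "torfun (\<lambda>x. (f x)\<^sup>2)" unfolding power2_eq_square by (intro torfun_mult tf)
  note int = torfun_integrable
  have mV: "measure V (space V) = 1" using measure_V by (simp add: space_V)
  have fms: "(\<lambda>x. f x * ?m b x) \<in> smooth_torus c d" for b by (intro smooth_torus_mult f ms)

  have part1: "\<bar>\<integral>x. f x * (1 - (tau a x)\<^sup>2) \<partial>V\<bar> \<le> 60 * norm a"
  proof -
    have i1: "integrable V (\<lambda>x. f x * (1 - (tau a x)\<^sup>2))"
      by (intro int torfun_mult torfun_diff torfun_const tf tt)
    have i2: "integrable V (\<lambda>x. 60 * norm a * ((1 + (f x)\<^sup>2) / 2))"
      using int[OF tf2] int[OF torfun_const[of "1::real"]] by simp
    have "\<bar>\<integral>x. f x * (1 - (tau a x)\<^sup>2) \<partial>V\<bar> \<le> (\<integral>x. \<bar>f x * (1 - (tau a x)\<^sup>2)\<bar> \<partial>V)"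
      using integral_norm_bound[of V "\<lambda>x. f x * (1 - (tau a x)\<^sup>2)"] by simp
    also have "\<dots> \<le> (\<integral>x. 60 * norm a * ((1 + (f x)\<^sup>2) / 2) \<partial>V)"
    proof (rule integral_mono)
      fix x
      \<comment> \<open>This turns the L2 bound on f into an L1 bound by 1, as V has total mass
        1.\<close>
      have "2 * \<bar>f x\<bar> \<le> 1 + (f x)\<^sup>2" using zero_le_power2[of "1 - \<bar>f x\<bar>"] by (simp add: power2_diff)
      then have "\<bar>1 - (tau a x)\<^sup>2\<bar> * \<bar>f x\<bar> \<le> 60 * norm a * ((1 + (f x)\<^sup>2) / 2)"
        using tb(2)[of x] by (intro mult_mono) auto
      then show "\<bar>f x * (1 - (tau a x)\<^sup>2)\<bar> \<le> 60 * norm a * ((1 + (f x)\<^sup>2) / 2)" by (simp add: abs_mult mult.commute)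
    qed (use i1 i2 in auto)
    also have "\<dots> = 60 * norm a * ((1 + (\<integral>x. (f x)\<^sup>2 \<partial>V)) / 2)"
      using int[OF tf2] int[OF torfun_const[of "1::real"]] by (simp add: mV)
    also have "\<dots> \<le> 60 * norm a * 1" using f2 by (intro mult_left_mono) auto
    finally show ?thesis by simp
  qed

  have G: "en (\<lambda>x. f x * ?m b x) (\<lambda>x. f x * ?m b x) \<le> 1 + 16 * Lam" if "b \<in> Basis" for b
  proof -
    have "en (\<lambda>x. f x * ?m b x) (\<lambda>x. f x * ?m b x) \<le> (\<Sum>b\<in>Basis. en (\<lambda>x. f x * ?m b x) (\<lambda>x. f x * ?m b x))"
      using that en_nonneg by (intro member_le_sum) auto
    also have "\<dots> = (\<integral>x. (\<Sum>b\<in>Basis. gr (\<lambda>x. f x * ?m b x) (\<lambda>x. f x * ?m b x) x) \<partial>V)"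
      unfolding en_def by (intro Bochner_Integration.integral_sum[symmetric] int torfun_gr fms)
    also have "\<dots> = (\<integral>x. gr f f x + (f x)\<^sup>2 * (Lam * (tau a x)\<^sup>2) \<partial>V)"
      unfolding gr_mob_mult(2)[OF a f] ..
    also have "\<dots> \<le> (\<integral>x. gr f f x + 16 * Lam * (f x)\<^sup>2 \<partial>V)"
    proof (rule integral_mono)
      show "integrable V (\<lambda>x. gr f f x + (f x)\<^sup>2 * (Lam * (tau a x)\<^sup>2))"
        by (intro int torfun_add torfun_mult torfun_gr torfun_const f tf2 tt)
      show "integrable V (\<lambda>x. gr f f x + 16 * Lam * (f x)\<^sup>2)"
        by (intro int torfun_add torfun_mult torfun_gr torfun_const f tf2)
      show "gr f f x + (f x)\<^sup>2 * (Lam * (tau a x)\<^sup>2) \<le> gr f f x + 16 * Lam * (f x)\<^sup>2" for x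
        using mult_left_mono[OF tb(1)[of x], of "(f x)\<^sup>2 * Lam"] Lam_pos by (simp add: mult_ac)
    qed
    also have "\<dots> = en f f + 16 * Lam * (\<integral>x. (f x)\<^sup>2 \<partial>V)"
      using int[OF torfun_gr[OF f f]] int[OF tf2] by (simp add: en_def)
    also have "\<dots> \<le> 1 + 16 * Lam * 1"
    proof (intro add_mono mult_left_mono f2)
      show "en f f \<le> 1" using fW f2nn by linarith
    qed (use Lam_pos in simp)
    finally show ?thesis by simp
  qed

  define t where "t b = en (?m b) (\<lambda>x. f x * ?m b x) - \<nu> * (\<integral>x. ?m b x * (f x * ?m b x) \<partial>\<mu>)" for b
  have tb': "\<bar>t b\<bar> \<le> sqrt \<epsilon> * sqrt (1 + 16 * Lam)" if "b \<in> Basis" for b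
  proof -
    have "(t b)\<^sup>2 \<le> Q b * en (\<lambda>x. f x * ?m b x) (\<lambda>x. f x * ?m b x)"
      unfolding t_def Q_def by (rule rayleigh_cauchy_schwarz[OF \<mu> nz \<nu> rb ms bal fms])
    also have "\<dots> \<le> \<epsilon> * (1 + 16 * Lam)"
      using Qb[OF that] G[OF that] \<epsilon>0 en_nonneg by (intro mult_mono) auto
    finally have "sqrt ((t b)\<^sup>2) \<le> sqrt (\<epsilon> * (1 + 16 * Lam))" by (rule real_sqrt_le_mono)
    then show ?thesis by (simp add: real_sqrt_mult)
  qed
  have part2: "\<bar>\<Sum>b\<in>Basis. t b\<bar> \<le> 4 * (sqrt \<epsilon> * sqrt (1 + 16 * Lam))"
  proof -
    have "\<bar>\<Sum>b\<in>Basis. t b\<bar> \<le> (\<Sum>b\<in>(Basis :: (complex \<times> complex) set). \<bar>t b\<bar>)" by (rule sum_abs)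
    also have "\<dots> \<le> of_nat DIM(complex \<times> complex) * (sqrt \<epsilon> * sqrt (1 + 16 * Lam))"
      using tb' by (intro sum_bounded_above)
    finally show ?thesis by simp
  qed
  have sum_t: "(\<Sum>b\<in>Basis. t b) = Lam * (\<integral>x. f x * (tau a x)\<^sup>2 \<partial>V) - \<nu> * (\<integral>x. f x \<partial>\<mu>)"
  proof -
    have "(\<Sum>b\<in>Basis. en (?m b) (\<lambda>x. f x * ?m b x)) = (\<integral>x. (\<Sum>b\<in>Basis. gr (?m b) (\<lambda>x. f x * ?m b x) x) \<partial>V)"
      unfolding en_def by (intro Bochner_Integration.integral_sum[symmetric] int torfun_gr fms ms)
    also have "\<dots> = (\<integral>x. Lam * (f x * (tau a x)\<^sup>2) \<partial>V)"
      unfolding gr_mob_mult(1)[OF a f] by (simp add: mult_ac)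
    also have "\<dots> = Lam * (\<integral>x. f x * (tau a x)\<^sup>2 \<partial>V)" by simp
    finally have 1: "(\<Sum>b\<in>Basis. en (?m b) (\<lambda>x. f x * ?m b x)) = Lam * (\<integral>x. f x * (tau a x)\<^sup>2 \<partial>V)" .
    have "(\<Sum>b\<in>Basis. \<integral>x. ?m b x * (f x * ?m b x) \<partial>\<mu>) = (\<integral>x. (\<Sum>b\<in>Basis. ?m b x * (f x * ?m b x)) \<partial>\<mu>)"
      by (intro Bochner_Integration.integral_sum[symmetric] torfun_integrable_radon[OF \<mu>] torfun_smooth smooth_torus_mult f ms)
    also have "\<dots> = (\<integral>x. f x \<partial>\<mu>)"
    proof (intro Bochner_Integration.integral_cong refl)
      fix x
      have "(\<Sum>b\<in>Basis. ?m b x * (f x * ?m b x)) = f x * (\<Sum>b\<in>Basis. (?m b x)\<^sup>2)"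
        by (simp add: sum_distrib_left power2_eq_square mult_ac)
      then show "(\<Sum>b\<in>Basis. ?m b x * (f x * ?m b x)) = f x"
        unfolding sum_Basis_inner_square using norm_mob[of a x] a by simp
    qed
    finally have 2: "(\<Sum>b\<in>Basis. \<integral>x. ?m b x * (f x * ?m b x) \<partial>\<mu>) = (\<integral>x. f x \<partial>\<mu>)" .
    show ?thesis unfolding t_def sum_subtractf 1 sum_distrib_left[symmetric] 2 ..
  qed
  have split: "(\<integral>x. f x \<partial>V) = (\<integral>x. f x * (1 - (tau a x)\<^sup>2) \<partial>V) + (\<integral>x. f x * (tau a x)\<^sup>2 \<partial>V)"
  proof -
    have "integrable V (\<lambda>x. f x * (1 - (tau a x)\<^sup>2))" "integrable V (\<lambda>x. f x * (tau a x)\<^sup>2)"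
      by (intro int torfun_mult torfun_diff torfun_const tf tt)+
    from Bochner_Integration.integral_add[OF this] show ?thesis by (simp add: algebra_simps)
  qed
  have an: "Lam * (60 * norm a) \<le> 240 * sqrt Lam * sqrt \<epsilon>"
  proof -
    have "(Lam * norm a)\<^sup>2 = 16 * Lam * (Lam * (norm a)\<^sup>2 / 16)" by (simp add: power2_eq_square)
    also have "\<dots> \<le> 16 * Lam * \<epsilon>" using a2 Lam_pos by (intro mult_left_mono) auto
    finally have "sqrt ((Lam * norm a)\<^sup>2) \<le> sqrt (16 * Lam * \<epsilon>)" by (rule real_sqrt_le_mono)
    moreover have "sqrt 16 = 4" by (rule real_sqrt_unique) auto
    ultimately show ?thesis using Lam_pos by (simp add: real_sqrt_mult mult_ac)
  qed
  \<comment> \<open>The error consists of the deviation of tau^2 from 1, of order |a| and hence of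
    sqrt \<epsilon>, and of the four Cauchy-Schwarz terms.\<close>
  have "Lam * (\<integral>x. f x \<partial>V) - \<nu> * (\<integral>x. f x \<partial>\<mu>) = Lam * (\<integral>x. f x * (1 - (tau a x)\<^sup>2) \<partial>V) + (\<Sum>b\<in>Basis. t b)"
    unfolding split sum_t by (simp add: algebra_simps)
  also have "\<dots> \<le> Lam * (60 * norm a) + 4 * (sqrt \<epsilon> * sqrt (1 + 16 * Lam))"
    using part1 part2 Lam_pos by (intro add_mono mult_left_mono) auto
  also have "\<dots> \<le> C_stab * sqrt \<epsilon>" using an by (simp add: C_stab_def algebra_simps)
  finally show "Lam * (\<integral>x. f x \<partial>V) - meas_eigenvalue 1 c d \<mu> * (\<integral>x. f x \<partial>\<mu>) \<le> C_stab * sqrt \<epsilon>" by (simp add: \<nu>_def)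
qed

text \<open>The supremum is an extended real, so its upper bound can be squared only when W \<ge> 0
  is known. The constant 1 has W12 norm 1 and gives the functional the value \<epsilon> \<ge> 0,
  which supplies this.\<close>

lemma stability_Wm12:
  assumes adm: "admissible c d \<mu>" and gap: "Lam - norm_meas_eigenvalue 1 c d \<mu> < Lam / 64"
  shows "ereal (1 / C_stab\<^sup>2) * (Wm12_norm c d (\<lambda>f. Lam * (\<integral>x. f x \<partial>V) - meas_eigenvalue 1 c d \<mu> * (\<integral>x. f x \<partial>\<mu>)))\<^sup>2
    \<le> ereal (Lam - norm_meas_eigenvalue 1 c d \<mu>)"
proof -
  let ?\<sigma> = "\<lambda>f. Lam * (\<integral>x. f x \<partial>V) - meas_eigenvalue 1 c d \<mu> * (\<integral>x. f x \<partial>\<mu>)"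
  define \<epsilon> where "\<epsilon> = Lam - norm_meas_eigenvalue 1 c d \<mu>"
  define W where "W = Wm12_norm c d ?\<sigma>"
  let ?one = "(\<lambda>x. 1) :: plane \<Rightarrow> real"
  have one: "?one \<in> smooth_torus c d" by (rule smooth_torus_const)
  have mV: "measure V (space V) = 1" using measure_V by (simp add: space_V)
  have one1: "W12_norm c d ?one (eucl_grad ?one) = 1"
    unfolding W12_norm_smooth using en_const[OF one] by (simp add: mV)
  have \<epsilon>0: "\<epsilon> \<ge> 0" unfolding \<epsilon>_def by (rule stability(1)[OF adm gap one one1])
  have upper: "W \<le> ereal (C_stab * sqrt \<epsilon>)"
    unfolding W_def Wm12_norm_def \<epsilon>_def using stability(2)[OF adm gap] by (intro SUP_least) auto
  have "ereal (?\<sigma> ?one) \<le> W"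
    unfolding W_def Wm12_norm_def using one one1 by (intro SUP_upper) auto
  moreover have "?\<sigma> ?one = \<epsilon>" by (simp add: \<epsilon>_def norm_meas_eigenvalue_def mV)
  ultimately have W0: "0 \<le> W" using \<epsilon>0 by (metis ereal_less_eq(5) order_trans)
  have "W\<^sup>2 \<le> ereal (C_stab * sqrt \<epsilon>) * ereal (C_stab * sqrt \<epsilon>)"
    unfolding power2_eq_square using upper W0 C_stab_pos \<epsilon>0 by (intro ereal_mult_mono) auto
  also have "\<dots> = ereal (C_stab\<^sup>2 * \<epsilon>)" using \<epsilon>0 by (simp add: power2_eq_square)
  finally have "ereal (1 / C_stab\<^sup>2) * W\<^sup>2 \<le> ereal (1 / C_stab\<^sup>2) * ereal (C_stab\<^sup>2 * \<epsilon>)"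
    by (intro ereal_mult_left_mono) auto
  also have "\<dots> = ereal \<epsilon>" using C_stab_pos by simp
  finally show ?thesis by (simp add: W_def \<epsilon>_def)
qed

end

theorem proposition2p10:
  fixes c d :: real
  assumes "0 \<le> c" and "c \<le> 1/2" and "d > 0" and "c\<^sup>2 + d\<^sup>2 = 1"
  shows "(\<forall>g\<in>conformal_class c d. norm_eigenvalue 1 c d g \<le> laplace_eigenvalue 1 c d flat_metric) \<and>
    laplace_eigenvalue 1 c d flat_metric = conf_eigenvalue 1 c d \<and>
    (\<exists>\<delta>>0. \<exists>c\<^sub>0>0. \<forall>\<mu>. admissible c d \<mu> \<and>
        conf_eigenvalue 1 c d - norm_meas_eigenvalue 1 c d \<mu> < \<delta> \<longrightarrow>
        (\<exists>g_max. conformally_maximal 1 c d g_max \<and>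
           ereal (conf_eigenvalue 1 c d - norm_meas_eigenvalue 1 c d \<mu>) \<ge>
             ereal c\<^sub>0 * (Wm12_norm c d (\<lambda>f. laplace_eigenvalue 1 c d g_max * (\<integral>x. f x \<partial>vol c d g_max)
                               - meas_eigenvalue 1 c d \<mu> * (\<integral>x. f x \<partial>\<mu>)))\<^sup>2))"
proof -
  interpret rhombic_torus c d by unfold_locales (use assms in auto)
  have stab: "conformally_maximal 1 c d flat_metric \<and>
      ereal (1 / C_stab\<^sup>2) * (Wm12_norm c d (\<lambda>f. laplace_eigenvalue 1 c d flat_metric * (\<integral>x. f x \<partial>vol c d flat_metric)
        - meas_eigenvalue 1 c d \<mu> * (\<integral>x. f x \<partial>\<mu>)))\<^sup>2 \<le> ereal (Lam - norm_meas_eigenvalue 1 c d \<mu>)"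
    if "admissible c d \<mu>" "Lam - norm_meas_eigenvalue 1 c d \<mu> < Lam / 64" for \<mu>
    unfolding flat_eigenvalue using conformally_maximal_flat stability_Wm12[OF that] by blast
  have "\<exists>c\<^sub>0>0. \<forall>\<mu>. admissible c d \<mu> \<and> Lam - norm_meas_eigenvalue 1 c d \<mu> < Lam / 64 \<longrightarrow>
      (\<exists>g_max. conformally_maximal 1 c d g_max \<and>
         ereal (Lam - norm_meas_eigenvalue 1 c d \<mu>) \<ge>
           ereal c\<^sub>0 * (Wm12_norm c d (\<lambda>f. laplace_eigenvalue 1 c d g_max * (\<integral>x. f x \<partial>vol c d g_max)
             - meas_eigenvalue 1 c d \<mu> * (\<integral>x. f x \<partial>\<mu>)))\<^sup>2)"
    using stab C_stab_pos by (intro exI[of _ "1 / C_stab\<^sup>2"]) auto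
  moreover have "Lam / 64 > 0" using Lam_pos by simp
  ultimately show ?thesis
    unfolding flat_eigenvalue conf_eigenvalue_eq using norm_eigenvalue_le by blast
qed

end
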